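(* Let $\psi$ be the unique solution of the weak problem: $\psi \in L^2(0,T;H^2_0(\Omega))\cap L^\infty(0,T;H^1_0(\Omega))$, $\psi(0)=\psi_0$, and $$(\nabla \psi_t,\nabla\chi)+Re^{-1}(\Delta\psi,\Delta\chi)+b(\psi;\psi,\chi)-Ro^{-1}(\psi_x,\chi)=Ro^{-1}(F,\chi)\quad\forall \chi\in X=H^2_0(\Omega).$$ Let $\psi^h$ be its conforming finite element approximation: $\psi^h\in L^2(0,T;X^h)\cap L^\infty(0,T;H^1_0(\Omega))$, $\psi^h(0)=\psi^h_0$, and $$(\nabla \psi^h_t,\nabla\chi^h)+Re^{-1}(\Delta\psi^h,\Delta\chi^h)+b(\psi^h;\psi^h,\chi^h)-Ro^{-1}(\psi^h_x,\chi^h)=Ro^{-1}(F,\chi^h)\quad\forall \chi^h\in X^h.$$ Then $$\begin{aligned} \|\nabla(\psi-\psi^h)(T)\|^2 &+ Re^{-1}\int_0^T\|\Delta(\psi-\psi^h)\|^2\,dt \le C\Big\{\|\nabla(\psi-\psi^h)(0)\|^2\\ &+\inf_{\lambda^h:[0,T]\to X^h}\Big[\|\nabla(\psi-\lambda^h)(0)\|^2+\int_0^T\Big(\|\nabla(\psi-\lambda^h)_t\|^2+\|\Delta(\psi-\lambda^h)\|^2\Big)\,dt\\ &\qquad+\|\Delta(\psi-\lambda^h)\|^2_{L^4(0,T;L^2)}+\|\nabla(\psi-\lambda^h)(T)\|^2\Big]\Big\}, \end{aligned}$$ where $C$ is a positive constant which can depend on $T,F,\psi_0,Re,Ro,\Gamma_0,\Gamma_1,\Gamma_2,\Gamma_3,\Gamma_4$,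 but not on the mesh size $h$.
   Context: $\Omega\subset\mathbb{R}^2$ is a bounded open rectangular domain with coordinates $(x,y)$; $T>0$; $Re>0$ and $Ro>0$ are constants (Reynolds and Rossby numbers). $(\cdot,\cdot)$ and $\|\cdot\|$ are the $L^2(\Omega)$ inner product (extended to the duality pairing for $(F,\chi)$) and norm. $X:=H^2_0(\Omega)=\{\psi\in H^2(\Omega):\psi=\partial\psi/\partial\mathbf{n}=0\text{ on }\partial\Omega\}$. $|v|_2$ is the $H^2$ seminorm; on $X$ one has $|v|_2=\|\Delta v\|$, which is a norm on $X$. Subscripts $t,x,y$ on functions denote partial derivatives. The variational equations hold for (almost every) time in $(0,T)$. The spaces are $L^2(0,T;H^2_0(\Omega))=\{\psi:[0,T]\to H^2_0(\Omega):\int_0^T\|\Delta\psi\|^2dt<\infty\}$ and $L^\infty(0,T;H^1_0(\Omega))=\{\psi:[0,T]\to H^1_0(\Omega):\operatorname{ess\,sup}_{0<t<T}\|\nabla\psi\|<\infty\}$; $\|g\|_{L^4(0,T;L^2)}=(\int_0^T\|g(t)\|^4dt)^{1/4}$. The trilinear form is $b(\xi;\psi,\chi)=\int_\Omega\Delta\xi\,(\psi_y\chi_x-\psi_x\chi_y)\,d\mathbf{x}$. The dual norm is $\|F\|_{-2}=\sup_{v\in H^2_0(\Omega),\,v\neq0}(F,v)/|v|_2$. Standing assumptions: $t\mapsto\|F(t)\|_{-2}$ is in $L^2(0,T)$; the problem for $\psi$ has a unique solution and it satisfies $\int_0^T\|\Delta\psi\|^4dt<\infty$; $X^h\subset X$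 is a (conforming) finite element space of piecewise polynomials on a triangulation of $\Omega$ with mesh size (maximum triangle diameter) $h$; $\psi^h_0\in X^h$ is the finite element initial condition; the discrete problem has a unique solution $\psi^h$. $\Gamma_0,\dots,\Gamma_4$ are positive constants such that for all $\psi,\varphi,\chi\in X$: $\|\nabla\psi\|\le\Gamma_0\|\Delta\psi\|$; $b(\psi;\varphi,\chi)\le\Gamma_1|\psi|_2|\varphi|_2|\chi|_2$; $(\psi_x,\chi)\le\Gamma_2|\psi|_2|\chi|_2$; $b(\psi;\varphi,\chi)\le\Gamma_3\|\Delta\psi\|\|\Delta\varphi\|\|\nabla\chi\|^{1/2}\|\Delta\chi\|^{1/2}$; $b(\psi;\varphi,\chi)\le\Gamma_4\|\nabla\psi\|^{1/2}\|\Delta\psi\|^{1/2}\|\Delta\varphi\|\|\Delta\chi\|$. The infimum is over those $\lambda^h:[0,T]\to X^h$ for which the bracketed expression is defined. *)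

theory Defs
  imports "HOL-Analysis.Analysis"
begin

section \<open>Smooth functions and test functions on the plane\<close>

type_synonym plane = "real \<times> real"

definition cpd :: "plane \<Rightarrow> (plane \<Rightarrow> real) \<Rightarrow> plane \<Rightarrow> real" where
  "cpd e f p = frechet_derivative f (at p) e"

primrec C_diff :: "nat \<Rightarrow> (plane \<Rightarrow> real) \<Rightarrow> bool" where
  "C_diff 0 f \<longleftrightarrow> continuous_on UNIV f"
| "C_diff (Suc k) f \<longleftrightarrow> (\<forall>p. f differentiable (at p)) \<and> C_diff k (cpd (1, 0) f) \<and> C_diff k (cpd (0, 1) f)"

definition smooth :: "(plane \<Rightarrow> real) \<Rightarrow> bool" where
  "smooth f \<longleftrightarrow> (\<forall>k. C_diff k f)"

definition test_functions :: "plane set \<Rightarrow> (plane \<Rightarrow> real) set" where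
  "test_functions \<Omega> =
     {\<phi>. smooth \<phi> \<and> compact (closure {p. \<phi> p \<noteq> 0}) \<and> closure {p. \<phi> p \<noteq> 0} \<subseteq> \<Omega>}"


section \<open>Lebesgue and Sobolev spaces\<close>

text \<open>
  Elements of the function spaces are functions on the whole plane. Only their values on
  \<open>\<Omega>\<close> matter, and two functions that agree almost everywhere on \<open>\<Omega>\<close> represent the same element.
\<close>

definition L2 :: "plane set \<Rightarrow> (plane \<Rightarrow> 'a::euclidean_space) set" where
  "L2 \<Omega> = {f. f \<in> borel_measurable (lebesgue_on \<Omega>) \<and> integrable (lebesgue_on \<Omega>) (\<lambda>p. (norm (f p))\<^sup>2)}"

definition ip :: "plane set \<Rightarrow> (plane \<Rightarrow> 'a::euclidean_space) \<Rightarrow> (plane \<Rightarrow> 'a) \<Rightarrow> real" where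
  "ip \<Omega> f g = (LINT p|lebesgue_on \<Omega>. f p \<bullet> g p)"

definition nrm :: "plane set \<Rightarrow> (plane \<Rightarrow> 'a::euclidean_space) \<Rightarrow> real" where
  "nrm \<Omega> f = sqrt (ip \<Omega> f f)"

definition weak_partial :: "plane set \<Rightarrow> plane \<Rightarrow> (plane \<Rightarrow> real) \<Rightarrow> (plane \<Rightarrow> real) \<Rightarrow> bool" where
  "weak_partial \<Omega> e f g \<longleftrightarrow> f \<in> L2 \<Omega> \<and> g \<in> L2 \<Omega> \<and>
     (\<forall>\<phi>\<in>test_functions \<Omega>. ip \<Omega> f (cpd e \<phi>) = - ip \<Omega> g \<phi>)"

text \<open>Weak derivatives are unique up to null sets; a representative is chosen.\<close>

definition wpd :: "plane set \<Rightarrow> plane \<Rightarrow> (plane \<Rightarrow> real) \<Rightarrow> plane \<Rightarrow> real" where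
  "wpd \<Omega> e f = (SOME g. weak_partial \<Omega> e f g)"

abbreviation dx :: "plane set \<Rightarrow> (plane \<Rightarrow> real) \<Rightarrow> plane \<Rightarrow> real" where
  "dx \<Omega> \<equiv> wpd \<Omega> (1, 0)"

abbreviation dy :: "plane set \<Rightarrow> (plane \<Rightarrow> real) \<Rightarrow> plane \<Rightarrow> real" where
  "dy \<Omega> \<equiv> wpd \<Omega> (0, 1)"

definition grad :: "plane set \<Rightarrow> (plane \<Rightarrow> real) \<Rightarrow> plane \<Rightarrow> plane" where
  "grad \<Omega> f p = (dx \<Omega> f p, dy \<Omega> f p)"

definition lap :: "plane set \<Rightarrow> (plane \<Rightarrow> real) \<Rightarrow> plane \<Rightarrow> real" where
  "lap \<Omega> f p = dx \<Omega> (dx \<Omega> f) p + dy \<Omega> (dy \<Omega> f) p"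

definition H1 :: "plane set \<Rightarrow> (plane \<Rightarrow> real) set" where
  "H1 \<Omega> = {f. f \<in> L2 \<Omega> \<and> (\<exists>g. weak_partial \<Omega> (1, 0) f g) \<and> (\<exists>g. weak_partial \<Omega> (0, 1) f g)}"

definition H2 :: "plane set \<Rightarrow> (plane \<Rightarrow> real) set" where
  "H2 \<Omega> = {f. f \<in> H1 \<Omega> \<and> dx \<Omega> f \<in> H1 \<Omega> \<and> dy \<Omega> f \<in> H1 \<Omega>}"

text \<open>
  The \<open>H\<^sup>2\<close> seminorm is the \<open>L\<^sup>2\<close> norm of the Hessian, so the mixed derivative is counted twice;
  this is the normalisation for which it equals \<open>\<parallel>\<Delta>v\<parallel>\<close> on \<open>H\<^sup>2\<^sub>0\<close>.
\<close>

definition semi2 :: "plane set \<Rightarrow> (plane \<Rightarrow> real) \<Rightarrow> real" where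
  "semi2 \<Omega> v = sqrt ((nrm \<Omega> (dx \<Omega> (dx \<Omega> v)))\<^sup>2 + (nrm \<Omega> (dy \<Omega> (dx \<Omega> v)))\<^sup>2
                   + (nrm \<Omega> (dx \<Omega> (dy \<Omega> v)))\<^sup>2 + (nrm \<Omega> (dy \<Omega> (dy \<Omega> v)))\<^sup>2)"

definition H1_norm :: "plane set \<Rightarrow> (plane \<Rightarrow> real) \<Rightarrow> real" where
  "H1_norm \<Omega> v = sqrt ((nrm \<Omega> v)\<^sup>2 + (nrm \<Omega> (grad \<Omega> v))\<^sup>2)"

definition H2_norm :: "plane set \<Rightarrow> (plane \<Rightarrow> real) \<Rightarrow> real" where
  "H2_norm \<Omega> v = sqrt ((nrm \<Omega> v)\<^sup>2 + (nrm \<Omega> (grad \<Omega> v))\<^sup>2 + (semi2 \<Omega> v)\<^sup>2)"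


section \<open>Boundary conditions on the rectangle\<close>

text \<open>
  From here on the domain is the rectangle \<open>box a b\<close>. Its boundary consists of four sides, which
  carry arc length. The value of \<open>outer_normal\<close> at the four corners is irrelevant.
\<close>

definition boundary_integral :: "plane \<Rightarrow> plane \<Rightarrow> (plane \<Rightarrow> real) \<Rightarrow> real" where
  "boundary_integral a b f =
     (LINT s|lebesgue_on {fst a..fst b}. f (s, snd a)) + (LINT s|lebesgue_on {fst a..fst b}. f (s, snd b))
   + (LINT s|lebesgue_on {snd a..snd b}. f (fst a, s)) + (LINT s|lebesgue_on {snd a..snd b}. f (fst b, s))"

definition outer_normal :: "plane \<Rightarrow> plane \<Rightarrow> plane \<Rightarrow> plane" where
  "outer_normal a b p =
     (if snd p = snd a then (0, -1) else if snd p = snd b then (0, 1)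
      else if fst p = fst a then (-1, 0) else (1, 0))"

definition normal_deriv :: "plane \<Rightarrow> plane \<Rightarrow> (plane \<Rightarrow> real) \<Rightarrow> plane \<Rightarrow> real" where
  "normal_deriv a b w p = cpd (outer_normal a b p) w p"

text \<open>
  The trace operators \<open>v \<mapsto> v|\<^sub>\<partial>\<^sub>\<Omega>\<close> on \<open>H\<^sup>1\<close> and \<open>v \<mapsto> (v|\<^sub>\<partial>\<^sub>\<Omega>, \<partial>v/\<partial>n)\<close> on \<open>H\<^sup>2\<close> are the continuous
  extensions, with values in \<open>L\<^sup>2(\<partial>\<Omega>)\<close>, of the classical restrictions of functions smooth up to
  the boundary. So a trace vanishes iff the classical boundary values of smooth functions
  approximating \<open>v\<close> tend to zero in \<open>L\<^sup>2(\<partial>\<Omega>)\<close>.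
\<close>

definition zero_trace :: "plane \<Rightarrow> plane \<Rightarrow> (plane \<Rightarrow> real) \<Rightarrow> bool" where
  "zero_trace a b v \<longleftrightarrow> (\<exists>w :: nat \<Rightarrow> plane \<Rightarrow> real. (\<forall>n. smooth (w n)) \<and>
     (\<lambda>n. H1_norm (box a b) (\<lambda>p. w n p - v p)) \<longlonglongrightarrow> 0 \<and>
     (\<lambda>n. boundary_integral a b (\<lambda>p. (w n p)\<^sup>2)) \<longlonglongrightarrow> 0)"

definition zero_trace_and_normal_deriv :: "plane \<Rightarrow> plane \<Rightarrow> (plane \<Rightarrow> real) \<Rightarrow> bool" where
  "zero_trace_and_normal_deriv a b v \<longleftrightarrow> (\<exists>w :: nat \<Rightarrow> plane \<Rightarrow> real. (\<forall>n. smooth (w n)) \<and>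
     (\<lambda>n. H2_norm (box a b) (\<lambda>p. w n p - v p)) \<longlonglongrightarrow> 0 \<and>
     (\<lambda>n. boundary_integral a b (\<lambda>p. (w n p)\<^sup>2)) \<longlonglongrightarrow> 0 \<and>
     (\<lambda>n. boundary_integral a b (\<lambda>p. (normal_deriv a b (w n) p)\<^sup>2)) \<longlonglongrightarrow> 0)"

definition H10 :: "plane \<Rightarrow> plane \<Rightarrow> (plane \<Rightarrow> real) set" where
  "H10 a b = {v. v \<in> H1 (box a b) \<and> zero_trace a b v}"

definition H20 :: "plane \<Rightarrow> plane \<Rightarrow> (plane \<Rightarrow> real) set" where
  "H20 a b = {v. v \<in> H2 (box a b) \<and> zero_trace_and_normal_deriv a b v}"


section \<open>Dual space and trilinear form\<close>

definition dual_H20 :: "plane \<Rightarrow> plane \<Rightarrow> ((plane \<Rightarrow> real) \<Rightarrow> real) set" where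
  "dual_H20 a b = {G.
     (\<forall>u\<in>H20 a b. \<forall>v\<in>H20 a b. G (\<lambda>p. u p + v p) = G u + G v) \<and>
     (\<forall>c. \<forall>v\<in>H20 a b. G (\<lambda>p. c * v p) = c * G v) \<and>
     (\<exists>K. \<forall>v\<in>H20 a b. \<bar>G v\<bar> \<le> K * semi2 (box a b) v)}"

definition dual_norm :: "plane \<Rightarrow> plane \<Rightarrow> ((plane \<Rightarrow> real) \<Rightarrow> real) \<Rightarrow> real" where
  "dual_norm a b G =
     Sup {G v / semi2 (box a b) v | v. v \<in> H20 a b \<and> \<not> (AE p in lebesgue_on (box a b). v p = 0)}"

definition trilin :: "plane set \<Rightarrow> (plane \<Rightarrow> real) \<Rightarrow> (plane \<Rightarrow> real) \<Rightarrow> (plane \<Rightarrow> real) \<Rightarrow> real" where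
  "trilin \<Omega> \<xi> \<psi> \<phi> =
     (LINT p|lebesgue_on \<Omega>. lap \<Omega> \<xi> p * (dy \<Omega> \<psi> p * dx \<Omega> \<phi> p - dx \<Omega> \<psi> p * dy \<Omega> \<phi> p))"


section \<open>The evolution problem\<close>

abbreviation time :: "real \<Rightarrow> real measure" where
  "time T \<equiv> lebesgue_on {0..T}"

text \<open>
  \<open>f\<close> is absolutely continuous on \<open>[0,T]\<close> with derivative \<open>f'\<close>, i.e. it is the continuous
  representative of a function with weak derivative \<open>f'\<close>.
\<close>

definition abs_cont_deriv :: "real \<Rightarrow> (real \<Rightarrow> real) \<Rightarrow> (real \<Rightarrow> real) \<Rightarrow> bool" where
  "abs_cont_deriv T f f' \<longleftrightarrow> integrable (time T) f' \<and>
     (\<forall>t\<in>{0..T}. f t = f 0 + (LINT s|lebesgue_on {0..t}. f' s))"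

text \<open>
  The time derivative \<open>u\<^sub>t = u'\<close> of a curve in the Hilbert space \<open>H\<^sup>1\<^sub>0(\<Omega>)\<close>, whose inner product is
  \<open>(\<nabla>\<cdot>,\<nabla>\<cdot>)\<close>.
\<close>

definition has_time_deriv ::
    "plane \<Rightarrow> plane \<Rightarrow> real \<Rightarrow> (real \<Rightarrow> plane \<Rightarrow> real) \<Rightarrow> (real \<Rightarrow> plane \<Rightarrow> real) \<Rightarrow> bool" where
  "has_time_deriv a b T u u' \<longleftrightarrow>
     (\<forall>t\<in>{0..T}. u t \<in> H10 a b) \<and> (AE t in time T. u' t \<in> H10 a b) \<and>
     (\<forall>\<phi>\<in>H10 a b. abs_cont_deriv T
        (\<lambda>t. ip (box a b) (grad (box a b) (u t)) (grad (box a b) \<phi>))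
        (\<lambda>t. ip (box a b) (grad (box a b) (u' t)) (grad (box a b) \<phi>)))"

definition L2_time :: "plane \<Rightarrow> plane \<Rightarrow> real \<Rightarrow> (plane \<Rightarrow> real) set \<Rightarrow> (real \<Rightarrow> plane \<Rightarrow> real) \<Rightarrow> bool" where
  "L2_time a b T V u \<longleftrightarrow> (AE t in time T. u t \<in> V) \<and>
     integrable (time T) (\<lambda>t. (nrm (box a b) (lap (box a b) (u t)))\<^sup>2)"

text \<open>Membership in \<open>H\<^sup>1\<^sub>0\<close> is required at every time, so that \<open>u(0)\<close> and \<open>u(T)\<close> are meaningful.\<close>

definition Linf_time :: "plane \<Rightarrow> plane \<Rightarrow> real \<Rightarrow> (real \<Rightarrow> plane \<Rightarrow> real) \<Rightarrow> bool" where
  "Linf_time a b T u \<longleftrightarrow> (\<forall>t\<in>{0..T}. u t \<in> H10 a b) \<and>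
     (\<lambda>t. nrm (box a b) (grad (box a b) (u t))) \<in> borel_measurable (time T) \<and>
     (\<exists>M. AE t in time T. nrm (box a b) (grad (box a b) (u t)) \<le> M)"

text \<open>
  The weak problem with trial and test space \<open>V\<close>. A solution in
  \<open>L\<^sup>2(0,T;H\<^sup>2\<^sub>0) \<inter> L\<^sup>\<infinity>(0,T;H\<^sup>1\<^sub>0)\<close> need not have a time derivative with values in \<open>H\<^sup>1\<^sub>0\<close>; therefore
  \<open>r\<close> stands for \<open>(\<nabla>u\<^sub>t,\<nabla>\<phi>)\<close>, understood as the derivative of the absolutely continuous function
  \<open>t \<mapsto> (\<nabla>u(t),\<nabla>\<phi>)\<close>. It is the inner product of \<open>\<nabla>u\<^sub>t\<close> and \<open>\<nabla>\<phi>\<close> whenever \<open>has_time_deriv\<close> holds.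
\<close>

definition weak_solution ::
    "plane \<Rightarrow> plane \<Rightarrow> real \<Rightarrow> real \<Rightarrow> real \<Rightarrow> (real \<Rightarrow> (plane \<Rightarrow> real) \<Rightarrow> real) \<Rightarrow> (plane \<Rightarrow> real) set
      \<Rightarrow> (plane \<Rightarrow> real) \<Rightarrow> (real \<Rightarrow> plane \<Rightarrow> real) \<Rightarrow> bool" where
  "weak_solution a b T Rey Ros F V u0 u \<longleftrightarrow>
     (let \<Omega> = box a b in
      L2_time a b T V u \<and> Linf_time a b T u \<and>
      (AE p in lebesgue_on \<Omega>. u 0 p = u0 p) \<and>
      (\<forall>\<phi>\<in>V. \<exists>r. abs_cont_deriv T (\<lambda>t. ip \<Omega> (grad \<Omega> (u t)) (grad \<Omega> \<phi>)) r \<and>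
         (AE t in time T.
            r t + inverse Rey * ip \<Omega> (lap \<Omega> (u t)) (lap \<Omega> \<phi>) + trilin \<Omega> (u t) (u t) \<phi>
              - inverse Ros * ip \<Omega> (dx \<Omega> (u t)) \<phi> = inverse Ros * F t \<phi>)))"

text \<open>
  In the discrete problem the values lie in \<open>X\<close> at every time: \<open>X\<close> is finite dimensional, and
  testing with \<open>X\<close> alone determines \<open>u(t)\<close> only within \<open>X\<close>.
\<close>

definition discrete_solution ::
    "plane \<Rightarrow> plane \<Rightarrow> real \<Rightarrow> real \<Rightarrow> real \<Rightarrow> (real \<Rightarrow> (plane \<Rightarrow> real) \<Rightarrow> real) \<Rightarrow> (plane \<Rightarrow> real) set
      \<Rightarrow> (plane \<Rightarrow> real) \<Rightarrow> (real \<Rightarrow> plane \<Rightarrow> real) \<Rightarrow> bool" where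
  "discrete_solution a b T Rey Ros F X u0 u \<longleftrightarrow>
     (\<forall>t\<in>{0..T}. u t \<in> X) \<and> weak_solution a b T Rey Ros F X u0 u"

definition unique_solution ::
    "plane \<Rightarrow> plane \<Rightarrow> real \<Rightarrow> ((real \<Rightarrow> plane \<Rightarrow> real) \<Rightarrow> bool) \<Rightarrow> (real \<Rightarrow> plane \<Rightarrow> real) \<Rightarrow> bool" where
  "unique_solution a b T P u \<longleftrightarrow> P u \<and>
     (\<forall>w. P w \<longrightarrow> (\<forall>t\<in>{0..T}. AE p in lebesgue_on (box a b). w t p = u t p))"


section \<open>Finite element spaces\<close>

definition poly2 :: "nat \<Rightarrow> (plane \<Rightarrow> real) \<Rightarrow> bool" where
  "poly2 k q \<longleftrightarrow> (\<exists>c :: nat \<Rightarrow> nat \<Rightarrow> real. \<forall>x y. q (x, y) = (\<Sum>i\<le>k. \<Sum>j\<le>k - i. c i j * x ^ i * y ^ j))"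

definition fe_space :: "plane \<Rightarrow> plane \<Rightarrow> real \<Rightarrow> (plane \<Rightarrow> real) set \<Rightarrow> bool" where
  "fe_space a b h X \<longleftrightarrow>
     X \<subseteq> H20 a b \<and> (\<lambda>p. 0) \<in> X \<and> (\<forall>u\<in>X. \<forall>v\<in>X. (\<lambda>p. u p + v p) \<in> X) \<and> (\<forall>c. \<forall>v\<in>X. (\<lambda>p. c * v p) \<in> X) \<and>
     (\<exists>\<T>. triangulation \<T> \<and> (\<forall>K\<in>\<T>. 2 simplex K) \<and> \<Union>\<T> = cbox a b \<and> h = Max (diameter ` \<T>) \<and>
        (\<exists>k. \<forall>v\<in>X. \<forall>K\<in>\<T>. \<exists>q. poly2 k q \<and> (\<forall>p\<in>K. v p = q p)))"


section \<open>Best approximation\<close>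

text \<open>
  The pairs \<open>(\<mu>, \<eta>')\<close> such that \<open>\<mu>\<close> takes values in \<open>X\<close>, \<open>\<eta>' = (\<psi> - \<mu>)\<^sub>t\<close>, and all norms in
  \<open>approx_error\<close> are defined and finite.
\<close>

definition admissible ::
    "plane \<Rightarrow> plane \<Rightarrow> real \<Rightarrow> (plane \<Rightarrow> real) set \<Rightarrow> (real \<Rightarrow> plane \<Rightarrow> real)
      \<Rightarrow> ((real \<Rightarrow> plane \<Rightarrow> real) \<times> (real \<Rightarrow> plane \<Rightarrow> real)) set" where
  "admissible a b T X \<psi> =
     (let \<Omega> = box a b in
      {(\<mu>, \<eta>'). (\<forall>t\<in>{0..T}. \<mu> t \<in> X) \<and> has_time_deriv a b T (\<lambda>t p. \<psi> t p - \<mu> t p) \<eta>' \<and>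
         integrable (time T) (\<lambda>t. (nrm \<Omega> (grad \<Omega> (\<eta>' t)))\<^sup>2) \<and>
         integrable (time T) (\<lambda>t. (nrm \<Omega> (lap \<Omega> (\<lambda>p. \<psi> t p - \<mu> t p)))\<^sup>2) \<and>
         integrable (time T) (\<lambda>t. (nrm \<Omega> (lap \<Omega> (\<lambda>p. \<psi> t p - \<mu> t p))) ^ 4)})"

definition approx_error ::
    "plane set \<Rightarrow> real \<Rightarrow> (real \<Rightarrow> plane \<Rightarrow> real) \<Rightarrow> (real \<Rightarrow> plane \<Rightarrow> real) \<Rightarrow> real" where
  "approx_error \<Omega> T \<eta> \<eta>' =
     (nrm \<Omega> (grad \<Omega> (\<eta> 0)))\<^sup>2
     + (LINT t|time T. (nrm \<Omega> (grad \<Omega> (\<eta>' t)))\<^sup>2 + (nrm \<Omega> (lap \<Omega> (\<eta> t)))\<^sup>2)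
     + ((LINT t|time T. (nrm \<Omega> (lap \<Omega> (\<eta> t))) ^ 4) powr (1/4))\<^sup>2
     + (nrm \<Omega> (grad \<Omega> (\<eta> T)))\<^sup>2"

end

theory Submission
  imports Defs
begin

text \<open>
  Put \<open>\<eta> = \<psi> - \<mu>\<close> and \<open>\<theta> = \<psi>\<^sup>h - \<mu> \<in> X\<close>. Subtracting the two equations and testing with \<open>\<theta>\<close> gives an
  energy inequality for \<open>\<parallel>\<nabla>\<theta>\<parallel>\<^sup>2\<close>, because the nonlinear terms can be written with \<open>\<psi>\<close>, \<open>\<eta>\<close>, \<open>\<theta>\<close> only and
  the terms cubic in \<open>\<theta>\<close> cancel. The weight in Gronwall's inequality contains \<open>\<parallel>\<Delta>\<psi>\<parallel>\<^sup>4 + \<parallel>\<Delta>\<eta>\<parallel>\<^sup>4\<close>. If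
  \<open>\<parallel>\<Delta>\<eta>\<parallel>\<^sub>L\<^sub>4 \<le> 1\<close>, its integral is bounded independently of \<open>\<mu>\<close> and \<open>X\<close>. Otherwise the right-hand side of the
  claim exceeds \<open>1\<close>, and the stability estimate for \<open>\<psi>\<^sup>h\<close>, obtained by testing with \<open>\<psi>\<^sup>h\<close> itself, suffices.
  The solution \<open>\<psi>\<close> is determined almost everywhere by the data, so the constant may depend on its norms.

  Three facts about weak derivatives on the rectangle are needed: first derivatives of functions in
  \<open>H\<^sup>2\<^sub>0\<close> are in \<open>L\<^sup>4\<close> (Ladyzhenskaya), so that \<open>b\<close> is trilinear; Poincare's inequality; and
  \<open>|v|\<^sub>2 = \<parallel>\<Delta>v\<parallel>\<close> on \<open>H\<^sup>2\<^sub>0\<close>. Since \<open>X\<close> is finite-dimensional modulo null sets, the test function \<open>\<theta>(t)\<close> is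
  expanded in an orthonormal basis whose coefficients are absolutely continuous in time.
\<close>

section \<open>Square-integrable functions\<close>

text \<open>The obstacle is that the weak equation holds for one fixed test function at a time, each
  with its own null set of times, and that \<psi> need not have a time derivative in
  \<open>H10\<close>. A finite basis, orthonormal for (\<nabla>u,\<nabla>v), resolves this: the
  coefficients of \<theta> are the very scalar products whose absolute continuity the equations and
  \<open>admissible\<close> provide, \<parallel>\<nabla>\<theta>\<parallel>^2 is the sum of their
  squares, and the load F cancels in the difference. The fourth powers come from
  b(\<theta>;\<psi>,\<theta>), bounded by \<parallel>\<Delta>\<psi>\<parallel>
  \<parallel>\<Delta>\<theta>\<parallel>^(3/2) \<parallel>\<nabla>\<theta>\<parallel>^(1/2): Young's
  inequality with exponents 4/3 and 4 leaves \<parallel>\<Delta>\<psi>\<parallel>^4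
  \<parallel>\<nabla>\<theta>\<parallel>^2. Poincare's inequality makes the gradient product
  definite modulo null sets and sends the rotation term into the Gronwall weight. The identity |v|_2
  = \<parallel>\<Delta>v\<parallel> links the dual norm, defined by the seminorm, with the
  dissipation. Membership in \<open>H20\<close> only provides smooth approximants whose boundary
  values tend to zero in L2, so integrations by parts are done on them and the boundary terms are
  kept until the limit.\<close>

lemma borel_measurable_lebesgue_on_AE:
  fixes f g :: "'a::euclidean_space \<Rightarrow> 'b::euclidean_space"
  assumes "f \<in> borel_measurable (lebesgue_on S)" "AE p in lebesgue_on S. f p = g p" "S \<in> sets lebesgue"
  shows "g \<in> borel_measurable (lebesgue_on S)"
proof -
  \<comment> \<open>Extending by zero moves the question to the complete measure
    \<open>lebesgue\<close>, where a function equal almost everywhere to a measurable one is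
    measurable.\<close>
  have "(\<lambda>x. if x \<in> S then f x else 0) \<in> borel_measurable lebesgue"
    using assms by (simp add: borel_measurable_if)
  moreover have "AE x in lebesgue. (if x \<in> S then f x else 0) = (if x \<in> S then g x else 0)"
    using assms(2,3) by (auto simp: AE_restrict_space_iff)
  ultimately have "(\<lambda>x. if x \<in> S then g x else 0) \<in> borel_measurable lebesgue"
    by (rule borel_measurable_AE)
  then show ?thesis
    using assms by (simp add: borel_measurable_if)
qed

lemma L2_cong_AE:
  fixes f g :: "plane \<Rightarrow> 'a::euclidean_space"
  assumes "AE p in lebesgue_on S. f p = g p" "S \<in> sets lebesgue"
  shows "f \<in> L2 S \<longleftrightarrow> g \<in> L2 S"
proof -
  have *: "g \<in> L2 S" if "f \<in> L2 S" "AE p in lebesgue_on S. f p = g p" for f g :: "plane \<Rightarrow> 'a"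
  proof -
    have g: "g \<in> borel_measurable (lebesgue_on S)"
      using that assms(2) borel_measurable_lebesgue_on_AE by (auto simp: L2_def)
    have "integrable (lebesgue_on S) (\<lambda>p. (norm (g p))\<^sup>2)"
      using that g unfolding L2_def
      by (subst integrable_cong_AE[where g="\<lambda>p. (norm (f p))\<^sup>2"]) auto
    then show ?thesis using g by (simp add: L2_def)
  qed
  show ?thesis
    using *[of f g] *[of g f] assms(1) by (metis (mono_tags, lifting) eventually_mono)
qed

lemma L2_integrable_inner:
  fixes f g :: "plane \<Rightarrow> 'a::euclidean_space"
  assumes "f \<in> L2 S" "g \<in> L2 S"
  shows "integrable (lebesgue_on S) (\<lambda>p. f p \<bullet> g p)"
proof (rule Bochner_Integration.integrable_bound)
  show "integrable (lebesgue_on S) (\<lambda>p. (norm (f p))\<^sup>2 + (norm (g p))\<^sup>2)"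
    using assms by (auto simp: L2_def)
  show "(\<lambda>p. f p \<bullet> g p) \<in> borel_measurable (lebesgue_on S)"
    using assms by (auto simp: L2_def)
  have "\<bar>x \<bullet> y\<bar> \<le> (norm x)\<^sup>2 + (norm y)\<^sup>2" for x y :: 'a
  proof -
    have "\<bar>x \<bullet> y\<bar> \<le> norm x * norm y" by (rule Cauchy_Schwarz_ineq2)
    moreover have "2 * (norm x * norm y) \<le> (norm x)\<^sup>2 + (norm y)\<^sup>2"
      using sum_squares_bound[of "norm x" "norm y"] by simp
    moreover have "0 \<le> norm x * norm y" by simp
    ultimately show ?thesis by linarith
  qed
  then show "AE p in lebesgue_on S. norm (f p \<bullet> g p) \<le> norm ((norm (f p))\<^sup>2 + (norm (g p))\<^sup>2)"
    by auto
qed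

lemma L2_integrable_mult:
  fixes f g :: "plane \<Rightarrow> real"
  assumes "f \<in> L2 S" "g \<in> L2 S"
  shows "integrable (lebesgue_on S) (\<lambda>p. f p * g p)"
  using L2_integrable_inner[OF assms] by (simp add: inner_real_def)

lemma L2_real_iff:
  fixes f :: "plane \<Rightarrow> real"
  shows "f \<in> L2 S \<longleftrightarrow> f \<in> borel_measurable (lebesgue_on S) \<and> integrable (lebesgue_on S) (\<lambda>p. (f p)\<^sup>2)"
  by (simp add: L2_def)

lemma L2_add:
  fixes f g :: "plane \<Rightarrow> real"
  assumes "f \<in> L2 S" "g \<in> L2 S"
  shows "(\<lambda>p. f p + g p) \<in> L2 S"
proof -
  have "integrable (lebesgue_on S) (\<lambda>p. (f p)\<^sup>2 + (g p)\<^sup>2 + 2 * (f p * g p))"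
    using assms L2_integrable_mult[OF assms] by (auto simp: L2_real_iff)
  then show ?thesis
    using assms by (auto simp: L2_real_iff power2_sum algebra_simps)
qed

lemma L2_scale:
  fixes f :: "plane \<Rightarrow> real"
  assumes "f \<in> L2 S"
  shows "(\<lambda>p. c * f p) \<in> L2 S"
  using assms by (auto simp: L2_real_iff power_mult_distrib)

lemma L2_minus:
  fixes f :: "plane \<Rightarrow> real"
  assumes "f \<in> L2 S"
  shows "(\<lambda>p. - f p) \<in> L2 S"
  using L2_scale[OF assms, of "-1"] by simp

lemma L2_diff:
  fixes f g :: "plane \<Rightarrow> real"
  assumes "f \<in> L2 S" "g \<in> L2 S"
  shows "(\<lambda>p. f p - g p) \<in> L2 S"
  using L2_add[OF assms(1) L2_minus[OF assms(2)]] by simp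

lemma L2_bounded_mult:
  fixes f g :: "plane \<Rightarrow> real"
  assumes "f \<in> L2 S" "g \<in> borel_measurable (lebesgue_on S)" "\<And>p. p \<in> S \<Longrightarrow> \<bar>g p\<bar> \<le> B"
    and S: "S \<in> sets lebesgue"
  shows "(\<lambda>p. g p * f p) \<in> L2 S"
proof -
  have "integrable (lebesgue_on S) (\<lambda>p. (g p * f p)\<^sup>2)"
  proof (rule Bochner_Integration.integrable_bound)
    show "integrable (lebesgue_on S) (\<lambda>p. B\<^sup>2 * (f p)\<^sup>2)"
      using assms by (auto simp: L2_real_iff)
    show "(\<lambda>p. (g p * f p)\<^sup>2) \<in> borel_measurable (lebesgue_on S)"
      using assms by (auto simp: L2_real_iff)
    have "(g p)\<^sup>2 \<le> B\<^sup>2" if "p \<in> S" for p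
      using power_mono[OF assms(3)[OF that] abs_ge_zero, of 2] by simp
    then show "AE p in lebesgue_on S. norm ((g p * f p)\<^sup>2) \<le> norm (B\<^sup>2 * (f p)\<^sup>2)"
      by (intro AE_I2) (auto simp: power_mult_distrib intro!: mult_right_mono)
  qed
  then show ?thesis using assms by (auto simp: L2_real_iff)
qed

lemma ip_real: "ip S f g = (LINT p|lebesgue_on S. f p * g p)" for f g :: "plane \<Rightarrow> real"
  by (simp add: ip_def)

lemma ip_cong_AE:
  fixes f g :: "plane \<Rightarrow> 'a::euclidean_space"
  assumes "AE p in lebesgue_on S. f p = f' p" "AE p in lebesgue_on S. g p = g' p" 
    "f \<in> borel_measurable (lebesgue_on S)" "g \<in> borel_measurable (lebesgue_on S)" and S: "S \<in> sets lebesgue"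
  shows "ip S f g = ip S f' g'"
  unfolding ip_def
  using borel_measurable_lebesgue_on_AE[OF assms(3,1) S] borel_measurable_lebesgue_on_AE[OF assms(4,2) S] assms
  by (intro integral_cong_AE) auto

lemma ip_commute: "ip S f g = ip S g f"
  by (simp add: ip_def inner_commute)

lemma ip_add_left:
  fixes f g h :: "plane \<Rightarrow> real"
  assumes "f \<in> L2 S" "g \<in> L2 S" "h \<in> L2 S"
  shows "ip S (\<lambda>p. f p + g p) h = ip S f h + ip S g h"
  using L2_integrable_mult[OF assms(1,3)] L2_integrable_mult[OF assms(2,3)]
  by (simp add: ip_real algebra_simps)

lemma ip_scale_left: "ip S (\<lambda>p. c * f p) h = c * ip S f h" for f h :: "plane \<Rightarrow> real"
  by (simp add: ip_real mult.assoc)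

lemma ip_diff_left:
  fixes f g h :: "plane \<Rightarrow> real"
  assumes "f \<in> L2 S" "g \<in> L2 S" "h \<in> L2 S"
  shows "ip S (\<lambda>p. f p - g p) h = ip S f h - ip S g h"
  using L2_integrable_mult[OF assms(1,3)] L2_integrable_mult[OF assms(2,3)]
  by (simp add: ip_real algebra_simps)

lemma ip_add_right:
  fixes f g h :: "plane \<Rightarrow> real"
  assumes "f \<in> L2 S" "g \<in> L2 S" "h \<in> L2 S"
  shows "ip S h (\<lambda>p. f p + g p) = ip S h f + ip S h g"
  using ip_add_left[OF assms] by (simp add: ip_commute)

lemma ip_scale_right: "ip S h (\<lambda>p. c * f p) = c * ip S h f" for f h :: "plane \<Rightarrow> real"
  using ip_scale_left[of S c f h] by (simp add: ip_commute)

lemma ip_self_nonneg: "0 \<le> ip S f f"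
  by (auto simp: ip_def intro: integral_nonneg_AE)

lemma nrm_nonneg [simp]: "0 \<le> nrm S f"
  by (simp add: nrm_def ip_self_nonneg)

lemma nrm_sq: "(nrm S f)\<^sup>2 = ip S f f"
  by (simp add: nrm_def ip_self_nonneg)

lemma nrm_scale: "nrm S (\<lambda>p. c * f p) = \<bar>c\<bar> * nrm S f" for f :: "plane \<Rightarrow> real"
proof -
  have "ip S (\<lambda>p. c * f p) (\<lambda>p. c * f p) = c\<^sup>2 * ip S f f"
    by (simp add: ip_scale_left ip_scale_right power2_eq_square)
  then show ?thesis by (simp add: nrm_def real_sqrt_mult)
qed

text \<open>The common core of the Cauchy-Schwarz inequalities below (for \<open>ip\<close>, for
  \<open>gp\<close>, on an interval, on a general measure): the polynomial is the expansion of the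
  square of f + t g.\<close>

lemma discriminant_le:
  fixes A B C :: real
  assumes "\<And>t. 0 \<le> A + t * (2 * B) + t\<^sup>2 * C" "0 \<le> C"
  shows "B\<^sup>2 \<le> A * C"
proof (cases "C = 0")
  case True
  have "B = 0"
  proof (rule ccontr)
    assume "B \<noteq> 0"
    \<comment> \<open>With \<open>C = 0\<close> the polynomial is linear; at this \<open>t\<close>
      it takes the value -1.\<close>
    then show False using assms(1)[of "- (A + 1) / (2 * B)"] True by simp
  qed
  then show ?thesis using True by simp
next
  case False
  \<comment> \<open>The polynomial is evaluated at its minimiser and multiplied by
    \<open>C\<close>.\<close>
  have "0 \<le> C * (A + (-B/C) * (2 * B) + (-B/C)\<^sup>2 * C)"
    using assms(1)[of "-B/C"] assms(2) by (intro mult_nonneg_nonneg) auto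
  also have "\<dots> = A * C - B\<^sup>2" using False by (simp add: field_simps power2_eq_square)
  finally show ?thesis by simp
qed

lemma ip_Cauchy_Schwarz:
  fixes f g :: "plane \<Rightarrow> real"
  assumes "f \<in> L2 S" "g \<in> L2 S"
  shows "\<bar>ip S f g\<bar> \<le> nrm S f * nrm S g"
proof -
  have "0 \<le> ip S f f + t * (2 * ip S f g) + t\<^sup>2 * ip S g g" for t
  proof -
    have "0 \<le> ip S (\<lambda>p. f p + t * g p) (\<lambda>p. f p + t * g p)" by (rule ip_self_nonneg)
    also have "\<dots> = ip S f f + t * (2 * ip S f g) + t\<^sup>2 * ip S g g"
      using assms by (simp add: ip_add_left ip_add_right L2_add L2_scale ip_scale_left ip_scale_right ip_commute[of S g f]
        power2_eq_square algebra_simps)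
    finally show ?thesis .
  qed
  then have "(ip S f g)\<^sup>2 \<le> ip S f f * ip S g g"
    using ip_self_nonneg by (rule discriminant_le)
  then have "sqrt ((ip S f g)\<^sup>2) \<le> sqrt (ip S f f * ip S g g)"
    by (rule real_sqrt_le_mono)
  then show ?thesis by (simp add: nrm_def real_sqrt_mult)
qed

lemma nrm_triangle:
  fixes f g :: "plane \<Rightarrow> real"
  assumes "f \<in> L2 S" "g \<in> L2 S"
  shows "nrm S (\<lambda>p. f p + g p) \<le> nrm S f + nrm S g"
proof (rule power2_le_imp_le)
  have "(nrm S (\<lambda>p. f p + g p))\<^sup>2 = (nrm S f)\<^sup>2 + 2 * ip S f g + (nrm S g)\<^sup>2"
    using assms by (simp add: nrm_sq ip_add_left ip_add_right L2_add ip_commute[of S g f])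
  also have "\<dots> \<le> (nrm S f + nrm S g)\<^sup>2"
    using ip_Cauchy_Schwarz[OF assms] by (simp add: power2_sum)
  finally show "(nrm S (\<lambda>p. f p + g p))\<^sup>2 \<le> (nrm S f + nrm S g)\<^sup>2" .
qed simp

lemma nrm_zero_iff:
  fixes f :: "plane \<Rightarrow> real"
  assumes "f \<in> L2 S"
  shows "nrm S f = 0 \<longleftrightarrow> (AE p in lebesgue_on S. f p = 0)"
proof -
  have "nrm S f = 0 \<longleftrightarrow> (LINT p|lebesgue_on S. (f p)\<^sup>2) = 0"
    by (simp add: nrm_def ip_real power2_eq_square)
  also have "\<dots> \<longleftrightarrow> (AE p in lebesgue_on S. (f p)\<^sup>2 = 0)"
    using assms by (intro integral_nonneg_eq_0_iff_AE) (auto simp: L2_real_iff)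
  finally show ?thesis by simp
qed

lemma nrm_cong_AE:
  fixes f g :: "plane \<Rightarrow> real"
  assumes "AE p in lebesgue_on S. f p = g p" "f \<in> L2 S" "S \<in> sets lebesgue"
  shows "nrm S f = nrm S g"
  unfolding nrm_def using ip_cong_AE[OF assms(1,1)] assms(2,3) by (simp add: L2_real_iff)

lemma ip_tendsto_left:
  fixes f :: "nat \<Rightarrow> plane \<Rightarrow> real"
  assumes "\<And>n. f n \<in> L2 S" "f' \<in> L2 S" "g \<in> L2 S"
    and lim: "(\<lambda>n. nrm S (\<lambda>p. f n p - f' p)) \<longlonglongrightarrow> 0"
  shows "(\<lambda>n. ip S (f n) g) \<longlonglongrightarrow> ip S f' g"
proof -
  have *: "norm (ip S (f n) g - ip S f' g) \<le> nrm S (\<lambda>p. f n p - f' p) * nrm S g" for n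
    using ip_Cauchy_Schwarz[OF L2_diff[OF assms(1)[of n] assms(2)] assms(3)] assms
    by (simp add: ip_diff_left)
  have **: "(\<lambda>n. nrm S (\<lambda>p. f n p - f' p) * nrm S g) \<longlonglongrightarrow> 0"
    by (rule tendsto_mult_left_zero[OF lim])
  have "(\<lambda>n. ip S (f n) g - ip S f' g) \<longlonglongrightarrow> 0"
    by (rule Lim_null_comparison[OF always_eventually **]) (use * in blast)
  then show ?thesis by (rule LIM_zero_cancel)
qed

lemma nrm_tendsto:
  fixes f :: "nat \<Rightarrow> plane \<Rightarrow> real"
  assumes "\<And>n. f n \<in> L2 S" "f' \<in> L2 S"
    and lim: "(\<lambda>n. nrm S (\<lambda>p. f n p - f' p)) \<longlonglongrightarrow> 0"
  shows "(\<lambda>n. nrm S (f n)) \<longlonglongrightarrow> nrm S f'"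
proof -
  have "\<bar>nrm S (f n) - nrm S f'\<bar> \<le> nrm S (\<lambda>p. f n p - f' p)" for n
  proof -
    have "nrm S (f n) \<le> nrm S (\<lambda>p. f n p - f' p) + nrm S f'"
      using nrm_triangle[OF L2_diff[OF assms(1)[of n] assms(2)] assms(2)] by simp
    moreover have "nrm S f' \<le> nrm S (\<lambda>p. f' p - f n p) + nrm S (f n)"
      using nrm_triangle[OF L2_diff[OF assms(2) assms(1)[of n]] assms(1)[of n]] by simp
    moreover have "nrm S (\<lambda>p. f' p - f n p) = nrm S (\<lambda>p. f n p - f' p)"
      using nrm_scale[of S "-1" "\<lambda>p. f' p - f n p"] by simp
    ultimately show ?thesis by linarith
  qed
  then have "(\<lambda>n. nrm S (f n) - nrm S f') \<longlonglongrightarrow> 0"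
    by (intro Lim_null_comparison[OF _ lim] always_eventually) auto
  then show ?thesis by (rule LIM_zero_cancel)
qed

section \<open>Smooth functions\<close>

lemma cpd_eq: "(f has_derivative D) (at p) \<Longrightarrow> cpd e f p = D e"
  unfolding cpd_def by (metis frechet_derivative_at)

lemma C_diff_imp_continuous: "C_diff k f \<Longrightarrow> continuous_on UNIV f"
proof (cases k)
  case (Suc j)
  assume "C_diff k f"
  then show ?thesis
    using Suc by (auto intro!: continuous_at_imp_continuous_on differentiable_imp_continuous_within)
qed auto

lemma C_diff_SucD: "C_diff (Suc k) f \<Longrightarrow> C_diff k f"
proof (induction k arbitrary: f)
  case 0
  then show ?case using C_diff_imp_continuous by (metis C_diff.simps(1))
next
  case (Suc k)
  then show ?case
    unfolding C_diff.simps(2)[of "Suc k"] C_diff.simps(2)[of k f] by blast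
qed

lemma differentiable_has_cpd:
  "f differentiable (at p) \<Longrightarrow> (f has_derivative (\<lambda>e. cpd e f p)) (at p)"
  unfolding cpd_def by (simp add: frechet_derivative_works)

lemma C_diff_add: "C_diff k f \<Longrightarrow> C_diff k g \<Longrightarrow> C_diff k (\<lambda>p. f p + g p)"
proof (induction k arbitrary: f g)
  case 0
  then show ?case by (auto intro: continuous_on_add)
next
  case (Suc k)
  then have d: "f differentiable (at p)" "g differentiable (at p)" for p
    by (metis C_diff.simps(2))+
  have "cpd e (\<lambda>p. f p + g p) = (\<lambda>p. cpd e f p + cpd e g p)" for e
    using has_derivative_add[OF differentiable_has_cpd[OF d(1)] differentiable_has_cpd[OF d(2)]]
    by (intro ext cpd_eq)
  then show ?case
    using Suc unfolding C_diff.simps by (simp add: d differentiable_add del: split_paired_All)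
qed

text \<open>The product rule mixes each factor with the derivative of the other, so the induction
  step also needs the factors at the lower order; this is \<open>C_diff_SucD\<close>.\<close>

lemma C_diff_mult: "C_diff k f \<Longrightarrow> C_diff k g \<Longrightarrow> C_diff k (\<lambda>p. f p * g p)"
proof (induction k arbitrary: f g)
  case 0
  then show ?case by (auto intro: continuous_on_mult)
next
  case (Suc k)
  then have d: "f differentiable (at p)" "g differentiable (at p)" for p
    by (metis C_diff.simps(2))+
  have *: "cpd e (\<lambda>p. f p * g p) = (\<lambda>p. f p * cpd e g p + cpd e f p * g p)" for e
    using has_derivative_mult[OF differentiable_has_cpd[OF d(1)] differentiable_has_cpd[OF d(2)]]
    by (intro ext cpd_eq)
  show ?case
    using Suc d C_diff_SucD[OF Suc.prems(1)] C_diff_SucD[OF Suc.prems(2)]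
    unfolding C_diff.simps by (simp add: * d differentiable_mult C_diff_add del: split_paired_All)
qed

lemma C_diff_const: "C_diff k (\<lambda>p. c)"
proof (induction k arbitrary: c)
  case (Suc k)
  have "cpd e (\<lambda>p. c) = (\<lambda>p. 0)" for e
    by (intro ext cpd_eq has_derivative_const)
  then show ?case using Suc by auto
qed auto

lemma smooth_const: "smooth (\<lambda>p. c)"
  by (simp add: smooth_def C_diff_const)

lemma smooth_add: "smooth f \<Longrightarrow> smooth g \<Longrightarrow> smooth (\<lambda>p. f p + g p)"
  by (simp add: smooth_def C_diff_add)

lemma smooth_mult: "smooth f \<Longrightarrow> smooth g \<Longrightarrow> smooth (\<lambda>p. f p * g p)"
  by (simp add: smooth_def C_diff_mult)

lemma smooth_cpd:
  assumes "smooth f"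
  shows "smooth (cpd (1, 0) f)" "smooth (cpd (0, 1) f)"
  using assms unfolding smooth_def by (metis C_diff.simps(2))+

lemma smooth_differentiable: "smooth f \<Longrightarrow> f differentiable (at p)"
  unfolding smooth_def by (metis C_diff.simps(2))

lemma smooth_continuous: "smooth f \<Longrightarrow> continuous_on S f"
  unfolding smooth_def by (metis C_diff.simps(1) continuous_on_subset subset_UNIV)

lemma smooth_has_derivative:
  assumes "smooth f"
  shows "(f has_derivative (\<lambda>e. fst e * cpd (1, 0) f p + snd e * cpd (0, 1) f p)) (at p)"
proof -
  have d: "(f has_derivative (\<lambda>e. cpd e f p)) (at p)"
    using differentiable_has_cpd smooth_differentiable assms by blast
  have "linear (\<lambda>e. cpd e f p)"
    using d has_derivative_linear by blast
  have "cpd e f p = fst e * cpd (1, 0) f p + snd e * cpd (0, 1) f p" for e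
  proof -
    have "e = fst e *\<^sub>R (1, 0) + snd e *\<^sub>R (0, 1)" by (simp add: prod_eq_iff)
    then show ?thesis
      using linear_add[OF \<open>linear (\<lambda>e. cpd e f p)\<close>] linear_scale[OF \<open>linear (\<lambda>e. cpd e f p)\<close>]
      by (metis real_scaleR_def)
  qed
  then show ?thesis
    by (intro has_derivative_eq_rhs[OF d] ext)
qed

lemma cpd_add: "smooth f \<Longrightarrow> smooth g \<Longrightarrow> cpd e (\<lambda>p. f p + g p) = (\<lambda>p. cpd e f p + cpd e g p)"
  by (intro ext cpd_eq has_derivative_add differentiable_has_cpd smooth_differentiable)

lemma cpd_mult: "smooth f \<Longrightarrow> smooth g \<Longrightarrow> cpd e (\<lambda>p. f p * g p) = (\<lambda>p. f p * cpd e g p + cpd e f p * g p)"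
  by (intro ext cpd_eq has_derivative_mult differentiable_has_cpd smooth_differentiable)

lemma cpd_const: "cpd e (\<lambda>p. c) = (\<lambda>p. 0)"
  by (intro ext cpd_eq has_derivative_const)

lemma smooth_scale: "smooth f \<Longrightarrow> smooth (\<lambda>p. c * f p)"
  by (rule smooth_mult[OF smooth_const])

lemma smooth_diff: "smooth f \<Longrightarrow> smooth g \<Longrightarrow> smooth (\<lambda>p. f p - g p)"
  using smooth_add[OF _ smooth_scale[of g "-1"], of f] by simp

lemma cpd_scale: "smooth f \<Longrightarrow> cpd e (\<lambda>p. c * f p) = (\<lambda>p. c * cpd e f p)"
  using cpd_mult[OF smooth_const, of f e c] by (simp add: cpd_const)

lemma smooth_fst: "smooth fst"
proof -
  have "cpd e fst = (\<lambda>p. fst e)" for e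
    by (intro ext cpd_eq) (auto intro!: derivative_eq_intros)
  then have "C_diff k fst" for k
    by (cases k) (auto simp: C_diff_const intro!: continuous_on_fst bounded_linear_imp_differentiable bounded_linear_fst)
  then show ?thesis by (simp add: smooth_def)
qed

section \<open>Test functions\<close>

text \<open>The exponent \<open>m\<close> is carried because differentiating exp(-1/s) produces
  powers of 1/s; with all \<open>m\<close> together the family is closed under differentiation up to
  linear combinations.\<close>

definition flat :: "nat \<Rightarrow> real \<Rightarrow> real" where
  "flat m s = (if s \<le> 0 then 0 else inverse s ^ m * exp (- inverse s))"

lemma flat_tendsto_0: "(flat m \<longlongrightarrow> 0) (at_right 0)"
proof -
  have "((\<lambda>u::real. u ^ m / exp u) \<longlongrightarrow> 0) at_top"
    by (rule tendsto_power_div_exp_0)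
  then have "((\<lambda>s::real. inverse s ^ m / exp (inverse s)) \<longlongrightarrow> 0) (at_right 0)"
    by (rule filterlim_compose[OF _ filterlim_inverse_at_top_right])
  then show ?thesis
    by (rule Lim_transform_eventually)
      (auto simp: flat_def eventually_at_right_less exp_minus field_simps intro!: eventually_at_rightI[of 0 1])
qed

text \<open>For s > 0 the two terms come from the chain rule for u^m exp(-u) at u = 1/s. At s = 0
  everything rests on \<open>flat_tendsto_0\<close>, since the right difference quotient of
  \<open>flat m\<close> is \<open>flat (m + 1)\<close>.\<close>

lemma flat_DERIV: "(flat m has_real_derivative (flat (m + 2) s - m * flat (m + 1) s)) (at s)"
proof -
  consider "s < 0" | "s = 0" | "s > 0" by linarith
  then show ?thesis
  proof cases
    case 1
    have "((\<lambda>_. 0) has_real_derivative 0) (at s)" by simp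
    then have "(flat m has_real_derivative 0) (at s)"
      by (rule has_field_derivative_transform_within_open[of _ _ _ "{..<0}"]) (use 1 in \<open>auto simp: flat_def\<close>)
    then show ?thesis using 1 by (simp add: flat_def)
  next
    case 2
    have "((\<lambda>h. (flat m (0 + h) - flat m 0) / h) \<longlongrightarrow> 0) (at 0)"
    proof (rule filterlim_split_at)
      show "((\<lambda>h. (flat m (0 + h) - flat m 0) / h) \<longlongrightarrow> 0) (at_left 0)"
        by (rule Lim_transform_eventually[of "\<lambda>_. 0"])
          (auto simp: flat_def intro!: eventually_at_leftI[of "-1" 0])
      show "((\<lambda>h. (flat m (0 + h) - flat m 0) / h) \<longlongrightarrow> 0) (at_right 0)"
        by (rule Lim_transform_eventually[OF flat_tendsto_0[of "m + 1"]])
          (auto simp: flat_def field_simps intro!: eventually_at_rightI[of 0 1])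
    qed
    then show ?thesis using 2 by (simp add: DERIV_def flat_def)
  next
    case 3
    have "((\<lambda>s. inverse s ^ m * exp (- inverse s)) has_real_derivative (flat (m + 2) s - m * flat (m + 1) s)) (at s)"
    proof -
      have "((\<lambda>u. u ^ m * exp (- u)) has_real_derivative (m * u ^ (m - 1) * exp (- u) - u ^ m * exp (- u))) (at u)" for u :: real
        by (auto intro!: derivative_eq_intros)
      from DERIV_chain2[OF this[of "inverse s"] DERIV_inverse[of s UNIV]] 3
      have "((\<lambda>s. inverse s ^ m * exp (- inverse s)) has_real_derivative
        ((m * inverse s ^ (m - 1) * exp (- inverse s) - inverse s ^ m * exp (- inverse s)) * (- (inverse s ^ 2)))) (at s)"
        by (simp add: numeral_2_eq_2)
      moreover have "(m * inverse s ^ (m - 1) * exp (- inverse s) - inverse s ^ m * exp (- inverse s)) * (- (inverse s ^ 2))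
        = flat (m + 2) s - m * flat (m + 1) s"
        using 3 by (cases m) (simp_all add: flat_def algebra_simps power2_eq_square)
      ultimately show ?thesis by simp
    qed
    then show ?thesis
      by (rule has_field_derivative_transform_within_open[of _ _ _ "{0<..}"]) (use 3 in \<open>auto simp: flat_def\<close>)
  qed
qed

text \<open>The argument is a general affine function so that the induction closes: both coordinate
  derivatives are constant multiples of one combination of \<open>flat (m + 2)\<close> and
  \<open>flat (m + 1)\<close> of the same affine function.\<close>

lemma C_diff_flat: "C_diff k (\<lambda>p. flat m (\<alpha> * fst p + \<beta> * snd p + \<gamma>))"
proof (induction k arbitrary: m)
  case 0
  have "continuous_on UNIV (flat m)"
    using DERIV_isCont[OF flat_DERIV] by (simp add: continuous_at_imp_continuous_on)
  then have "continuous_on UNIV (flat m \<circ> (\<lambda>p::plane. \<alpha> * fst p + \<beta> * snd p + \<gamma>))"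
    by (intro continuous_on_compose continuous_intros) (auto intro: continuous_on_subset)
  then show ?case by (simp add: o_def)
next
  case (Suc k)
  let ?l = "\<lambda>p::plane. \<alpha> * fst p + \<beta> * snd p + \<gamma>"
  have d: "((\<lambda>p. flat m (?l p)) has_derivative
     (\<lambda>e. (\<alpha> * fst e + \<beta> * snd e) * (flat (m + 2) (?l p) - m * flat (m + 1) (?l p)))) (at p)" for p
  proof -
    have "(?l has_derivative (\<lambda>e. \<alpha> * fst e + \<beta> * snd e)) (at p)"
      by (auto intro!: derivative_eq_intros)
    from has_derivative_compose[OF this flat_DERIV[of m "?l p", unfolded has_field_derivative_def]]
    show ?thesis by (simp add: mult.commute)
  qed
  have c: "cpd e (\<lambda>p. flat m (?l p)) =
     (\<lambda>p. (\<alpha> * fst e + \<beta> * snd e) * (flat (m + 2) (?l p) + (- real m) * flat (m + 1) (?l p)))" for e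
    by (rule ext) (simp add: cpd_eq[OF d])
  have "C_diff k (\<lambda>p. c * (flat (m + 2) (?l p) + (- real m) * flat (m + 1) (?l p)))" for c
    by (intro C_diff_mult C_diff_add C_diff_const Suc.IH)
  then show ?case
    using d c by (auto simp: differentiable_def simp del: add_2_eq_Suc')
qed

text \<open>The shift by \<open>1\<close> keeps the support inside the open rectangle.\<close>

definition bump :: "plane \<Rightarrow> plane \<Rightarrow> nat \<Rightarrow> plane \<Rightarrow> real" where
  "bump c d n p = flat 0 (n * (fst p - fst c) - 1) * flat 0 (n * (fst d - fst p) - 1) *
     (flat 0 (n * (snd p - snd c) - 1) * flat 0 (n * (snd d - snd p) - 1))"

lemma smooth_bump: "smooth (bump c d n)"
proof -
  have "C_diff k (\<lambda>p. flat 0 (n * fst p + 0 * snd p + (- n * fst c - 1)) * flat 0 (- n * fst p + 0 * snd p + (n * fst d - 1)) *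
     (flat 0 (0 * fst p + n * snd p + (- n * snd c - 1)) * flat 0 (0 * fst p + (- n) * snd p + (n * snd d - 1))))" for k
    by (intro C_diff_mult C_diff_flat)
  then show ?thesis
    by (simp add: smooth_def bump_def[abs_def] algebra_simps)
qed

lemma flat_0_bounds: "0 \<le> flat 0 s" "flat 0 s \<le> 1"
  by (auto simp: flat_def)

lemma bump_bounds: "0 \<le> bump c d n p" "bump c d n p \<le> 1"
  unfolding bump_def by (auto intro!: mult_nonneg_nonneg mult_le_one flat_0_bounds)

lemma mem_box_plane: "p \<in> box c d \<longleftrightarrow> fst c < fst p \<and> fst p < fst d \<and> snd c < snd p \<and> snd p < snd d" for p :: plane
  by (cases p; cases c; cases d) (auto simp: mem_box Basis_prod_def)

lemma mem_cbox_plane: "p \<in> cbox c d \<longleftrightarrow> fst c \<le> fst p \<and> fst p \<le> fst d \<and> snd c \<le> snd p \<and> snd p \<le> snd d" for p :: plane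
  by (cases p; cases c; cases d) (auto simp: mem_box Basis_prod_def)

text \<open>A nonzero value forces every distance to the sides to exceed 1/n, so the support lies in
  the closed box shrunk by 1/n on each side.\<close>

lemma bump_test_function:
  assumes "box c d \<subseteq> \<Omega>"
  shows "bump c d n \<in> test_functions \<Omega>"
proof -
  have *: "closure {p. bump c d n p \<noteq> 0} \<subseteq> box c d \<and> compact (closure {p. bump c d n p \<noteq> 0})"
  proof (cases "n = 0")
    \<comment> \<open>Every factor is then \<open>flat 0 (-1)\<close>, which is zero.\<close>
    case True
    then have "{p. bump c d n p \<noteq> 0} = {}" by (auto simp: bump_def flat_def)
    then show ?thesis unfolding \<open>{p. bump c d n p \<noteq> 0} = {}\<close> by simp
  next
    case False
    define u v where "u = (fst c + 1 / n, snd c + 1 / n)" and "v = (fst d - 1 / n, snd d - 1 / n)"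
    have *: "1 / n < s" if "flat 0 (real n * s - 1) \<noteq> 0" for s :: real
      using that False by (auto simp: flat_def field_simps split: if_splits)
    have "{p. bump c d n p \<noteq> 0} \<subseteq> cbox u v"
    proof
      fix p assume "p \<in> {p. bump c d n p \<noteq> 0}"
      then have "1 / n < fst p - fst c" "1 / n < fst d - fst p" "1 / n < snd p - snd c" "1 / n < snd d - snd p"
        unfolding bump_def using * by auto
      then show "p \<in> cbox u v" by (simp add: mem_cbox_plane u_def v_def)
    qed
    then have sub: "closure {p. bump c d n p \<noteq> 0} \<subseteq> cbox u v"
      by (rule closure_minimal) (rule closed_cbox)
    have "cbox u v \<subseteq> box c d"
    proof
      fix p assume "p \<in> cbox u v"
      moreover have "1 / real n > 0" using False by simp
      ultimately show "p \<in> box c d"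
        unfolding mem_cbox_plane mem_box_plane u_def v_def fst_conv snd_conv by linarith
    qed
    moreover have "compact (closure {p. bump c d n p \<noteq> 0})"
      unfolding compact_eq_bounded_closed using bounded_subset[OF bounded_cbox sub] by blast
    ultimately show ?thesis using sub by blast
  qed
  then show ?thesis using assms by (auto simp: test_functions_def smooth_bump)
qed

lemma flat_0_tendsto:
  assumes "s > 0"
  shows "(\<lambda>n. flat 0 (real n * s - 1)) \<longlonglongrightarrow> 1"
proof -
  have l: "filterlim (\<lambda>n. real n * s - 1) at_top sequentially"
    using filterlim_tendsto_add_at_top[OF tendsto_const[of "-1"] filterlim_at_top_mult_tendsto_pos[OF tendsto_const[of s] assms filterlim_real_sequentially]]
    by (simp add: algebra_simps)
  have "((\<lambda>u. exp (- inverse u)) \<longlongrightarrow> exp (- 0)) (at_top :: real filter)"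
    by (intro tendsto_intros tendsto_inverse_0_at_top filterlim_ident)
  then have "(flat 0 \<longlongrightarrow> 1) at_top"
    unfolding minus_zero exp_zero
    by (rule Lim_transform_eventually) (auto simp: flat_def eventually_at_top_linorder intro!: exI[of _ 1])
  then show ?thesis
    using filterlim_compose l by blast
qed

text \<open>Each factor tends to exp(0) = 1 where the corresponding distance is positive and is zero
  for every \<open>n\<close> otherwise.\<close>

lemma bump_tendsto: "(\<lambda>n. bump c d n p) \<longlonglongrightarrow> indicator (box c d) p"
proof (cases "p \<in> box c d")
  case True
  then have "(\<lambda>n. bump c d n p) \<longlonglongrightarrow> 1 * 1 * (1 * 1)"
    unfolding bump_def by (intro tendsto_mult flat_0_tendsto) (auto simp: mem_box_plane)
  then show ?thesis using True by simp
next
  case False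
  have "bump c d n p = 0" for n
  proof -
    have "flat 0 (real n * s - 1) = 0" if "s \<le> 0" for s
      using mult_nonneg_nonpos[of "real n" s] that by (simp add: flat_def)
    then show ?thesis
      using False unfolding mem_box_plane bump_def by (smt (verit) mult_eq_0_iff)
  qed
  then show ?thesis using False by simp
qed

section \<open>Uniqueness of weak derivatives\<close>

text \<open>Dynkin's argument: open boxes are stable under intersection and generate the Borel sets,
  and the sets over which \<open>g\<close> integrates to zero are closed under complements, by the
  hypothesis on the total integral, and under countable disjoint unions.\<close>

lemma AE_zero_if_box_integrals_zero:
  fixes g :: "'a::euclidean_space \<Rightarrow> real"
  assumes g: "integrable lborel g" and "integral\<^sup>L lborel g = 0"
    and box: "\<And>c d. (LINT x|lborel. indicator (box c d) x * g x) = 0"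
  shows "AE x in lborel. g x = 0"
proof (rule sigma_finite_measure.density_zero[OF lborel.sigma_finite_measure_axioms g])
  fix A :: "'a set" assume "A \<in> sets lborel"
  then have sigma: "A \<in> sigma_sets UNIV (range (\<lambda>(c, d). box c d))"
    by (simp add: borel_eq_box)
  have Int: "Int_stable (range (\<lambda>(c, d). box c d :: 'a set))"
    by (auto simp: Int_stable_def box_Int_box)
  have Pow: "range (\<lambda>(c, d). box c d :: 'a set) \<subseteq> Pow UNIV" by simp
  show "set_lebesgue_integral lborel A g = 0"
    using Int Pow sigma
  proof (induction A rule: sigma_sets_induct_disjoint)
    case (basic A)
    then show ?case using box by (auto simp: set_lebesgue_integral_def)
  next
    case empty
    then show ?case by (simp add: set_lebesgue_integral_def)
  next
    case (compl A)
    then have A: "A \<in> sets lborel" by (simp add: borel_eq_box)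
    have "integrable lborel (\<lambda>x. indicator A x *\<^sub>R g x)"
      using g A by (intro integrable_mult_indicator)
    moreover have "(\<lambda>x. indicator (UNIV - A) x *\<^sub>R g x) = (\<lambda>x. g x - indicator A x *\<^sub>R g x)"
      by (auto simp: indicator_def)
    ultimately have "set_lebesgue_integral lborel (UNIV - A) g = integral\<^sup>L lborel g - set_lebesgue_integral lborel A g"
      using g unfolding set_lebesgue_integral_def by (simp only: Bochner_Integration.integral_diff)
    then show ?case using compl assms by simp
  next
    case (union A)
    then have A: "A i \<in> sets lborel" for i by (auto simp: borel_eq_box)
    have "set_lebesgue_integral lborel (\<Union>(range A)) g = (\<Sum>i. set_lebesgue_integral lborel (A i) g)"
    proof (rule lebesgue_integral_countable_add)
      show "A i \<inter> A j = {}" if "i \<noteq> j" for i j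
        using union(1) that by (auto simp: disjoint_family_on_def)
      show "set_integrable lborel (\<Union>(range A)) g"
        unfolding set_integrable_def using A g by (intro integrable_mult_indicator) auto
    qed (use A in auto)
    then show ?case using union by simp
  qed
qed

lemma L2_integrable:
  fixes f :: "plane \<Rightarrow> real"
  assumes "f \<in> L2 S" "S \<in> lmeasurable"
  shows "integrable (lebesgue_on S) f"
proof -
  interpret finite_measure "lebesgue_on S" using assms(2) by (rule finite_measure_lebesgue_on)
  show ?thesis
    using assms(1) by (auto simp: L2_real_iff intro: square_integrable_imp_integrable)
qed

text \<open>The bumps of a box inside \<Omega> converge pointwise to its indicator and are bounded
  by 1, so by dominated convergence \<open>f\<close> integrates to zero over every such box.
  Intersecting with \<Omega> extends this to all boxes for the extension of \<open>f\<close> by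
  zero.\<close>

lemma fundamental_lemma:
  fixes f :: "plane \<Rightarrow> real"
  assumes f: "f \<in> L2 (box a b)" and 0: "\<And>\<phi>. \<phi> \<in> test_functions (box a b) \<Longrightarrow> ip (box a b) f \<phi> = 0"
  shows "AE p in lebesgue_on (box a b). f p = 0"
proof -
  let ?S = "box a b"
  have i: "integrable (lebesgue_on ?S) f"
    using f by (rule L2_integrable) simp
  have sub: "(LINT p|lebesgue_on ?S. f p * indicator (box c d) p) = 0" if "box c d \<subseteq> ?S" for c d
  proof (rule LIMSEQ_unique)
    have "(\<lambda>n. LINT p|lebesgue_on ?S. f p * bump c d n p) \<longlonglongrightarrow> (LINT p|lebesgue_on ?S. f p * indicator (box c d) p)"
    proof (rule integral_dominated_convergence)
      show "integrable (lebesgue_on ?S) (\<lambda>p. \<bar>f p\<bar>)" using i by simp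
      show "AE p in lebesgue_on ?S. (\<lambda>n. f p * bump c d n p) \<longlonglongrightarrow> f p * indicator (box c d) p"
        by (intro AE_I2 tendsto_mult tendsto_const bump_tendsto)
      show "(\<lambda>p. f p * indicator (box c d) p) \<in> borel_measurable (lebesgue_on ?S)"
        using i by (intro borel_measurable_times borel_measurable_indicator) (use that i in \<open>auto simp: sets_restrict_space_iff\<close>)
      show "(\<lambda>p. f p * bump c d n p) \<in> borel_measurable (lebesgue_on ?S)" for n
      proof (rule borel_measurable_times)
        show "bump c d n \<in> borel_measurable (lebesgue_on ?S)"
          by (intro continuous_imp_measurable_on_sets_lebesgue smooth_continuous smooth_bump) simp
      qed (use i in auto)
      show "AE p in lebesgue_on ?S. norm (f p * bump c d n p) \<le> \<bar>f p\<bar>" for n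
        using bump_bounds[of c d n] by (auto simp: abs_mult intro!: mult_left_le)
    qed
    then show "(\<lambda>n. 0) \<longlonglongrightarrow> (LINT p|lebesgue_on ?S. f p * indicator (box c d) p)"
      using 0[OF bump_test_function[OF that]] by (simp add: ip_real)
  qed simp
  let ?f = "\<lambda>p. if p \<in> ?S then f p else 0"
  have fi: "integrable lebesgue ?f"
    using i by (subst Lebesgue_Measure.integrable_restrict_UNIV) auto
  \<comment> \<open>\<open>f\<close> is only Lebesgue measurable, while boxes generate the Borel
    sets; hence a Borel representative.\<close>
  obtain g where g: "g \<in> borel_measurable lborel" "AE p in lborel. ?f p = g p"
    using completion_ex_borel_measurable_real[of ?f lborel] fi by auto
  have gl: "AE p in lebesgue. ?f p = g p" using g(2) by (rule AE_completion)
  have gm: "g \<in> borel_measurable lebesgue" using g(1) by (rule measurable_completion)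
  have fm: "?f \<in> borel_measurable lebesgue" using fi by (rule borel_measurable_integrable)
  have gi: "integrable lborel g"
    using fi g gl integrable_cong_AE[of ?f lebesgue g] by (simp add: integrable_completion measurable_completion)
  have eq: "(LINT x|lborel. indicator (box c d) x * g x) = 0" for c d
  proof -
    obtain c' d' where cd: "box c d \<inter> ?S = box c' d'"
      using box_Int_box by (rule that)
    have "(LINT x|lborel. indicator (box c d) x * g x) = (LINT x|lebesgue. indicator (box c d) x * g x)"
      using g(1) by (intro integral_completion[symmetric]) auto
    also have "\<dots> = (LINT x|lebesgue. indicator (box c d) x * ?f x)"
    proof (rule integral_cong_AE)
      show "(\<lambda>x. indicator (box c d) x * g x) \<in> borel_measurable lebesgue"
        by (intro borel_measurable_times borel_measurable_indicator gm) simp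
      show "(\<lambda>x. indicator (box c d) x * ?f x) \<in> borel_measurable lebesgue"
        by (intro borel_measurable_times borel_measurable_indicator fm) simp
    qed (use gl in auto)
    also have "\<dots> = (LINT x|lebesgue. (if x \<in> ?S then f x * indicator (box c' d') x else 0))"
      unfolding cd[symmetric] by (intro Bochner_Integration.integral_cong) (auto simp: indicator_def)
    also have "\<dots> = (LINT p|lebesgue_on ?S. f p * indicator (box c' d') p)"
      by (subst Lebesgue_Measure.integral_restrict_UNIV) auto
    also have "\<dots> = 0" using cd by (intro sub) blast
    finally show ?thesis .
  qed
  have "integral\<^sup>L lborel g = integral\<^sup>L lebesgue g"
    using g(1) by (intro integral_completion[symmetric]) auto
  also have "\<dots> = integral\<^sup>L lebesgue ?f"
    using gl by (intro integral_cong_AE gm fm) auto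
  also have "\<dots> = (LINT p|lebesgue_on ?S. f p * indicator (box a b) p)"
    by (subst Lebesgue_Measure.integral_restrict_UNIV) (auto intro!: Bochner_Integration.integral_cong)
  also have "\<dots> = 0" by (rule sub) simp
  finally have "AE x in lborel. g x = 0"
    using AE_zero_if_box_integrals_zero[OF gi] eq by blast
  then have "AE x in lebesgue. ?f x = 0"
    using gl AE_completion[of "\<lambda>x. g x = 0" lborel] by auto
  then have "AE p in lebesgue. p \<in> ?S \<longrightarrow> f p = 0"
    by (rule eventually_mono) auto
  then show ?thesis by (simp add: AE_restrict_space_iff)
qed

section \<open>Calculus on the rectangle\<close>

lemma smooth_DERIV_fst:
  assumes "smooth f"
  shows "((\<lambda>x. f (x, y)) has_real_derivative cpd (1, 0) f (x, y)) (at x)"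
proof -
  have "((\<lambda>x::real. (x, y)) has_derivative (\<lambda>h. (h, 0))) (at x)"
    by (auto intro!: derivative_eq_intros)
  from has_derivative_compose[OF this smooth_has_derivative[OF assms]]
  show ?thesis by (simp add: has_field_derivative_def mult.commute[of _ "cpd _ _ _"])
qed

lemma smooth_DERIV_snd:
  assumes "smooth f"
  shows "((\<lambda>y. f (x, y)) has_real_derivative cpd (0, 1) f (x, y)) (at y)"
proof -
  have "((\<lambda>y::real. (x, y)) has_derivative (\<lambda>h. (0, h))) (at y)"
    by (auto intro!: derivative_eq_intros)
  from has_derivative_compose[OF this smooth_has_derivative[OF assms]]
  show ?thesis by (simp add: has_field_derivative_def mult.commute[of _ "cpd _ _ _"])
qed

lemma smooth_continuous_fst: "smooth f \<Longrightarrow> continuous_on S (\<lambda>x. f (x, y))"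
  by (rule continuous_on_compose2[OF smooth_continuous[of f UNIV]]) (auto intro!: continuous_intros)

lemma smooth_continuous_snd: "smooth f \<Longrightarrow> continuous_on S (\<lambda>y. f (x, y))"
  by (rule continuous_on_compose2[OF smooth_continuous[of f UNIV]]) (auto intro!: continuous_intros)

text \<open>f(x,t) is f(x,y0) plus the integral of its y-derivative. Differentiating under the
  integral sign in x expresses the x-derivative at (x,t) as an integral up to t, and differentiating
  that in t exchanges the order.\<close>

lemma cpd_symmetric:
  assumes f: "smooth f"
  shows "cpd (1, 0) (cpd (0, 1) f) = cpd (0, 1) (cpd (1, 0) f)"
proof
  fix p :: plane
  obtain x y where p: "p = (x, y)" by (cases p)
  \<comment> \<open>Any interval with \<open>y\<close> in its interior would do; there the
    derivative within the interval is the full derivative.\<close>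
  let ?y0 = "y - 1" and ?y1 = "y + 1"
  note s = smooth_cpd[OF f] smooth_cpd(1)[OF smooth_cpd(2)[OF f]]
  have eq: "cpd (1, 0) f (x, t) = cpd (1, 0) f (x, ?y0) + integral {?y0..t} (\<lambda>s. cpd (1, 0) (cpd (0, 1) f) (x, s))"
    if "t \<in> {?y0..?y1}" for t
  proof -
    have ft: "f (x', t) = f (x', ?y0) + integral {?y0..t} (\<lambda>s. cpd (0, 1) f (x', s))" for x'
    proof -
      have "((\<lambda>s. cpd (0, 1) f (x', s)) has_integral f (x', t) - f (x', ?y0)) {?y0..t}"
        using that smooth_DERIV_snd[OF f]
        by (intro fundamental_theorem_of_calculus)
          (auto simp: has_real_derivative_iff_has_vector_derivative[symmetric] intro: has_field_derivative_at_within)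
      then show ?thesis by (simp add: integral_unique)
    qed
    have "((\<lambda>x'. integral (cbox ?y0 t) (\<lambda>s. cpd (0, 1) f (x', s))) has_field_derivative
        integral (cbox ?y0 t) (\<lambda>s. cpd (1, 0) (cpd (0, 1) f) (x, s))) (at x within UNIV)"
    proof (rule leibniz_rule_field_derivative[where fx="\<lambda>x' s. cpd (1, 0) (cpd (0, 1) f) (x', s)"])
      show "(\<lambda>s. cpd (0, 1) f (x', s)) integrable_on cbox ?y0 t" for x'
        by (intro integrable_continuous smooth_continuous_snd s)
      show "continuous_on (UNIV \<times> cbox ?y0 t) (\<lambda>(x, t). cpd (1, 0) (cpd (0, 1) f) (x, t))"
        using smooth_continuous[OF s(3)] by (simp add: case_prod_beta')
    qed (use smooth_DERIV_fst[OF s(2)] in auto)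
    then have "((\<lambda>x'. f (x', ?y0) + integral {?y0..t} (\<lambda>s. cpd (0, 1) f (x', s))) has_field_derivative
        cpd (1, 0) f (x, ?y0) + integral {?y0..t} (\<lambda>s. cpd (1, 0) (cpd (0, 1) f) (x, s))) (at x)"
      using smooth_DERIV_fst[OF f, of ?y0 x] by (auto intro: DERIV_add)
    then show ?thesis
      using smooth_DERIV_fst[OF f, of t x] ft[symmetric] by (simp add: DERIV_unique)
  qed
  have "((\<lambda>t. integral {?y0..t} (\<lambda>s. cpd (1, 0) (cpd (0, 1) f) (x, s))) has_real_derivative
      cpd (1, 0) (cpd (0, 1) f) (x, y)) (at y within {?y0..?y1})"
    by (intro integral_has_real_derivative smooth_continuous_snd s) auto
  then have "((\<lambda>t. cpd (1, 0) f (x, ?y0) + integral {?y0..t} (\<lambda>s. cpd (1, 0) (cpd (0, 1) f) (x, s))) has_real_derivative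
      cpd (1, 0) (cpd (0, 1) f) (x, y)) (at y within {?y0..?y1})"
    using DERIV_add[OF DERIV_const] by fastforce
  then have "((\<lambda>t. cpd (1, 0) f (x, t)) has_real_derivative cpd (1, 0) (cpd (0, 1) f) (x, y)) (at y within {?y0..?y1})"
    by (rule has_field_derivative_transform_within[of _ _ _ _ 1]) (use eq[symmetric] in auto)
  moreover have "at y within {?y0..?y1} = at y"
    by (intro at_within_Icc_at) auto
  ultimately show "cpd (1, 0) (cpd (0, 1) f) p = cpd (0, 1) (cpd (1, 0) f) p"
    using smooth_DERIV_snd[OF s(1), of x y] DERIV_unique p by metis
qed

locale rectangle =
  fixes a b :: plane
  assumes ab: "fst a < fst b" "snd a < snd b"
begin

abbreviation "\<Omega> \<equiv> box a b"

definition rint :: "(plane \<Rightarrow> real) \<Rightarrow> real" where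
  "rint f = (LINT p|lebesgue_on \<Omega>. f p)"

lemma integrable_continuous_\<Omega>:
  fixes f :: "plane \<Rightarrow> real"
  assumes "continuous_on (cbox a b) f"
  shows "integrable (lebesgue_on \<Omega>) f"
proof (rule absolutely_integrable_imp_integrable)
  show "f absolutely_integrable_on \<Omega>"
    unfolding absolutely_integrable_on_open_interval by (rule absolutely_integrable_continuous[OF assms])
qed simp

text \<open>Passes from the Lebesgue integral over the open rectangle to the gauge integral over the
  closed one, to which the theorems on iterated integrals apply.\<close>

lemma rint_integral:
  assumes "continuous_on (cbox a b) f"
  shows "rint f = integral (cbox a b) f"
  unfolding rint_def integral_open_interval[symmetric]
  by (rule lebesgue_integral_eq_integral[OF integrable_continuous_\<Omega>[OF assms]]) simp

lemma rint_iterated: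
  assumes "continuous_on (cbox a b) f"
  shows "rint f = integral {fst a..fst b} (\<lambda>x. integral {snd a..snd b} (\<lambda>y. f (x, y)))"
  unfolding rint_integral[OF assms]
  using integral_prod_continuous[of "fst a" "snd a" "fst b" "snd b" f] assms by simp

lemma rint_iterated':
  assumes "continuous_on (cbox a b) f"
  shows "rint f = integral {snd a..snd b} (\<lambda>y. integral {fst a..fst b} (\<lambda>x. f (x, y)))"
  unfolding rint_iterated[OF assms]
  using integral_swap_continuous[of "fst a" "snd a" "fst b" "snd b" "\<lambda>x y. f (x, y)"] assms by simp

lemma rint_cpd_fst:
  assumes "smooth f"
  shows "rint (cpd (1, 0) f) = integral {snd a..snd b} (\<lambda>y. f (fst b, y) - f (fst a, y))"
proof -
  have "integral {fst a..fst b} (\<lambda>x. cpd (1, 0) f (x, y)) = f (fst b, y) - f (fst a, y)" for y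
    using ab smooth_DERIV_fst[OF assms]
    by (intro integral_unique fundamental_theorem_of_calculus)
      (auto simp: has_real_derivative_iff_has_vector_derivative[symmetric] intro: has_field_derivative_at_within)
  then show ?thesis
    by (simp add: rint_iterated'[OF smooth_continuous[OF smooth_cpd(1)[OF assms]]])
qed

lemma rint_cpd_snd:
  assumes "smooth f"
  shows "rint (cpd (0, 1) f) = integral {fst a..fst b} (\<lambda>x. f (x, snd b) - f (x, snd a))"
proof -
  have "integral {snd a..snd b} (\<lambda>y. cpd (0, 1) f (x, y)) = f (x, snd b) - f (x, snd a)" for x
    using ab smooth_DERIV_snd[OF assms]
    by (intro integral_unique fundamental_theorem_of_calculus)
      (auto simp: has_real_derivative_iff_has_vector_derivative[symmetric] intro: has_field_derivative_at_within)
  then show ?thesis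
    by (simp add: rint_iterated[OF smooth_continuous[OF smooth_cpd(2)[OF assms]]])
qed

lemma smooth_L2: "smooth f \<Longrightarrow> f \<in> L2 \<Omega>"
  unfolding L2_real_iff
  using integrable_continuous_\<Omega>[OF continuous_on_power[OF smooth_continuous]]
    continuous_imp_measurable_on_sets_lebesgue[OF smooth_continuous] by simp

lemma integrable_smooth: "smooth f \<Longrightarrow> integrable (lebesgue_on \<Omega>) f"
  by (rule integrable_continuous_\<Omega>[OF smooth_continuous])

lemma rint_add: "smooth f \<Longrightarrow> smooth g \<Longrightarrow> rint (\<lambda>p. f p + g p) = rint f + rint g"
  by (simp add: rint_def integrable_smooth)

lemma ip_rint: "ip \<Omega> f g = rint (\<lambda>p. f p * g p)"
  by (simp add: ip_real rint_def)

text \<open>The boundary values are kept: they vanish for test functions, but those of smooth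
  approximants of functions in \<open>H20\<close> only tend to zero.\<close>

lemma ip_cpd_fst:
  assumes "smooth f" "smooth g"
  shows "ip \<Omega> (cpd (1, 0) f) g =
    integral {snd a..snd b} (\<lambda>y. f (fst b, y) * g (fst b, y) - f (fst a, y) * g (fst a, y)) - ip \<Omega> f (cpd (1, 0) g)"
proof -
  have "rint (cpd (1, 0) (\<lambda>p. f p * g p)) = ip \<Omega> f (cpd (1, 0) g) + ip \<Omega> (cpd (1, 0) f) g"
    using assms by (simp add: cpd_mult ip_rint rint_add smooth_mult smooth_cpd)
  then show ?thesis
    using rint_cpd_fst[OF smooth_mult[OF assms]] by simp
qed

lemma ip_cpd_snd:
  assumes "smooth f" "smooth g"
  shows "ip \<Omega> (cpd (0, 1) f) g =
    integral {fst a..fst b} (\<lambda>x. f (x, snd b) * g (x, snd b) - f (x, snd a) * g (x, snd a)) - ip \<Omega> f (cpd (0, 1) g)"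
proof -
  have "rint (cpd (0, 1) (\<lambda>p. f p * g p)) = ip \<Omega> f (cpd (0, 1) g) + ip \<Omega> (cpd (0, 1) f) g"
    using assms by (simp add: cpd_mult ip_rint rint_add smooth_mult smooth_cpd)
  then show ?thesis
    using rint_cpd_snd[OF smooth_mult[OF assms]] by simp
qed

lemma test_function_smooth: "\<phi> \<in> test_functions \<Omega> \<Longrightarrow> smooth \<phi>"
  by (simp add: test_functions_def)

lemma test_function_zero: "\<phi> \<in> test_functions \<Omega> \<Longrightarrow> p \<notin> \<Omega> \<Longrightarrow> \<phi> p = 0"
  using closure_subset[of "{p. \<phi> p \<noteq> 0}"] unfolding test_functions_def by blast

text \<open>Off the closed support the function is zero in a neighbourhood, so its derivatives
  vanish there. The lemma makes second derivatives of test functions available in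
  \<open>wpd_commute\<close>.\<close>

lemma test_function_cpd:
  assumes "\<phi> \<in> test_functions \<Omega>"
  shows "cpd (1, 0) \<phi> \<in> test_functions \<Omega>" "cpd (0, 1) \<phi> \<in> test_functions \<Omega>"
proof -
  have sub: "closure {p. cpd e \<phi> p \<noteq> 0} \<subseteq> closure {p. \<phi> p \<noteq> 0}" for e
  proof (rule closure_minimal)
    show "{p. cpd e \<phi> p \<noteq> 0} \<subseteq> closure {p. \<phi> p \<noteq> 0}"
    proof safe
      fix x y assume n: "cpd e \<phi> (x, y) \<noteq> 0"
      show "(x, y) \<in> closure {p. \<phi> p \<noteq> 0}"
      proof (rule ccontr)
        assume "(x, y) \<notin> closure {p. \<phi> p \<noteq> 0}"
        then have 1: "(x, y) \<in> - closure {p. \<phi> p \<noteq> 0}" by blast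
        have 2: "0 = \<phi> q" if "q \<in> - closure {p. \<phi> p \<noteq> 0}" for q
          using that closure_subset[of "{p. \<phi> p \<noteq> 0}"] by fastforce
        have "(\<phi> has_derivative (\<lambda>h. 0)) (at (x, y))"
          by (rule has_derivative_transform_within_open[OF has_derivative_const open_Compl[OF closed_closure] 1 2])
        from cpd_eq[OF this] n show False by simp
      qed
    qed
  qed simp
  have "compact (closure {p. cpd e \<phi> p \<noteq> 0}) \<and> closure {p. cpd e \<phi> p \<noteq> 0} \<subseteq> \<Omega>" for e
  proof
    have \<phi>: "compact (closure {p. \<phi> p \<noteq> 0})" "closure {p. \<phi> p \<noteq> 0} \<subseteq> \<Omega>"
      using assms by (simp_all add: test_functions_def)
    show "compact (closure {p. cpd e \<phi> p \<noteq> 0})"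
      using closed_Int_compact[OF closed_closure \<phi>(1)] sub[of e] by (metis Int_absorb2)
    show "closure {p. cpd e \<phi> p \<noteq> 0} \<subseteq> \<Omega>"
      using sub[of e] \<phi>(2) by (rule order_trans)
  qed
  then show "cpd (1, 0) \<phi> \<in> test_functions \<Omega>" "cpd (0, 1) \<phi> \<in> test_functions \<Omega>"
    using smooth_cpd[OF test_function_smooth[OF assms]] by (simp_all add: test_functions_def)
qed

lemma smooth_weak_partial:
  assumes "smooth f"
  shows "weak_partial \<Omega> (1, 0) f (cpd (1, 0) f)" "weak_partial \<Omega> (0, 1) f (cpd (0, 1) f)"
proof -
  have "ip \<Omega> f (cpd (1, 0) \<phi>) = - ip \<Omega> (cpd (1, 0) f) \<phi>" "ip \<Omega> f (cpd (0, 1) \<phi>) = - ip \<Omega> (cpd (0, 1) f) \<phi>"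
    if "\<phi> \<in> test_functions \<Omega>" for \<phi>
  proof -
    have "\<phi> (fst b, y) = 0" "\<phi> (fst a, y) = 0" "\<phi> (x, snd b) = 0" "\<phi> (x, snd a) = 0" for x y
      using that by (auto intro!: test_function_zero simp: mem_box_plane)
    then show "ip \<Omega> f (cpd (1, 0) \<phi>) = - ip \<Omega> (cpd (1, 0) f) \<phi>" "ip \<Omega> f (cpd (0, 1) \<phi>) = - ip \<Omega> (cpd (0, 1) f) \<phi>"
      using ip_cpd_fst[OF assms test_function_smooth[OF that]] ip_cpd_snd[OF assms test_function_smooth[OF that]] by auto
  qed
  then show "weak_partial \<Omega> (1, 0) f (cpd (1, 0) f)" "weak_partial \<Omega> (0, 1) f (cpd (0, 1) f)"
    using assms by (auto simp: weak_partial_def smooth_L2 smooth_cpd)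
qed

section \<open>Weak derivatives\<close>

lemma weak_partial_unique:
  assumes "weak_partial \<Omega> e f g" "weak_partial \<Omega> e f h"
  shows "AE p in lebesgue_on \<Omega>. g p = h p"
proof -
  have "AE p in lebesgue_on \<Omega>. g p - h p = 0"
  proof (rule fundamental_lemma)
    show "(\<lambda>p. g p - h p) \<in> L2 \<Omega>"
      using assms by (auto simp: weak_partial_def intro: L2_diff)
    fix \<phi> assume "\<phi> \<in> test_functions \<Omega>"
    then show "ip \<Omega> (\<lambda>p. g p - h p) \<phi> = 0"
      using assms smooth_L2[OF test_function_smooth] by (simp add: weak_partial_def ip_diff_left)
  qed
  then show ?thesis by simp
qed

lemma weak_partial_wpd: "weak_partial \<Omega> e f g \<Longrightarrow> weak_partial \<Omega> e f (wpd \<Omega> e f)"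
  unfolding wpd_def by (rule someI[of "weak_partial \<Omega> e f"])

lemma wpd_AE: "weak_partial \<Omega> e f g \<Longrightarrow> AE p in lebesgue_on \<Omega>. wpd \<Omega> e f p = g p"
  using weak_partial_unique weak_partial_wpd by blast

lemma weak_partial_cong:
  assumes "AE p in lebesgue_on \<Omega>. f p = f' p"
  shows "weak_partial \<Omega> e f g = weak_partial \<Omega> e f' g"
proof -
  have "weak_partial \<Omega> e f' g" if "weak_partial \<Omega> e f g" "AE p in lebesgue_on \<Omega>. f p = f' p" for f f'
  proof -
    have "ip \<Omega> f (cpd e \<phi>) = ip \<Omega> f' (cpd e \<phi>)" if "\<phi> \<in> test_functions \<Omega>" for \<phi>
    proof (cases "cpd e \<phi> \<in> borel_measurable (lebesgue_on \<Omega>)")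
      case True
      then show ?thesis
        using \<open>weak_partial \<Omega> e f g\<close> \<open>AE p in lebesgue_on \<Omega>. f p = f' p\<close>
        by (intro ip_cong_AE) (auto simp: weak_partial_def L2_real_iff)
    next
      case False
      \<comment> \<open>Measurability is automatic also for an arbitrary direction \<open>e\<close>,
        because the derivative is a combination of the two coordinate derivatives.\<close>
      have "cpd e \<phi> = (\<lambda>p. fst e * cpd (1, 0) \<phi> p + snd e * cpd (0, 1) \<phi> p)"
        by (rule ext, rule cpd_eq, rule smooth_has_derivative, rule test_function_smooth[OF that])
      then have "smooth (cpd e \<phi>)"
        using smooth_cpd[OF test_function_smooth[OF that]] by (auto intro!: smooth_add smooth_scale)
      then show ?thesis using False smooth_L2 by (auto simp: L2_real_iff)
    qed
    then show ?thesis
      using that L2_cong_AE[OF that(2)] by (auto simp: weak_partial_def)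
  qed
  moreover have "AE p in lebesgue_on \<Omega>. f' p = f p"
    using assms by (rule eventually_mono) simp
  ultimately show ?thesis using assms by blast
qed

text \<open>The representative is chosen from the predicate
  \<open>weak_partial \<Omega> e f\<close>, which is the same for both functions. Hence the equality
  is one of functions and not only almost everywhere, and derivatives of derivatives can be
  rewritten.\<close>

lemma wpd_cong: "AE p in lebesgue_on \<Omega>. f p = f' p \<Longrightarrow> wpd \<Omega> e f = wpd \<Omega> e f'"
  unfolding wpd_def using weak_partial_cong by presburger

lemma lap_cong: "AE p in lebesgue_on \<Omega>. f p = f' p \<Longrightarrow> lap \<Omega> f = lap \<Omega> f'"
  unfolding lap_def[abs_def] by (simp add: wpd_cong)

lemma grad_cong: "AE p in lebesgue_on \<Omega>. f p = f' p \<Longrightarrow> grad \<Omega> f = grad \<Omega> f'"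
  unfolding grad_def[abs_def] by (simp add: wpd_cong)

lemma weak_partial_add:
  assumes "weak_partial \<Omega> e f g" "weak_partial \<Omega> e f' g'" "e \<in> {(1, 0), (0, 1)}"
  shows "weak_partial \<Omega> e (\<lambda>p. f p + f' p) (\<lambda>p. g p + g' p)"
  unfolding weak_partial_def
proof (intro conjI ballI)
  fix \<phi> assume \<phi>: "\<phi> \<in> test_functions \<Omega>"
  have "\<phi> \<in> L2 \<Omega>" "cpd e \<phi> \<in> L2 \<Omega>"
    using assms(3) smooth_L2[OF test_function_smooth[OF \<phi>]] smooth_L2[OF test_function_smooth[OF test_function_cpd(1)[OF \<phi>]]]
       smooth_L2[OF test_function_smooth[OF test_function_cpd(2)[OF \<phi>]]]
    by auto
  then show "ip \<Omega> (\<lambda>p. f p + f' p) (cpd e \<phi>) = - ip \<Omega> (\<lambda>p. g p + g' p) \<phi>"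
    using assms \<phi> by (simp add: weak_partial_def ip_add_left)
qed (use assms in \<open>auto simp: weak_partial_def intro: L2_add\<close>)

lemma weak_partial_scale:
  assumes "weak_partial \<Omega> e f g"
  shows "weak_partial \<Omega> e (\<lambda>p. c * f p) (\<lambda>p. c * g p)"
  using assms by (auto simp: weak_partial_def ip_scale_left L2_scale)

text \<open>Restricted to the coordinate directions, since these are the ones for which derivatives
  of test functions are known to be test functions again.\<close>

definition has_wpd :: "plane \<Rightarrow> (plane \<Rightarrow> real) \<Rightarrow> bool" where
  "has_wpd e f \<longleftrightarrow> e \<in> {(1, 0), (0, 1)} \<and> (\<exists>g. weak_partial \<Omega> e f g)"

lemma has_wpd_weak_partial: "has_wpd e f \<Longrightarrow> weak_partial \<Omega> e f (wpd \<Omega> e f)"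
  unfolding has_wpd_def using weak_partial_wpd by blast

lemma has_wpd_L2: "has_wpd e f \<Longrightarrow> wpd \<Omega> e f \<in> L2 \<Omega>" "has_wpd e f \<Longrightarrow> f \<in> L2 \<Omega>"
  using has_wpd_weak_partial by (auto simp: weak_partial_def)

lemma has_wpd_add: "has_wpd e f \<Longrightarrow> has_wpd e g \<Longrightarrow> has_wpd e (\<lambda>p. f p + g p)"
  unfolding has_wpd_def using weak_partial_add by blast

lemma has_wpd_scale: "has_wpd e f \<Longrightarrow> has_wpd e (\<lambda>p. c * f p)"
  unfolding has_wpd_def using weak_partial_scale by blast

lemma has_wpd_cong: "AE p in lebesgue_on \<Omega>. f p = f' p \<Longrightarrow> has_wpd e f = has_wpd e f'"
  unfolding has_wpd_def using weak_partial_cong by blast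

lemma wpd_add:
  assumes "has_wpd e f" "has_wpd e g"
  shows "AE p in lebesgue_on \<Omega>. wpd \<Omega> e (\<lambda>p. f p + g p) p = wpd \<Omega> e f p + wpd \<Omega> e g p"
  using assms by (intro wpd_AE weak_partial_add has_wpd_weak_partial) (auto simp: has_wpd_def)

lemma wpd_scale:
  assumes "has_wpd e f"
  shows "AE p in lebesgue_on \<Omega>. wpd \<Omega> e (\<lambda>p. c * f p) p = c * wpd \<Omega> e f p"
  using assms by (intro wpd_AE weak_partial_scale has_wpd_weak_partial)

lemma has_wpd_smooth: "smooth f \<Longrightarrow> e \<in> {(1, 0), (0, 1)} \<Longrightarrow> has_wpd e f"
  unfolding has_wpd_def using smooth_weak_partial by blast

lemma wpd_smooth: "smooth f \<Longrightarrow> e \<in> {(1, 0), (0, 1)} \<Longrightarrow> AE p in lebesgue_on \<Omega>. wpd \<Omega> e f p = cpd e f p"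
  using smooth_weak_partial wpd_AE by blast

lemma H1_iff: "f \<in> H1 \<Omega> \<longleftrightarrow> has_wpd (1, 0) f \<and> has_wpd (0, 1) f"
  by (auto simp: H1_def has_wpd_def weak_partial_def)

lemma H1_cong: "AE p in lebesgue_on \<Omega>. f p = f' p \<Longrightarrow> f \<in> H1 \<Omega> \<longleftrightarrow> f' \<in> H1 \<Omega>"
  unfolding H1_iff using has_wpd_cong by blast

lemma H1_add: "f \<in> H1 \<Omega> \<Longrightarrow> g \<in> H1 \<Omega> \<Longrightarrow> (\<lambda>p. f p + g p) \<in> H1 \<Omega>"
  by (simp add: H1_iff has_wpd_add)

lemma H1_scale: "f \<in> H1 \<Omega> \<Longrightarrow> (\<lambda>p. c * f p) \<in> H1 \<Omega>"
  by (simp add: H1_iff has_wpd_scale)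

lemma H1_smooth: "smooth f \<Longrightarrow> f \<in> H1 \<Omega>"
  by (simp add: H1_iff has_wpd_smooth)

lemma H1_L2:
  assumes "f \<in> H1 \<Omega>"
  shows "f \<in> L2 \<Omega>" "dx \<Omega> f \<in> L2 \<Omega>" "dy \<Omega> f \<in> L2 \<Omega>"
  using assms by (auto simp: H1_iff has_wpd_L2)

text \<open>The derivative of the sum equals the sum of the derivatives only almost everywhere, so
  its membership in \<open>H1\<close> goes through \<open>H1_cong\<close>.\<close>

lemma H2_add: 
  assumes "f \<in> H2 \<Omega>" "g \<in> H2 \<Omega>"
  shows "(\<lambda>p. f p + g p) \<in> H2 \<Omega>"
  using assms H1_cong[OF wpd_add[of "(1,0)" f g]] H1_cong[OF wpd_add[of "(0,1)" f g]]
  by (auto simp: H2_def H1_add) (auto simp: H1_iff has_wpd_add)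

lemma H2_scale:
  assumes "f \<in> H2 \<Omega>"
  shows "(\<lambda>p. c * f p) \<in> H2 \<Omega>"
  using assms H1_cong[OF wpd_scale[of "(1,0)" f c]] H1_cong[OF wpd_scale[of "(0,1)" f c]]
  by (auto simp: H2_def H1_scale) (auto simp: H1_iff has_wpd_scale)

lemma H2_smooth:
  assumes "smooth f"
  shows "f \<in> H2 \<Omega>"
  using assms H1_cong[OF wpd_smooth[OF assms, of "(1,0)"]] H1_cong[OF wpd_smooth[OF assms, of "(0,1)"]]
  by (simp add: H2_def H1_smooth smooth_cpd)

lemma H2_D:
  assumes "f \<in> H2 \<Omega>"
  shows "has_wpd (1,0) f" "has_wpd (0,1) f" "has_wpd (1,0) (dx \<Omega> f)" "has_wpd (0,1) (dx \<Omega> f)"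
    "has_wpd (1,0) (dy \<Omega> f)" "has_wpd (0,1) (dy \<Omega> f)"
  using assms by (auto simp: H2_def H1_iff)

lemma wpd_wpd_add:
  assumes "has_wpd e f" "has_wpd e g" "has_wpd e' (wpd \<Omega> e f)" "has_wpd e' (wpd \<Omega> e g)"
  shows "AE p in lebesgue_on \<Omega>. wpd \<Omega> e' (wpd \<Omega> e (\<lambda>p. f p + g p)) p = wpd \<Omega> e' (wpd \<Omega> e f) p + wpd \<Omega> e' (wpd \<Omega> e g) p"
  unfolding wpd_cong[OF wpd_add[OF assms(1,2)]] using assms(3,4) by (rule wpd_add)

lemma wpd_wpd_scale:
  assumes "has_wpd e f" "has_wpd e' (wpd \<Omega> e f)"
  shows "AE p in lebesgue_on \<Omega>. wpd \<Omega> e' (wpd \<Omega> e (\<lambda>p. c * f p)) p = c * wpd \<Omega> e' (wpd \<Omega> e f) p"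
  unfolding wpd_cong[OF wpd_scale[OF assms(1)]] using assms(2) by (rule wpd_scale)

lemma lap_add:
  assumes "f \<in> H2 \<Omega>" "g \<in> H2 \<Omega>"
  shows "AE p in lebesgue_on \<Omega>. lap \<Omega> (\<lambda>p. f p + g p) p = lap \<Omega> f p + lap \<Omega> g p"
  using wpd_wpd_add[OF H2_D(1)[OF assms(1)] H2_D(1)[OF assms(2)] H2_D(3)[OF assms(1)] H2_D(3)[OF assms(2)]]
    wpd_wpd_add[OF H2_D(2)[OF assms(1)] H2_D(2)[OF assms(2)] H2_D(6)[OF assms(1)] H2_D(6)[OF assms(2)]]
  by eventually_elim (simp add: lap_def)

lemma lap_scale:
  assumes "f \<in> H2 \<Omega>"
  shows "AE p in lebesgue_on \<Omega>. lap \<Omega> (\<lambda>p. c * f p) p = c * lap \<Omega> f p"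
  using wpd_wpd_scale[OF H2_D(1)[OF assms(1)] H2_D(3)[OF assms(1)], of c]
    wpd_wpd_scale[OF H2_D(2)[OF assms(1)] H2_D(6)[OF assms(1)], of c]
  by eventually_elim (simp add: lap_def algebra_simps)

lemma lap_L2: "f \<in> H2 \<Omega> \<Longrightarrow> lap \<Omega> f \<in> L2 \<Omega>"
  unfolding lap_def[abs_def] using H2_D by (intro L2_add has_wpd_L2)

text \<open>Moved onto a test function, both mixed derivatives become mixed derivatives of that test
  function, which agree by \<open>cpd_symmetric\<close>; the fundamental lemma does the
  rest.\<close>

lemma wpd_commute:
  assumes "f \<in> H2 \<Omega>"
  shows "AE p in lebesgue_on \<Omega>. dx \<Omega> (dy \<Omega> f) p = dy \<Omega> (dx \<Omega> f) p"
proof -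
  let ?h = "\<lambda>p. dx \<Omega> (dy \<Omega> f) p - dy \<Omega> (dx \<Omega> f) p"
  note D = H2_D[OF assms]
  note L = has_wpd_L2[OF D(5)] has_wpd_L2[OF D(4)]
  have "AE p in lebesgue_on \<Omega>. ?h p = 0"
  proof (rule fundamental_lemma)
    show "?h \<in> L2 \<Omega>" using L by (intro L2_diff)
    fix \<phi> assume \<phi>: "\<phi> \<in> test_functions \<Omega>"
    note s = test_function_smooth[OF \<phi>]
    have "ip \<Omega> (dx \<Omega> (dy \<Omega> f)) \<phi> = ip \<Omega> f (cpd (0, 1) (cpd (1, 0) \<phi>))"
      using has_wpd_weak_partial[OF D(5)] has_wpd_weak_partial[OF D(2)] \<phi> test_function_cpd[OF \<phi>]
      by (auto simp: weak_partial_def)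
    moreover have "ip \<Omega> (dy \<Omega> (dx \<Omega> f)) \<phi> = ip \<Omega> f (cpd (1, 0) (cpd (0, 1) \<phi>))"
      using has_wpd_weak_partial[OF D(4)] has_wpd_weak_partial[OF D(1)] \<phi> test_function_cpd[OF \<phi>]
      by (auto simp: weak_partial_def)
    ultimately show "ip \<Omega> ?h \<phi> = 0"
      using L smooth_L2[OF s] by (simp add: ip_diff_left cpd_symmetric[OF s])
  qed
  then show ?thesis by simp
qed

end

section \<open>One-dimensional estimates\<close>

lemma integral_Cauchy_Schwarz:
  fixes f g :: "real \<Rightarrow> real"
  assumes "continuous_on {c..d} f" "continuous_on {c..d} g"
  shows "\<bar>integral {c..d} (\<lambda>x. f x * g x)\<bar> \<le> sqrt (integral {c..d} (\<lambda>x. (f x)\<^sup>2)) * sqrt (integral {c..d} (\<lambda>x. (g x)\<^sup>2))"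
proof -
  have i: "(\<lambda>x. f x * g x) integrable_on {c..d}" "(\<lambda>x. (f x)\<^sup>2) integrable_on {c..d}" "(\<lambda>x. (g x)\<^sup>2) integrable_on {c..d}"
    by (intro integrable_continuous_real continuous_intros assms)+
  have "0 \<le> integral {c..d} (\<lambda>x. (f x)\<^sup>2) + t * (2 * integral {c..d} (\<lambda>x. f x * g x)) + t\<^sup>2 * integral {c..d} (\<lambda>x. (g x)\<^sup>2)" for t
  proof -
    have "((\<lambda>x. (f x)\<^sup>2 + t * (2 * (f x * g x)) + t\<^sup>2 * (g x)\<^sup>2) has_integral
      (integral {c..d} (\<lambda>x. (f x)\<^sup>2) + t * (2 * integral {c..d} (\<lambda>x. f x * g x)) + t\<^sup>2 * integral {c..d} (\<lambda>x. (g x)\<^sup>2))) {c..d}"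
      by (intro has_integral_add has_integral_mult_right integrable_integral i)
    moreover have "(f x)\<^sup>2 + t * (2 * (f x * g x)) + t\<^sup>2 * (g x)\<^sup>2 = (f x + t * g x)\<^sup>2" for x
      by (simp add: power2_eq_square algebra_simps)
    ultimately show ?thesis by (auto intro: has_integral_nonneg)
  qed
  then have "(integral {c..d} (\<lambda>x. f x * g x))\<^sup>2 \<le> integral {c..d} (\<lambda>x. (f x)\<^sup>2) * integral {c..d} (\<lambda>x. (g x)\<^sup>2)"
    by (rule discriminant_le) (simp add: integral_nonneg i)
  then have "sqrt ((integral {c..d} (\<lambda>x. f x * g x))\<^sup>2) \<le> sqrt (integral {c..d} (\<lambda>x. (f x)\<^sup>2) * integral {c..d} (\<lambda>x. (g x)\<^sup>2))"
    by (rule real_sqrt_le_mono)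
  then show ?thesis by (simp add: real_sqrt_mult)
qed

text \<open>Somewhere \<open>f\<^sup>2\<close> is at most its mean; the increment from there is an integral of \<open>2 f f'\<close>.\<close>

lemma sup_square_le:
  fixes f f' :: "real \<Rightarrow> real"
  assumes cd: "c < d" and \<epsilon>: "\<epsilon> > 0" and f: "\<And>x. (f has_real_derivative f' x) (at x)"
    and f': "continuous_on {c..d} f'" and x: "x \<in> {c..d}"
  shows "(f x)\<^sup>2 \<le> (1 / (d - c) + 1 / \<epsilon>) * integral {c..d} (\<lambda>x. (f x)\<^sup>2) + \<epsilon> * integral {c..d} (\<lambda>x. (f' x)\<^sup>2)"
proof -
  have cf: "continuous_on {c..d} f"
    using f DERIV_isCont continuous_at_imp_continuous_on by blast
  \<comment> \<open>\<open>h\<close> is the bound for 2 f f' from Young's inequality with weight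
    \<epsilon>. Being nonnegative, its integral over any part of the interval is at most that over
    the whole.\<close>
  define h where "h x = (f x)\<^sup>2 / \<epsilon> + \<epsilon> * (f' x)\<^sup>2" for x
  have ch: "continuous_on {c..d} h"
    unfolding h_def using \<epsilon> by (intro continuous_intros cf f') auto
  have h0: "0 \<le> h x" for x using \<epsilon> by (simp add: h_def)
  have hle: "\<bar>2 * f x * f' x\<bar> \<le> h x" for x
  proof -
    have "0 \<le> (\<bar>f x\<bar> / sqrt \<epsilon> - sqrt \<epsilon> * \<bar>f' x\<bar>)\<^sup>2" by simp
    also have "\<dots> = h x - \<bar>2 * f x * f' x\<bar>"
      using \<epsilon> by (simp add: h_def power2_diff power_divide power_mult_distrib abs_mult)
    finally show ?thesis by simp
  qed
  have var: "\<bar>(f v)\<^sup>2 - (f u)\<^sup>2\<bar> \<le> integral {c..d} h" if "c \<le> u" "u \<le> v" "v \<le> d" for u v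
  proof -
    have sub: "{u..v} \<subseteq> {c..d}" using that by auto
    have i: "h integrable_on {u..v}" using ch sub by (meson continuous_on_subset integrable_continuous_real)
    have "((\<lambda>x. 2 * f x * f' x) has_integral ((f v)\<^sup>2 - (f u)\<^sup>2)) {u..v}"
    proof (rule fundamental_theorem_of_calculus[OF that(2)])
      fix x
      have "((\<lambda>x. (f x)\<^sup>2) has_real_derivative 2 * f x * f' x) (at x within {u..v})"
        using f[of x, THEN has_field_derivative_at_within] by (auto intro!: derivative_eq_intros)
      then show "((\<lambda>x. (f x)\<^sup>2) has_vector_derivative 2 * f x * f' x) (at x within {u..v})"
        by (simp add: has_real_derivative_iff_has_vector_derivative)
    qed
    then have "\<bar>(f v)\<^sup>2 - (f u)\<^sup>2\<bar> \<le> integral {u..v} h"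
      using integral_norm_bound_integral[of "\<lambda>x. 2 * f x * f' x" "{u..v}" h] i hle
      by (auto simp: has_integral_iff)
    also have "\<dots> \<le> integral {c..d} h"
      using h0 by (intro integral_subset_le[OF sub i integrable_continuous_real[OF ch]]) auto
    finally show ?thesis .
  qed
  obtain z where z: "z \<in> {c..d}" "\<And>y. y \<in> {c..d} \<Longrightarrow> (f z)\<^sup>2 \<le> (f y)\<^sup>2"
    using continuous_attains_inf[of "{c..d}" "\<lambda>x. (f x)\<^sup>2", OF compact_Icc _ continuous_on_power[OF cf]] cd
    by fastforce
  have "integral {c..d} (\<lambda>_. (f z)\<^sup>2) \<le> integral {c..d} (\<lambda>x. (f x)\<^sup>2)"
    using z by (intro integral_le integrable_continuous_real continuous_intros cf) auto
  then have "(f z)\<^sup>2 \<le> integral {c..d} (\<lambda>x. (f x)\<^sup>2) / (d - c)"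
    using cd by (simp add: field_simps)
  moreover have "(f x)\<^sup>2 - (f z)\<^sup>2 \<le> integral {c..d} h"
    using var[of z x] var[of x z] z(1) x by (cases "z \<le> x") (auto simp: abs_le_iff)
  moreover have "integral {c..d} h = integral {c..d} (\<lambda>x. (f x)\<^sup>2) / \<epsilon> + \<epsilon> * integral {c..d} (\<lambda>x. (f' x)\<^sup>2)"
    unfolding h_def by (subst integral_add) (auto intro!: integrable_continuous_real continuous_intros cf f' simp: \<epsilon>[THEN less_imp_neq, symmetric])
  ultimately show ?thesis by (simp add: algebra_simps)
qed

text \<open>Fix \<epsilon> with \<epsilon> M < r; for this \<epsilon> the remaining term tends to
  zero. With \<open>t\<close> a squared L2 norm and \<open>M\<close> a bound for the squared norm of
  the derivative, \<open>sup_square_le\<close> thus yields pointwise convergence.\<close>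

lemma tendsto_zero_interpolation:
  fixes s t :: "nat \<Rightarrow> real"
  assumes t: "t \<longlonglongrightarrow> 0" and s: "\<And>n. 0 \<le> s n" and M: "\<And>\<epsilon> n. \<epsilon> > 0 \<Longrightarrow> s n \<le> (c + 1 / \<epsilon>) * t n + \<epsilon> * M"
  shows "s \<longlonglongrightarrow> 0"
proof (rule LIMSEQ_I)
  fix r :: real assume r: "r > 0"
  \<comment> \<open>The absolute value and the added 1 keep the denominator positive for every real
    \<open>M\<close>.\<close>
  define \<epsilon> where "\<epsilon> = r / (2 * (\<bar>M\<bar> + 1))"
  have e: "\<epsilon> > 0" using r by (simp add: \<epsilon>_def)
  have eM: "\<epsilon> * M < r"
  proof -
    have "\<epsilon> * M \<le> \<epsilon> * (\<bar>M\<bar> + 1)" using e by (intro mult_left_mono) auto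
    also have "\<dots> = r / 2" by (simp add: \<epsilon>_def field_simps add_nonneg_eq_0_iff)
    finally show ?thesis using r by simp
  qed
  have "(\<lambda>n. (c + 1 / \<epsilon>) * t n + \<epsilon> * M) \<longlonglongrightarrow> (c + 1 / \<epsilon>) * 0 + \<epsilon> * M"
    by (intro tendsto_intros t)
  then have "eventually (\<lambda>n. (c + 1 / \<epsilon>) * t n + \<epsilon> * M < r) sequentially"
    using eM by (intro order_tendstoD) auto
  then obtain N where N: "\<And>n. n \<ge> N \<Longrightarrow> (c + 1 / \<epsilon>) * t n + \<epsilon> * M < r"
    by (auto simp: eventually_sequentially)
  have "norm (s n - 0) < r" if "n \<ge> N" for n
    using s[of n] M[OF e, of n] N[OF that] by simp
  then show "\<exists>no. \<forall>n\<ge>no. norm (s n - 0) < r" by blast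
qed

context rectangle begin

lemma sup_square_le_fst:
  assumes "smooth f" "\<epsilon> > 0" "x \<in> {fst a..fst b}"
  shows "(f (x, y))\<^sup>2 \<le> (1 / (fst b - fst a) + 1 / \<epsilon>) * integral {fst a..fst b} (\<lambda>x. (f (x, y))\<^sup>2)
    + \<epsilon> * integral {fst a..fst b} (\<lambda>x. (cpd (1, 0) f (x, y))\<^sup>2)"
  using sup_square_le[OF ab(1) assms(2) smooth_DERIV_fst[OF assms(1), of y] smooth_continuous_fst[OF smooth_cpd(1)[OF assms(1)]] assms(3)] .

lemma sup_square_le_snd:
  assumes "smooth f" "\<epsilon> > 0" "y \<in> {snd a..snd b}"
  shows "(f (x, y))\<^sup>2 \<le> (1 / (snd b - snd a) + 1 / \<epsilon>) * integral {snd a..snd b} (\<lambda>y. (f (x, y))\<^sup>2)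
    + \<epsilon> * integral {snd a..snd b} (\<lambda>y. (cpd (0, 1) f (x, y))\<^sup>2)"
  using sup_square_le[OF ab(2) assms(2) smooth_DERIV_snd[OF assms(1), of x] smooth_continuous_snd[OF smooth_cpd(2)[OF assms(1)]] assms(3)] .

section \<open>Trace and Ladyzhenskaya inequalities\<close>

text \<open>Embedding constants of H1 into the bounded functions on a horizontal and on a vertical
  segment, from \<open>sup_square_le\<close> with \<epsilon> = 1. Both exceed 1, so the same
  constant also covers the derivative term.\<close>

definition "K\<^sub>1 = 1 / (fst b - fst a) + 1"
definition "K\<^sub>2 = 1 / (snd b - snd a) + 1"

lemma K_pos: "K\<^sub>1 > 0" "K\<^sub>2 > 0"
  using ab by (auto simp: K\<^sub>1_def K\<^sub>2_def intro!: add_pos_pos)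

lemma continuous_integral_fst:
  assumes "smooth f"
  shows "continuous_on S (\<lambda>y. integral {fst a..fst b} (\<lambda>x. f (x, y)))"
  unfolding cbox_interval[symmetric]
proof (rule integral_continuous_on_param)
  have "continuous_on (S \<times> cbox (fst a) (fst b)) (\<lambda>z. f (snd z, fst z))"
    by (rule continuous_on_compose2[OF smooth_continuous[OF assms, of UNIV]]) (auto intro!: continuous_intros)
  then show "continuous_on (S \<times> cbox (fst a) (fst b)) (\<lambda>(y, x). f (x, y))"
    by (simp add: case_prod_beta')
qed

lemma continuous_integral_snd:
  assumes "smooth f"
  shows "continuous_on S (\<lambda>x. integral {snd a..snd b} (\<lambda>y. f (x, y)))"
  unfolding cbox_interval[symmetric]
proof (rule integral_continuous_on_param)
  show "continuous_on (S \<times> cbox (snd a) (snd b)) (\<lambda>(x, y). f (x, y))"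
    using smooth_continuous[OF assms] by (simp add: case_prod_beta')
qed

lemma smooth_square: "smooth f \<Longrightarrow> smooth (\<lambda>p. (f p)\<^sup>2)"
  by (simp add: power2_eq_square smooth_mult)

lemma rint_square: "rint (\<lambda>p. (f p)\<^sup>2) = (nrm \<Omega> f)\<^sup>2"
  unfolding nrm_sq ip_rint by (simp add: power2_eq_square)

lemma smooth_square_le_snd:
  assumes "smooth f" "y \<in> {snd a..snd b}"
  shows "(f (x, y))\<^sup>2 \<le> K\<^sub>2 * integral {snd a..snd b} (\<lambda>y. (f (x, y))\<^sup>2 + (cpd (0, 1) f (x, y))\<^sup>2)"
proof -
  have i: "(\<lambda>y. (f (x, y))\<^sup>2) integrable_on {snd a..snd b}" "(\<lambda>y. (cpd (0, 1) f (x, y))\<^sup>2) integrable_on {snd a..snd b}"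
    by (intro integrable_continuous_real continuous_on_power smooth_continuous_snd assms(1) smooth_cpd(2)[OF assms(1)])+
  have "1 * integral {snd a..snd b} (\<lambda>y. (cpd (0, 1) f (x, y))\<^sup>2) \<le> K\<^sub>2 * integral {snd a..snd b} (\<lambda>y. (cpd (0, 1) f (x, y))\<^sup>2)"
    using ab i by (intro mult_right_mono integral_nonneg) (auto simp: K\<^sub>2_def)
  then show ?thesis
    using sup_square_le_snd[OF assms(1) zero_less_one assms(2), of x] i by (simp add: integral_add K\<^sub>2_def algebra_simps)
qed

lemma smooth_square_le_fst:
  assumes "smooth f" "x \<in> {fst a..fst b}"
  shows "(f (x, y))\<^sup>2 \<le> K\<^sub>1 * integral {fst a..fst b} (\<lambda>x. (f (x, y))\<^sup>2 + (cpd (1, 0) f (x, y))\<^sup>2)"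
proof -
  have i: "(\<lambda>x. (f (x, y))\<^sup>2) integrable_on {fst a..fst b}" "(\<lambda>x. (cpd (1, 0) f (x, y))\<^sup>2) integrable_on {fst a..fst b}"
    by (intro integrable_continuous_real continuous_on_power smooth_continuous_fst assms(1) smooth_cpd(1)[OF assms(1)])+
  have "1 * integral {fst a..fst b} (\<lambda>x. (cpd (1, 0) f (x, y))\<^sup>2) \<le> K\<^sub>1 * integral {fst a..fst b} (\<lambda>x. (cpd (1, 0) f (x, y))\<^sup>2)"
    using ab i by (intro mult_right_mono integral_nonneg) (auto simp: K\<^sub>1_def)
  then show ?thesis
    using sup_square_le_fst[OF assms(1) zero_less_one assms(2), of y] i by (simp add: integral_add K\<^sub>1_def algebra_simps)
qed

lemma integral_iterated_squares:
  assumes "smooth f"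
  shows "integral {fst a..fst b} (\<lambda>x. integral {snd a..snd b} (\<lambda>y. (f (x, y))\<^sup>2 + (cpd (0, 1) f (x, y))\<^sup>2))
      = (nrm \<Omega> f)\<^sup>2 + (nrm \<Omega> (cpd (0, 1) f))\<^sup>2"
    and "integral {snd a..snd b} (\<lambda>y. integral {fst a..fst b} (\<lambda>x. (f (x, y))\<^sup>2 + (cpd (1, 0) f (x, y))\<^sup>2))
      = (nrm \<Omega> f)\<^sup>2 + (nrm \<Omega> (cpd (1, 0) f))\<^sup>2"
proof -
  note s = assms smooth_cpd[OF assms]
  show "integral {fst a..fst b} (\<lambda>x. integral {snd a..snd b} (\<lambda>y. (f (x, y))\<^sup>2 + (cpd (0, 1) f (x, y))\<^sup>2))
      = (nrm \<Omega> f)\<^sup>2 + (nrm \<Omega> (cpd (0, 1) f))\<^sup>2"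
    using rint_iterated[OF smooth_continuous[OF smooth_add[OF smooth_square[OF s(1)] smooth_square[OF s(3)]]]]
    by (simp add: rint_add smooth_square s rint_square)
  show "integral {snd a..snd b} (\<lambda>y. integral {fst a..fst b} (\<lambda>x. (f (x, y))\<^sup>2 + (cpd (1, 0) f (x, y))\<^sup>2))
      = (nrm \<Omega> f)\<^sup>2 + (nrm \<Omega> (cpd (1, 0) f))\<^sup>2"
    using rint_iterated'[OF smooth_continuous[OF smooth_add[OF smooth_square[OF s(1)] smooth_square[OF s(2)]]]]
    by (simp add: rint_add smooth_square s rint_square)
qed

text \<open>The pointwise bound on vertical segments, integrated in x. Applied to
  \<open>cpd (1, 0) (w n)\<close> it bounds the tangential derivative of the approximants on the
  horizontal sides.\<close>

lemma trace_snd_le: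
  assumes f: "smooth f" and y: "y \<in> {snd a..snd b}"
  shows "integral {fst a..fst b} (\<lambda>x. (f (x, y))\<^sup>2) \<le> K\<^sub>2 * ((nrm \<Omega> f)\<^sup>2 + (nrm \<Omega> (cpd (0, 1) f))\<^sup>2)"
proof -
  have "smooth (\<lambda>p. (f p)\<^sup>2 + (cpd (0, 1) f p)\<^sup>2)"
    using f by (intro smooth_add smooth_square smooth_cpd)
  from continuous_integral_snd[OF this]
  have "integral {fst a..fst b} (\<lambda>x. (f (x, y))\<^sup>2) \<le>
    integral {fst a..fst b} (\<lambda>x. K\<^sub>2 * integral {snd a..snd b} (\<lambda>y. (f (x, y))\<^sup>2 + (cpd (0, 1) f (x, y))\<^sup>2))"
    using f y by (intro integral_le integrable_continuous_real continuous_on_mult continuous_on_const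
      smooth_continuous_fst smooth_square smooth_square_le_snd)
  then show ?thesis by (simp add: integral_iterated_squares(1)[OF f])
qed

text \<open>The square of f at (x,y) is bounded by a function \<open>A\<close> of y alone and by a
  function \<open>B\<close> of x alone, so its fourth power is at most B(x) A(y), whose double
  integral factors.\<close>

lemma Ladyzhenskaya:
  assumes f: "smooth f"
  shows "rint (\<lambda>p. (f p)^4) \<le> K\<^sub>1 * K\<^sub>2 * (((nrm \<Omega> f)\<^sup>2 + (nrm \<Omega> (cpd (1, 0) f))\<^sup>2) * ((nrm \<Omega> f)\<^sup>2 + (nrm \<Omega> (cpd (0, 1) f))\<^sup>2))"
proof -
  define A where "A y = K\<^sub>1 * integral {fst a..fst b} (\<lambda>x. (f (x, y))\<^sup>2 + (cpd (1, 0) f (x, y))\<^sup>2)" for y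
  define B where "B x = K\<^sub>2 * integral {snd a..snd b} (\<lambda>y. (f (x, y))\<^sup>2 + (cpd (0, 1) f (x, y))\<^sup>2)" for x
  have cA: "continuous_on S A" for S
  proof -
    have "smooth (\<lambda>p. (f p)\<^sup>2 + (cpd (1, 0) f p)\<^sup>2)"
      using f by (intro smooth_add smooth_square smooth_cpd)
    from continuous_integral_fst[OF this] show ?thesis
      unfolding A_def by (intro continuous_on_mult continuous_on_const)
  qed
  have cB: "continuous_on S B" for S
  proof -
    have "smooth (\<lambda>p. (f p)\<^sup>2 + (cpd (0, 1) f p)\<^sup>2)"
      using f by (intro smooth_add smooth_square smooth_cpd)
    from continuous_integral_snd[OF this] show ?thesis
      unfolding B_def by (intro continuous_on_mult continuous_on_const)
  qed
  have le: "(f (x, y))^4 \<le> B x * A y" if "x \<in> {fst a..fst b}" "y \<in> {snd a..snd b}" for x y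
  proof -
    have "(f (x, y))\<^sup>2 \<le> B x" "(f (x, y))\<^sup>2 \<le> A y"
      using smooth_square_le_snd[OF f that(2), of x] smooth_square_le_fst[OF f that(1), of y] by (simp_all add: A_def B_def)
    then have "(f (x, y))\<^sup>2 * (f (x, y))\<^sup>2 \<le> B x * A y"
      by (meson mult_mono order_trans zero_le_power2)
    then show ?thesis by (simp add: power2_eq_square power4_eq_xxxx mult.assoc)
  qed
  have s4: "smooth (\<lambda>p. (f p)^4)"
    using f by (simp add: power4_eq_xxxx smooth_mult)
  have "rint (\<lambda>p. (f p)^4) = integral {fst a..fst b} (\<lambda>x. integral {snd a..snd b} (\<lambda>y. (f (x, y))^4))"
    by (rule rint_iterated[OF smooth_continuous[OF s4]])
  also have "\<dots> \<le> integral {fst a..fst b} (\<lambda>x. B x * integral {snd a..snd b} A)"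
  proof (intro integral_le integrable_continuous_real continuous_on_mult continuous_on_const cB continuous_integral_snd[OF s4])
    fix x assume x: "x \<in> {fst a..fst b}"
    have "integral {snd a..snd b} (\<lambda>y. (f (x, y))^4) \<le> integral {snd a..snd b} (\<lambda>y. B x * A y)"
      using le[OF x] by (intro integral_le integrable_continuous_real continuous_on_mult continuous_on_const cA smooth_continuous_snd[OF s4]) auto
    then show "integral {snd a..snd b} (\<lambda>y. (f (x, y))^4) \<le> B x * integral {snd a..snd b} A" by simp
  qed
  also have "\<dots> = integral {fst a..fst b} B * integral {snd a..snd b} A" by simp
  also have "integral {fst a..fst b} B = K\<^sub>2 * ((nrm \<Omega> f)\<^sup>2 + (nrm \<Omega> (cpd (0, 1) f))\<^sup>2)"
    unfolding B_def by (simp add: integral_iterated_squares(1)[OF f])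
  also have "integral {snd a..snd b} A = K\<^sub>1 * ((nrm \<Omega> f)\<^sup>2 + (nrm \<Omega> (cpd (1, 0) f))\<^sup>2)"
    unfolding A_def by (simp add: integral_iterated_squares(2)[OF f])
  finally show ?thesis by (simp add: mult_ac)
qed

text \<open>Fatou's lemma along a subsequence converging almost everywhere;
  \<open>Ladyzhenskaya\<close> bounds the integrals of the fourth powers uniformly in
  \<open>n\<close>.\<close>

lemma integrable_power4_limit:
  fixes u :: "plane \<Rightarrow> real" and g :: "nat \<Rightarrow> plane \<Rightarrow> real"
  assumes g: "\<And>n. smooth (g n)" and u: "u \<in> L2 \<Omega>"
    and lim: "(\<lambda>n. nrm \<Omega> (\<lambda>p. g n p - u p)) \<longlonglongrightarrow> 0"
    and bd: "\<And>n. nrm \<Omega> (g n) \<le> M" "\<And>n. nrm \<Omega> (cpd (1, 0) (g n)) \<le> M" "\<And>n. nrm \<Omega> (cpd (0, 1) (g n)) \<le> M"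
  shows "integrable (lebesgue_on \<Omega>) (\<lambda>p. (u p)^4)"
proof -
  let ?m = "lebesgue_on \<Omega>"
  have gL: "g n \<in> L2 \<Omega>" for n using g smooth_L2 by blast
  \<comment> \<open>Convergence in the norm is L1 convergence of the squared differences, and that
    yields a subsequence converging almost everywhere.\<close>
  have "\<exists>r::nat\<Rightarrow>nat. strict_mono r \<and> (AE p in ?m. (\<lambda>n. (g (r n) p - u p)\<^sup>2) \<longlonglongrightarrow> 0)"
  proof (rule tendsto_L1_AE_subseq)
    show "integrable ?m (\<lambda>p. (g n p - u p)\<^sup>2)" for n
      using L2_diff[OF gL u] by (simp add: L2_real_iff)
    have "(\<lambda>n. (nrm \<Omega> (\<lambda>p. g n p - u p))\<^sup>2) \<longlonglongrightarrow> 0\<^sup>2"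
      by (intro tendsto_power lim)
    then show "(\<lambda>n. LINT p|?m. norm ((g n p - u p)\<^sup>2)) \<longlonglongrightarrow> 0"
      unfolding nrm_sq ip_real by (simp add: power2_eq_square)
  qed
  then obtain r where r: "AE p in ?m. (\<lambda>n. (g (r n) p - u p)\<^sup>2) \<longlonglongrightarrow> 0" by blast
  have AE: "AE p in ?m. (\<lambda>n. ennreal ((g (r n) p)^4)) \<longlonglongrightarrow> ennreal ((u p)^4)"
    using r
  proof eventually_elim
    case (elim p)
    then have "(\<lambda>n. g (r n) p - u p) \<longlonglongrightarrow> 0"
      using tendsto_real_sqrt[OF elim] by (simp add: tendsto_rabs_zero_iff)
    then have "(\<lambda>n. g (r n) p) \<longlonglongrightarrow> u p" by (rule LIM_zero_cancel)
    then show ?case by (intro tendsto_ennrealI tendsto_power)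
  qed
  define B where "B = K\<^sub>1 * K\<^sub>2 * ((M\<^sup>2 + M\<^sup>2) * (M\<^sup>2 + M\<^sup>2))"
  have "(\<integral>\<^sup>+p. ennreal ((u p)^4) \<partial>?m) = (\<integral>\<^sup>+p. liminf (\<lambda>n. ennreal ((g (r n) p)^4)) \<partial>?m)"
  proof (rule nn_integral_cong_AE)
    show "AE p in ?m. ennreal ((u p)^4) = liminf (\<lambda>n. ennreal ((g (r n) p)^4))"
      using AE by (rule eventually_mono) (metis lim_imp_Liminf trivial_limit_sequentially)
  qed
  also have "\<dots> \<le> liminf (\<lambda>n. \<integral>\<^sup>+p. ennreal ((g (r n) p)^4) \<partial>?m)"
  proof (rule nn_integral_liminf)
    fix n
    have [measurable]: "g (r n) \<in> borel_measurable ?m" using gL[of "r n"] by (simp add: L2_real_iff)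
    show "(\<lambda>p. ennreal ((g (r n) p)^4)) \<in> borel_measurable ?m" by measurable
  qed
  also have "\<dots> \<le> ennreal B"
  proof (intro Liminf_le always_eventually allI)
    fix n
    have "rint (\<lambda>p. (g (r n) p)^4) \<le> B"
      unfolding B_def using bd K_pos
      by (intro order_trans[OF Ladyzhenskaya[OF g]] mult_left_mono mult_mono add_mono power_mono) auto
    moreover have "integrable ?m (\<lambda>p. (g (r n) p)^4)"
      using g by (intro integrable_smooth) (simp add: power4_eq_xxxx smooth_mult)
    ultimately show "(\<integral>\<^sup>+p. ennreal ((g (r n) p)^4) \<partial>?m) \<le> ennreal B"
      by (subst nn_integral_eq_integral) (auto simp: rint_def intro!: ennreal_leI)
  qed simp
  finally have "(\<integral>\<^sup>+p. ennreal ((u p)^4) \<partial>?m) < \<infinity>"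
    by (simp add: le_less_trans)
  then show ?thesis
    using u by (intro integrableI_nonneg) (auto simp: L2_real_iff)
qed

end

section \<open>Elementary inequalities for sums of squares and for integrals along a side\<close>

lemma sum4_le:
  fixes x1 :: real
  assumes "x1 \<le> 2 * y1 + 2 * z1" "x2 \<le> 2 * y2 + 2 * z2" "x3 \<le> 2 * y3 + 2 * z3" "x4 \<le> 2 * y4 + 2 * z4"
  shows "x1 + x2 + x3 + x4 \<le> 2 * (y1 + y2 + y3 + y4) + 2 * (z1 + z2 + z3 + z4)"
  using add_mono[OF add_mono[OF add_mono[OF assms(1,2)] assms(3)] assms(4)] by (simp add: algebra_simps)

lemma LINT_continuous:
  fixes f :: "real \<Rightarrow> real"
  assumes "continuous_on {c..d} f"
  shows "(LINT s|lebesgue_on {c..d}. f s) = integral {c..d} f"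
  using assms by (intro lebesgue_integral_eq_integral continuous_imp_integrable_real) auto

text \<open>The endpoints form a null set. On the sides of the rectangle this removes the corners,
  where \<open>outer_normal\<close> may select the normal of the adjacent side.\<close>

lemma AE_interval_interior:
  assumes "\<And>s. c < s \<Longrightarrow> s < d \<Longrightarrow> P s"
  shows "AE s in lebesgue_on {c..d::real}. P s"
proof -
  have "AE s in lebesgue. s \<noteq> c" "AE s in lebesgue. s \<noteq> d"
    using AE_completion[OF AE_lborel_singleton] by auto
  then have "AE s in lebesgue. s \<in> {c..d} \<longrightarrow> P s"
    by eventually_elim (use assms in auto)
  then show ?thesis by (simp add: AE_restrict_space_iff)
qed

lemma integral_square_add_le:
  fixes f g :: "real \<Rightarrow> real"
  assumes "continuous_on {c..d} f" "continuous_on {c..d} g"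
  shows "integral {c..d} (\<lambda>s. (f s + g s)\<^sup>2) \<le> 2 * integral {c..d} (\<lambda>s. (f s)\<^sup>2) + 2 * integral {c..d} (\<lambda>s. (g s)\<^sup>2)"
proof -
  have i: "(\<lambda>s. (f s)\<^sup>2) integrable_on {c..d}" "(\<lambda>s. (g s)\<^sup>2) integrable_on {c..d}" "(\<lambda>s. (f s + g s)\<^sup>2) integrable_on {c..d}"
    by (intro integrable_continuous_real continuous_on_power continuous_on_add assms)+
  have h: "((\<lambda>s. 2 * (f s)\<^sup>2 + 2 * (g s)\<^sup>2) has_integral 2 * integral {c..d} (\<lambda>s. (f s)\<^sup>2) + 2 * integral {c..d} (\<lambda>s. (g s)\<^sup>2)) {c..d}"
    by (intro has_integral_add has_integral_mult_right integrable_integral i)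
  have "(x + y)\<^sup>2 \<le> 2 * x\<^sup>2 + 2 * y\<^sup>2" for x y :: real
    using sum_squares_bound[of x y] by (simp add: power2_sum)
  then show ?thesis
    by (intro has_integral_le[OF integrable_integral[OF i(3)] h])
qed

text \<open>Minkowski's inequality in dimension seven: \<open>H2_norm\<close> consists of the
  function, its two first derivatives and four second derivatives.\<close>

lemma sqrt_sum7_triangle:
  fixes x0 :: real
  assumes "0 \<le> z0" "0 \<le> z1" "0 \<le> z2" "0 \<le> z3" "0 \<le> z4" "0 \<le> z5" "0 \<le> z6"
    and "z0 \<le> x0 + y0" "z1 \<le> x1 + y1" "z2 \<le> x2 + y2" "z3 \<le> x3 + y3" "z4 \<le> x4 + y4" "z5 \<le> x5 + y5" "z6 \<le> x6 + y6"
  shows "sqrt (z0\<^sup>2 + z1\<^sup>2 + z2\<^sup>2 + z3\<^sup>2 + z4\<^sup>2 + z5\<^sup>2 + z6\<^sup>2) \<le>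
    sqrt (x0\<^sup>2 + x1\<^sup>2 + x2\<^sup>2 + x3\<^sup>2 + x4\<^sup>2 + x5\<^sup>2 + x6\<^sup>2) + sqrt (y0\<^sup>2 + y1\<^sup>2 + y2\<^sup>2 + y3\<^sup>2 + y4\<^sup>2 + y5\<^sup>2 + y6\<^sup>2)"
proof -
  have sum7: "(\<Sum>i\<in>{0..<7::nat}. F i) = F 0 + F 1 + F 2 + F 3 + F 4 + F 5 + F 6" for F :: "nat \<Rightarrow> real"
    by (simp add: eval_nat_numeral)
  have "sqrt (z0\<^sup>2 + z1\<^sup>2 + z2\<^sup>2 + z3\<^sup>2 + z4\<^sup>2 + z5\<^sup>2 + z6\<^sup>2) \<le>
    sqrt ((x0 + y0)\<^sup>2 + (x1 + y1)\<^sup>2 + (x2 + y2)\<^sup>2 + (x3 + y3)\<^sup>2 + (x4 + y4)\<^sup>2 + (x5 + y5)\<^sup>2 + (x6 + y6)\<^sup>2)"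
    using assms by (intro real_sqrt_le_mono add_mono power_mono)
  also have "\<dots> \<le> sqrt (x0\<^sup>2 + x1\<^sup>2 + x2\<^sup>2 + x3\<^sup>2 + x4\<^sup>2 + x5\<^sup>2 + x6\<^sup>2) + sqrt (y0\<^sup>2 + y1\<^sup>2 + y2\<^sup>2 + y3\<^sup>2 + y4\<^sup>2 + y5\<^sup>2 + y6\<^sup>2)"
    using L2_set_triangle_ineq[of "\<lambda>i. [x0, x1, x2, x3, x4, x5, x6] ! i" "\<lambda>i. [y0, y1, y2, y3, y4, y5, y6] ! i" "{0..<7::nat}"]
    unfolding L2_set_def sum7 by simp
  finally show ?thesis .
qed

context rectangle begin

section \<open>Traces of functions in \<open>H\<^sup>1\<^sub>0\<close> and \<open>H\<^sup>2\<^sub>0\<close>\<close>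

lemma ip_grad:
  assumes "f \<in> H1 \<Omega>" "g \<in> H1 \<Omega>"
  shows "ip \<Omega> (grad \<Omega> f) (grad \<Omega> g) = ip \<Omega> (dx \<Omega> f) (dx \<Omega> g) + ip \<Omega> (dy \<Omega> f) (dy \<Omega> g)"
  unfolding ip_def grad_def inner_Pair
  using L2_integrable_inner[OF H1_L2(2)[OF assms(1)] H1_L2(2)[OF assms(2)]]
    L2_integrable_inner[OF H1_L2(3)[OF assms(1)] H1_L2(3)[OF assms(2)]]
  by (rule Bochner_Integration.integral_add)

lemma nrm_grad: "f \<in> H1 \<Omega> \<Longrightarrow> (nrm \<Omega> (grad \<Omega> f))\<^sup>2 = (nrm \<Omega> (dx \<Omega> f))\<^sup>2 + (nrm \<Omega> (dy \<Omega> f))\<^sup>2"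
  by (simp add: nrm_sq ip_grad)

lemma nrm_le_H1_norm:
  assumes "f \<in> H1 \<Omega>"
  shows "nrm \<Omega> f \<le> H1_norm \<Omega> f" "nrm \<Omega> (dx \<Omega> f) \<le> H1_norm \<Omega> f" "nrm \<Omega> (dy \<Omega> f) \<le> H1_norm \<Omega> f"
  unfolding H1_norm_def nrm_grad[OF assms] by (auto intro!: real_le_rsqrt)

lemma nrm_le_H2_norm:
  assumes "f \<in> H2 \<Omega>"
  shows "H1_norm \<Omega> f \<le> H2_norm \<Omega> f"
    "nrm \<Omega> (dx \<Omega> (dx \<Omega> f)) \<le> H2_norm \<Omega> f" "nrm \<Omega> (dy \<Omega> (dx \<Omega> f)) \<le> H2_norm \<Omega> f"
    "nrm \<Omega> (dx \<Omega> (dy \<Omega> f)) \<le> H2_norm \<Omega> f" "nrm \<Omega> (dy \<Omega> (dy \<Omega> f)) \<le> H2_norm \<Omega> f"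
  unfolding H2_norm_def H1_norm_def semi2_def by (auto intro!: real_le_rsqrt)

lemma nrm_tendsto_0_bound:
  assumes "F \<longlonglongrightarrow> 0" "\<And>n. nrm \<Omega> (f n) \<le> F n"
  shows "(\<lambda>n. nrm \<Omega> (f n)) \<longlonglongrightarrow> 0"
  using assms by (intro tendsto_sandwich[OF _ _ tendsto_const assms(1)]) auto

lemma nrm_cong_AE': "AE p in lebesgue_on \<Omega>. f p = g p \<Longrightarrow> g \<in> L2 \<Omega> \<Longrightarrow> nrm \<Omega> f = nrm \<Omega> g"
  for f g :: "plane \<Rightarrow> real"
  using nrm_cong_AE[where S=\<Omega> and f=f and g=g] L2_cong_AE[where S=\<Omega> and f=f and g=g] by simp

lemma H1_diff: "f \<in> H1 \<Omega> \<Longrightarrow> g \<in> H1 \<Omega> \<Longrightarrow> (\<lambda>p. f p - g p) \<in> H1 \<Omega>"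
  using H1_add[OF _ H1_scale[of g "-1"]] by simp

lemma H2_diff: "f \<in> H2 \<Omega> \<Longrightarrow> g \<in> H2 \<Omega> \<Longrightarrow> (\<lambda>p. f p - g p) \<in> H2 \<Omega>"
  using H2_add[OF _ H2_scale[of g "-1"]] by simp

lemma wpd_diff:
  assumes "has_wpd e f" "has_wpd e g"
  shows "AE p in lebesgue_on \<Omega>. wpd \<Omega> e (\<lambda>p. f p - g p) p = wpd \<Omega> e f p - wpd \<Omega> e g p"
  using wpd_add[OF assms(1) has_wpd_scale[OF assms(2), of "-1"]] wpd_scale[OF assms(2), of "-1"]
  by eventually_elim simp

lemma nrm_wpd_smooth_diff:
  assumes "smooth w" "has_wpd e v"
  shows "nrm \<Omega> (wpd \<Omega> e (\<lambda>p. w p - v p)) = nrm \<Omega> (\<lambda>p. cpd e w p - wpd \<Omega> e v p)"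
proof (rule nrm_cong_AE')
  have e: "e \<in> {(1, 0), (0, 1)}" using assms(2) by (simp add: has_wpd_def)
  show "AE p in lebesgue_on \<Omega>. wpd \<Omega> e (\<lambda>p. w p - v p) p = cpd e w p - wpd \<Omega> e v p"
    using wpd_diff[OF has_wpd_smooth[OF assms(1) e] assms(2)] wpd_smooth[OF assms(1) e]
    by eventually_elim simp
  show "(\<lambda>p. cpd e w p - wpd \<Omega> e v p) \<in> L2 \<Omega>"
    using e smooth_L2 smooth_cpd[OF assms(1)] has_wpd_L2(1)[OF assms(2)] by (auto intro: L2_diff)
qed

lemma nrm_wpd_wpd_smooth_diff:
  assumes "smooth w" "has_wpd e v" "has_wpd e' (wpd \<Omega> e v)"
  shows "nrm \<Omega> (wpd \<Omega> e' (wpd \<Omega> e (\<lambda>p. w p - v p))) = nrm \<Omega> (\<lambda>p. cpd e' (cpd e w) p - wpd \<Omega> e' (wpd \<Omega> e v) p)"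
proof -
  have e: "e \<in> {(1, 0), (0, 1)}" using assms(2) by (simp add: has_wpd_def)
  have "AE p in lebesgue_on \<Omega>. wpd \<Omega> e (\<lambda>p. w p - v p) p = cpd e w p - wpd \<Omega> e v p"
    using wpd_diff[OF has_wpd_smooth[OF assms(1) e] assms(2)] wpd_smooth[OF assms(1) e]
    by eventually_elim simp
  from wpd_cong[OF this] show ?thesis
    using nrm_wpd_smooth_diff[of "cpd e w", OF _ assms(3)] e smooth_cpd[OF assms(1)] by auto
qed

lemma zero_traceE:
  assumes "v \<in> H10 a b"
  obtains w where "\<And>n. smooth (w n)" "(\<lambda>n. nrm \<Omega> (\<lambda>p. w n p - v p)) \<longlonglongrightarrow> 0"
    "(\<lambda>n. nrm \<Omega> (\<lambda>p. cpd (1, 0) (w n) p - dx \<Omega> v p)) \<longlonglongrightarrow> 0"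
    "(\<lambda>n. boundary_integral a b (\<lambda>p. (w n p)\<^sup>2)) \<longlonglongrightarrow> 0"
proof -
  have v: "v \<in> H1 \<Omega>" using assms by (simp add: H10_def)
  obtain w where w: "\<And>n. smooth (w n)" and lim: "(\<lambda>n. H1_norm \<Omega> (\<lambda>p. w n p - v p)) \<longlonglongrightarrow> 0"
    and bd: "(\<lambda>n. boundary_integral a b (\<lambda>p. (w n p)\<^sup>2)) \<longlonglongrightarrow> 0"
    using assms unfolding H10_def zero_trace_def by blast
  have "(\<lambda>p. w n p - v p) \<in> H1 \<Omega>" for n using H1_diff[OF H1_smooth[OF w] v] .
  note le = nrm_le_H1_norm[OF this]
  have "(\<lambda>n. nrm \<Omega> (\<lambda>p. w n p - v p)) \<longlonglongrightarrow> 0"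
    by (rule nrm_tendsto_0_bound[OF lim le(1)])
  moreover have "(\<lambda>n. nrm \<Omega> (dx \<Omega> (\<lambda>p. w n p - v p))) \<longlonglongrightarrow> 0"
    by (rule nrm_tendsto_0_bound[OF lim le(2)])
  ultimately show ?thesis
    using that[OF w _ _ bd] v by (simp add: nrm_wpd_smooth_diff[OF w] H1_iff)
qed

text \<open>Separates convergence in \<open>H2_norm\<close> into convergence of every derivative of
  order at most two, with classical derivatives of the approximants. The integrations by parts for
  the Hessian start from this form.\<close>

lemma zero_trace_and_normal_derivE:
  assumes "v \<in> H20 a b"
  obtains w where "\<And>n. smooth (w n)" "(\<lambda>n. nrm \<Omega> (\<lambda>p. w n p - v p)) \<longlonglongrightarrow> 0"
    "\<And>e. e \<in> {(1, 0), (0, 1)} \<Longrightarrow> (\<lambda>n. nrm \<Omega> (\<lambda>p. cpd e (w n) p - wpd \<Omega> e v p)) \<longlonglongrightarrow> 0"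
    "\<And>e e'. e \<in> {(1, 0), (0, 1)} \<Longrightarrow> e' \<in> {(1, 0), (0, 1)} \<Longrightarrow>
      (\<lambda>n. nrm \<Omega> (\<lambda>p. cpd e' (cpd e (w n)) p - wpd \<Omega> e' (wpd \<Omega> e v) p)) \<longlonglongrightarrow> 0"
    "(\<lambda>n. boundary_integral a b (\<lambda>p. (w n p)\<^sup>2)) \<longlonglongrightarrow> 0"
    "(\<lambda>n. boundary_integral a b (\<lambda>p. (normal_deriv a b (w n) p)\<^sup>2)) \<longlonglongrightarrow> 0"
proof -
  have v: "v \<in> H2 \<Omega>" using assms by (simp add: H20_def)
  note D = H2_D[OF v]
  obtain w where w: "\<And>n. smooth (w n)" and lim: "(\<lambda>n. H2_norm \<Omega> (\<lambda>p. w n p - v p)) \<longlonglongrightarrow> 0"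
    and bd: "(\<lambda>n. boundary_integral a b (\<lambda>p. (w n p)\<^sup>2)) \<longlonglongrightarrow> 0"
      "(\<lambda>n. boundary_integral a b (\<lambda>p. (normal_deriv a b (w n) p)\<^sup>2)) \<longlonglongrightarrow> 0"
    using assms unfolding H20_def zero_trace_and_normal_deriv_def by blast
  have d: "(\<lambda>p. w n p - v p) \<in> H2 \<Omega>" for n using H2_diff[OF H2_smooth[OF w] v] .
  then have d1: "(\<lambda>p. w n p - v p) \<in> H1 \<Omega>" for n by (simp add: H2_def)
  note le1 = nrm_le_H1_norm[OF d1, THEN order_trans, OF nrm_le_H2_norm(1)[OF d]]
  note le2 = nrm_le_H2_norm(2-5)[OF d]
  note l = nrm_tendsto_0_bound[OF lim le1(1)]
    nrm_tendsto_0_bound[OF lim le1(2), unfolded nrm_wpd_smooth_diff[OF w D(1)]]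
    nrm_tendsto_0_bound[OF lim le1(3), unfolded nrm_wpd_smooth_diff[OF w D(2)]]
    nrm_tendsto_0_bound[OF lim le2(1), unfolded nrm_wpd_wpd_smooth_diff[OF w D(1) D(3)]]
    nrm_tendsto_0_bound[OF lim le2(2), unfolded nrm_wpd_wpd_smooth_diff[OF w D(1) D(4)]]
    nrm_tendsto_0_bound[OF lim le2(3), unfolded nrm_wpd_wpd_smooth_diff[OF w D(2) D(5)]]
    nrm_tendsto_0_bound[OF lim le2(4), unfolded nrm_wpd_wpd_smooth_diff[OF w D(2) D(6)]]
  show ?thesis
    by (rule that[OF w l(1) _ _ bd]) (use l in auto)
qed

lemma H20_subset_H10: "v \<in> H20 a b \<Longrightarrow> v \<in> H10 a b"
proof -
  assume v: "v \<in> H20 a b"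
  then have v1: "v \<in> H2 \<Omega>" "v \<in> H1 \<Omega>" by (auto simp: H20_def H2_def)
  obtain w where w: "\<And>n. smooth (w n)" and lim: "(\<lambda>n. H2_norm \<Omega> (\<lambda>p. w n p - v p)) \<longlonglongrightarrow> 0"
    and bd: "(\<lambda>n. boundary_integral a b (\<lambda>p. (w n p)\<^sup>2)) \<longlonglongrightarrow> 0"
    using v unfolding H20_def zero_trace_and_normal_deriv_def by blast
  have "(\<lambda>n. H1_norm \<Omega> (\<lambda>p. w n p - v p)) \<longlonglongrightarrow> 0"
  proof (rule tendsto_sandwich[OF _ _ tendsto_const lim])
    show "\<forall>\<^sub>F n in sequentially. 0 \<le> H1_norm \<Omega> (\<lambda>p. w n p - v p)" by (simp add: H1_norm_def)
    show "\<forall>\<^sub>F n in sequentially. H1_norm \<Omega> (\<lambda>p. w n p - v p) \<le> H2_norm \<Omega> (\<lambda>p. w n p - v p)"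
      by (intro always_eventually allI nrm_le_H2_norm(1) H2_diff H2_smooth w v1)
  qed
  then show ?thesis
    using w bd v1 unfolding H10_def zero_trace_def by blast
qed

lemma boundary_integral_nonneg:
  assumes "\<And>p. 0 \<le> f p"
  shows "0 \<le> boundary_integral a b f"
  unfolding boundary_integral_def by (intro add_nonneg_nonneg Bochner_Integration.integral_nonneg assms)

lemma boundary_integral_smooth:
  assumes "smooth f"
  shows "boundary_integral a b f =
    integral {fst a..fst b} (\<lambda>s. f (s, snd a)) + integral {fst a..fst b} (\<lambda>s. f (s, snd b)) +
    integral {snd a..snd b} (\<lambda>s. f (fst a, s)) + integral {snd a..snd b} (\<lambda>s. f (fst b, s))"
  unfolding boundary_integral_def
  by (simp add: LINT_continuous smooth_continuous_fst[OF assms] smooth_continuous_snd[OF assms])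

lemma cpd_minus:
  assumes "smooth w"
  shows "cpd (-1, 0) w p = - cpd (1, 0) w p" "cpd (0, -1) w p = - cpd (0, 1) w p"
  using cpd_eq[OF smooth_has_derivative[OF assms], where e="(-1, 0)"] cpd_eq[OF smooth_has_derivative[OF assms], where e="(0, -1)"]
  by simp_all

text \<open>Squaring removes the sign of the outer normal, so each side contributes the squared
  coordinate derivative across it.\<close>

lemma boundary_integral_normal_deriv:
  assumes w: "smooth w"
  shows "boundary_integral a b (\<lambda>p. (normal_deriv a b w p)\<^sup>2) =
    integral {fst a..fst b} (\<lambda>s. (cpd (0, 1) w (s, snd a))\<^sup>2) + integral {fst a..fst b} (\<lambda>s. (cpd (0, 1) w (s, snd b))\<^sup>2) +
    integral {snd a..snd b} (\<lambda>s. (cpd (1, 0) w (fst a, s))\<^sup>2) + integral {snd a..snd b} (\<lambda>s. (cpd (1, 0) w (fst b, s))\<^sup>2)"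
proof -
  note c = continuous_on_power[OF smooth_continuous_fst[OF smooth_cpd(2)[OF w]]]
    continuous_on_power[OF smooth_continuous_snd[OF smooth_cpd(1)[OF w]]]
  have *: "(LINT s|lebesgue_on {c..d}. f s) = integral {c..d} g"
    if "continuous_on {c..d} g" "\<And>s. c < s \<Longrightarrow> s < d \<Longrightarrow> f s = g s" for f g :: "real \<Rightarrow> real" and c d
  proof -
    have AE: "AE s in lebesgue_on {c..d}. g s = f s"
      using that(2) by (intro AE_interval_interior) simp
    have gm: "g \<in> borel_measurable (lebesgue_on {c..d})"
      using that(1) by (intro continuous_imp_measurable_on_sets_lebesgue) auto
    have "f \<in> borel_measurable (lebesgue_on {c..d})"
      by (rule borel_measurable_lebesgue_on_AE[OF gm AE]) simp
    then have "(LINT s|lebesgue_on {c..d}. f s) = (LINT s|lebesgue_on {c..d}. g s)"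
      using AE gm by (intro integral_cong_AE) auto
    then show ?thesis using LINT_continuous[OF that(1)] by simp
  qed
  show ?thesis
    unfolding boundary_integral_def
    by (intro arg_cong2[where f="(+)"] * c) (use ab in \<open>auto simp: normal_deriv_def outer_normal_def cpd_minus[OF w]\<close>)
qed

lemma boundary_integral_square_add_le:
  assumes "smooth f" "smooth g"
  shows "boundary_integral a b (\<lambda>p. (f p + g p)\<^sup>2) \<le> 2 * boundary_integral a b (\<lambda>p. (f p)\<^sup>2) + 2 * boundary_integral a b (\<lambda>p. (g p)\<^sup>2)"
  unfolding boundary_integral_smooth[OF smooth_square[OF smooth_add[OF assms]]]
    boundary_integral_smooth[OF smooth_square[OF assms(1)]] boundary_integral_smooth[OF smooth_square[OF assms(2)]]
  by (intro sum4_le integral_square_add_le smooth_continuous_fst smooth_continuous_snd assms)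

lemma boundary_integral_normal_deriv_add_le:
  assumes "smooth f" "smooth g"
  shows "boundary_integral a b (\<lambda>p. (normal_deriv a b (\<lambda>p. f p + g p) p)\<^sup>2)
    \<le> 2 * boundary_integral a b (\<lambda>p. (normal_deriv a b f p)\<^sup>2) + 2 * boundary_integral a b (\<lambda>p. (normal_deriv a b g p)\<^sup>2)"
proof -
  note c = smooth_continuous_fst[OF smooth_cpd(2)[OF assms(1)]] smooth_continuous_fst[OF smooth_cpd(2)[OF assms(2)]]
    smooth_continuous_snd[OF smooth_cpd(1)[OF assms(1)]] smooth_continuous_snd[OF smooth_cpd(1)[OF assms(2)]]
  show ?thesis
    unfolding boundary_integral_normal_deriv[OF smooth_add[OF assms]] boundary_integral_normal_deriv[OF assms(1)]
      boundary_integral_normal_deriv[OF assms(2)] cpd_add[OF assms]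
    by (intro sum4_le integral_square_add_le c)
qed

lemma boundary_integral_scale: "boundary_integral a b (\<lambda>p. c * f p) = c * boundary_integral a b f"
  by (simp add: boundary_integral_def algebra_simps)

lemma nrm_grad_scale: "f \<in> H1 \<Omega> \<Longrightarrow> nrm \<Omega> (grad \<Omega> (\<lambda>p. c * f p)) = \<bar>c\<bar> * nrm \<Omega> (grad \<Omega> f)"
proof -
  assume f: "f \<in> H1 \<Omega>"
  then have "nrm \<Omega> (wpd \<Omega> e (\<lambda>p. c * f p)) = \<bar>c\<bar> * nrm \<Omega> (wpd \<Omega> e f)" if "e \<in> {(1,0),(0,1)}" for e
    using that nrm_cong_AE'[OF wpd_scale[of e f c]] by (auto simp: H1_iff nrm_scale has_wpd_L2 L2_scale)
  then have "(nrm \<Omega> (grad \<Omega> (\<lambda>p. c * f p)))\<^sup>2 = (\<bar>c\<bar> * nrm \<Omega> (grad \<Omega> f))\<^sup>2"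
    by (simp add: nrm_grad[OF f] nrm_grad[OF H1_scale[OF f]] power_mult_distrib distrib_left)
  then show ?thesis by (rule power2_eq_imp_eq) auto
qed

lemma H2_norm_eq:
  assumes "f \<in> H2 \<Omega>"
  shows "H2_norm \<Omega> f = sqrt ((nrm \<Omega> f)\<^sup>2 + (nrm \<Omega> (dx \<Omega> f))\<^sup>2 + (nrm \<Omega> (dy \<Omega> f))\<^sup>2 + (nrm \<Omega> (dx \<Omega> (dx \<Omega> f)))\<^sup>2
    + (nrm \<Omega> (dy \<Omega> (dx \<Omega> f)))\<^sup>2 + (nrm \<Omega> (dx \<Omega> (dy \<Omega> f)))\<^sup>2 + (nrm \<Omega> (dy \<Omega> (dy \<Omega> f)))\<^sup>2)"
proof -
  have "f \<in> H1 \<Omega>" using assms by (simp add: H2_def)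
  then show ?thesis
    by (simp add: H2_norm_def semi2_def nrm_grad add.assoc)
qed

lemma H2_norm_add:
  assumes f: "f \<in> H2 \<Omega>" and g: "g \<in> H2 \<Omega>"
  shows "H2_norm \<Omega> (\<lambda>p. f p + g p) \<le> H2_norm \<Omega> f + H2_norm \<Omega> g"
proof -
  have *: "nrm \<Omega> h \<le> nrm \<Omega> u + nrm \<Omega> v" if "AE p in lebesgue_on \<Omega>. h p = u p + v p" "u \<in> L2 \<Omega>" "v \<in> L2 \<Omega>" for h u v :: "plane \<Rightarrow> real"
    using nrm_cong_AE'[OF that(1) L2_add[OF that(2,3)]] nrm_triangle[OF that(2,3)] by simp
  note D = H2_D[OF f] note E = H2_D[OF g]
  show ?thesis
    unfolding H2_norm_eq[OF f] H2_norm_eq[OF g] H2_norm_eq[OF H2_add[OF f g]]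
    by (intro sqrt_sum7_triangle nrm_nonneg nrm_triangle[OF has_wpd_L2(2)[OF D(1)] has_wpd_L2(2)[OF E(1)]]
        *[OF wpd_add[OF D(1) E(1)] has_wpd_L2(1)[OF D(1)] has_wpd_L2(1)[OF E(1)]]
        *[OF wpd_add[OF D(2) E(2)] has_wpd_L2(1)[OF D(2)] has_wpd_L2(1)[OF E(2)]]
        *[OF wpd_wpd_add[OF D(1) E(1) D(3) E(3)] has_wpd_L2(1)[OF D(3)] has_wpd_L2(1)[OF E(3)]]
        *[OF wpd_wpd_add[OF D(1) E(1) D(4) E(4)] has_wpd_L2(1)[OF D(4)] has_wpd_L2(1)[OF E(4)]]
        *[OF wpd_wpd_add[OF D(2) E(2) D(5) E(5)] has_wpd_L2(1)[OF D(5)] has_wpd_L2(1)[OF E(5)]]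
        *[OF wpd_wpd_add[OF D(2) E(2) D(6) E(6)] has_wpd_L2(1)[OF D(6)] has_wpd_L2(1)[OF E(6)]])
qed

lemma semi2_scale:
  assumes "f \<in> H2 \<Omega>"
  shows "semi2 \<Omega> (\<lambda>p. c * f p) = \<bar>c\<bar> * semi2 \<Omega> f"
proof -
  note D = H2_D[OF assms]
  have *: "(nrm \<Omega> h)\<^sup>2 = \<bar>c\<bar>\<^sup>2 * (nrm \<Omega> u)\<^sup>2" if "AE p in lebesgue_on \<Omega>. h p = c * u p" "u \<in> L2 \<Omega>" for h u :: "plane \<Rightarrow> real"
    using nrm_cong_AE'[OF that(1) L2_scale[OF that(2)]] by (simp add: nrm_scale power_mult_distrib)
  show ?thesis
    unfolding semi2_def *[OF wpd_wpd_scale[OF D(1) D(3)] has_wpd_L2(1)[OF D(3)]]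
      *[OF wpd_wpd_scale[OF D(1) D(4)] has_wpd_L2(1)[OF D(4)]]
      *[OF wpd_wpd_scale[OF D(2) D(5)] has_wpd_L2(1)[OF D(5)]]
      *[OF wpd_wpd_scale[OF D(2) D(6)] has_wpd_L2(1)[OF D(6)]]
    by (simp add: distrib_left[symmetric] real_sqrt_mult)
qed

lemma H2_norm_scale:
  assumes "f \<in> H2 \<Omega>"
  shows "H2_norm \<Omega> (\<lambda>p. c * f p) = \<bar>c\<bar> * H2_norm \<Omega> f"
proof -
  have "f \<in> H1 \<Omega>" using assms by (simp add: H2_def)
  then show ?thesis
    unfolding H2_norm_def semi2_scale[OF assms] nrm_grad_scale[OF \<open>f \<in> H1 \<Omega>\<close>] nrm_scale power_mult_distrib
      distrib_left[symmetric] by (simp add: real_sqrt_mult)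
qed

lemma H20_scale:
  assumes v: "v \<in> H20 a b"
  shows "(\<lambda>p. c * v p) \<in> H20 a b"
proof -
  have v2: "v \<in> H2 \<Omega>" using v by (simp add: H20_def)
  obtain w where w: "\<And>n. smooth (w n)" and lim: "(\<lambda>n. H2_norm \<Omega> (\<lambda>p. w n p - v p)) \<longlonglongrightarrow> 0"
    and bd: "(\<lambda>n. boundary_integral a b (\<lambda>p. (w n p)\<^sup>2)) \<longlonglongrightarrow> 0"
      "(\<lambda>n. boundary_integral a b (\<lambda>p. (normal_deriv a b (w n) p)\<^sup>2)) \<longlonglongrightarrow> 0"
    using v unfolding H20_def zero_trace_and_normal_deriv_def by blast
  have "H2_norm \<Omega> (\<lambda>p. c * w n p - c * v p) = \<bar>c\<bar> * H2_norm \<Omega> (\<lambda>p. w n p - v p)" for n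
    using H2_norm_scale[OF H2_diff[OF H2_smooth[OF w] v2], of c n] by (simp add: right_diff_distrib)
  then have "(\<lambda>n. H2_norm \<Omega> (\<lambda>p. c * w n p - c * v p)) \<longlonglongrightarrow> 0"
    using tendsto_mult_right_zero[OF lim] by simp
  moreover have "(\<lambda>n. boundary_integral a b (\<lambda>p. (c * w n p)\<^sup>2)) \<longlonglongrightarrow> 0"
    using tendsto_mult_right_zero[OF bd(1), of "c\<^sup>2"] by (simp add: power_mult_distrib boundary_integral_scale)
  moreover have "(\<lambda>n. boundary_integral a b (\<lambda>p. (normal_deriv a b (\<lambda>p. c * w n p) p)\<^sup>2)) \<longlonglongrightarrow> 0"
    using tendsto_mult_right_zero[OF bd(2), of "c\<^sup>2"]
    by (simp add: normal_deriv_def cpd_scale[OF w] power_mult_distrib boundary_integral_scale)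
  ultimately show ?thesis
    using w v2 smooth_scale unfolding H20_def zero_trace_and_normal_deriv_def
    by (auto intro!: H2_scale exI[of _ "\<lambda>n p. c * w n p"])
qed

text \<open>The sums of the approximants serve as approximants. The boundary integrals are
  quadratic, so they are compared with twice the sum of the two given ones.\<close>

lemma H20_add:
  assumes u: "u \<in> H20 a b" and v: "v \<in> H20 a b"
  shows "(\<lambda>p. u p + v p) \<in> H20 a b"
proof -
  have uv: "u \<in> H2 \<Omega>" "v \<in> H2 \<Omega>" using u v by (auto simp: H20_def)
  obtain w where w: "\<And>n. smooth (w n)" and lim: "(\<lambda>n. H2_norm \<Omega> (\<lambda>p. w n p - v p)) \<longlonglongrightarrow> 0"
    and bd: "(\<lambda>n. boundary_integral a b (\<lambda>p. (w n p)\<^sup>2)) \<longlonglongrightarrow> 0"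
      "(\<lambda>n. boundary_integral a b (\<lambda>p. (normal_deriv a b (w n) p)\<^sup>2)) \<longlonglongrightarrow> 0"
    using v unfolding H20_def zero_trace_and_normal_deriv_def by blast
  obtain z where z: "\<And>n. smooth (z n)" and limz: "(\<lambda>n. H2_norm \<Omega> (\<lambda>p. z n p - u p)) \<longlonglongrightarrow> 0"
    and bdz: "(\<lambda>n. boundary_integral a b (\<lambda>p. (z n p)\<^sup>2)) \<longlonglongrightarrow> 0"
      "(\<lambda>n. boundary_integral a b (\<lambda>p. (normal_deriv a b (z n) p)\<^sup>2)) \<longlonglongrightarrow> 0"
    using u unfolding H20_def zero_trace_and_normal_deriv_def by blast
  have "(\<lambda>n. H2_norm \<Omega> (\<lambda>p. z n p + w n p - (u p + v p))) \<longlonglongrightarrow> 0"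
  proof (rule tendsto_sandwich[OF _ _ tendsto_const tendsto_add_zero[OF limz lim]])
    show "\<forall>\<^sub>F n in sequentially. 0 \<le> H2_norm \<Omega> (\<lambda>p. z n p + w n p - (u p + v p))" by (simp add: H2_norm_def)
    have "H2_norm \<Omega> (\<lambda>p. z n p + w n p - (u p + v p)) \<le> H2_norm \<Omega> (\<lambda>p. z n p - u p) + H2_norm \<Omega> (\<lambda>p. w n p - v p)" for n
      using H2_norm_add[OF H2_diff[OF H2_smooth[OF z] uv(1)] H2_diff[OF H2_smooth[OF w] uv(2)], of n n] by (simp add: algebra_simps)
    then show "\<forall>\<^sub>F n in sequentially. H2_norm \<Omega> (\<lambda>p. z n p + w n p - (u p + v p)) \<le> H2_norm \<Omega> (\<lambda>p. z n p - u p) + H2_norm \<Omega> (\<lambda>p. w n p - v p)"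
      by simp
  qed
  moreover have "(\<lambda>n. boundary_integral a b (\<lambda>p. (z n p + w n p)\<^sup>2)) \<longlonglongrightarrow> 0"
    by (rule tendsto_sandwich[OF _ _ tendsto_const tendsto_add_zero[OF tendsto_mult_right_zero[OF bdz(1), of 2] tendsto_mult_right_zero[OF bd(1), of 2]]])
      (simp_all add: boundary_integral_square_add_le w z boundary_integral_nonneg)
  moreover have "(\<lambda>n. boundary_integral a b (\<lambda>p. (normal_deriv a b (\<lambda>p. z n p + w n p) p)\<^sup>2)) \<longlonglongrightarrow> 0"
    by (rule tendsto_sandwich[OF _ _ tendsto_const tendsto_add_zero[OF tendsto_mult_right_zero[OF bdz(2), of 2] tendsto_mult_right_zero[OF bd(2), of 2]]])
      (simp_all add: boundary_integral_normal_deriv_add_le w z boundary_integral_nonneg)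
  ultimately show ?thesis
    using w z uv smooth_add unfolding H20_def zero_trace_and_normal_deriv_def
    by (auto intro!: H2_add exI[of _ "\<lambda>n p. z n p + w n p"])
qed

lemma H20_diff: "u \<in> H20 a b \<Longrightarrow> v \<in> H20 a b \<Longrightarrow> (\<lambda>p. u p - v p) \<in> H20 a b"
  using H20_add[OF _ H20_scale[of v "-1"], of u] by simp

end

section \<open>Auxiliary limits for the boundary integrals\<close>

lemma integral_square_nonneg: "0 \<le> integral S (\<lambda>x. (f x)\<^sup>2)" for f :: "real \<Rightarrow> real"
  by (cases "(\<lambda>x. (f x)\<^sup>2) integrable_on S") (auto intro: integral_nonneg simp: not_integrable_integral)

lemma convergent_bounded_above: "X \<longlonglongrightarrow> (x::real) \<Longrightarrow> \<exists>M. \<forall>n. X n \<le> M"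
  using convergent_imp_Bseq[of X] by (auto simp: convergent_def Bseq_def dest: abs_le_D1)

lemma integral_mult_tendsto_0:
  fixes f :: "nat \<Rightarrow> real \<Rightarrow> real"
  assumes "\<And>n. continuous_on {c..d} (f n)" "continuous_on {c..d} g"
    and lim: "(\<lambda>n. integral {c..d} (\<lambda>x. (f n x)\<^sup>2)) \<longlonglongrightarrow> 0"
  shows "(\<lambda>n. integral {c..d} (\<lambda>x. f n x * g x)) \<longlonglongrightarrow> 0"
proof (rule Lim_null_comparison)
  show "\<forall>\<^sub>F n in sequentially. norm (integral {c..d} (\<lambda>x. f n x * g x))
    \<le> sqrt (integral {c..d} (\<lambda>x. (f n x)\<^sup>2)) * sqrt (integral {c..d} (\<lambda>x. (g x)\<^sup>2))"
    using integral_Cauchy_Schwarz[OF assms(1,2)] by simp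
  show "(\<lambda>n. sqrt (integral {c..d} (\<lambda>x. (f n x)\<^sup>2)) * sqrt (integral {c..d} (\<lambda>x. (g x)\<^sup>2))) \<longlonglongrightarrow> 0"
    using tendsto_mult_left_zero[OF tendsto_real_sqrt[OF lim, unfolded real_sqrt_zero]] .
qed

context rectangle begin

section \<open>Inequalities in \<open>H\<^sup>1\<^sub>0\<close> and \<open>H\<^sup>2\<^sub>0\<close>\<close>

lemma nrm_bounded_mult:
  fixes f g :: "plane \<Rightarrow> real"
  assumes f: "f \<in> L2 \<Omega>" and g: "g \<in> borel_measurable (lebesgue_on \<Omega>)" and B: "\<And>p. p \<in> \<Omega> \<Longrightarrow> \<bar>g p\<bar> \<le> B" "0 \<le> B"
  shows "nrm \<Omega> (\<lambda>p. g p * f p) \<le> B * nrm \<Omega> f"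
proof (rule power2_le_imp_le)
  have L: "(\<lambda>p. g p * f p) \<in> L2 \<Omega>"
    by (rule L2_bounded_mult[OF f g B(1)]) auto
  have "(nrm \<Omega> (\<lambda>p. g p * f p))\<^sup>2 = (LINT p|lebesgue_on \<Omega>. (g p * f p)\<^sup>2)"
    unfolding nrm_sq ip_real by (simp add: power2_eq_square)
  also have "\<dots> \<le> (LINT p|lebesgue_on \<Omega>. B\<^sup>2 * (f p)\<^sup>2)"
  proof (rule integral_mono)
    show "integrable (lebesgue_on \<Omega>) (\<lambda>p. (g p * f p)\<^sup>2)" "integrable (lebesgue_on \<Omega>) (\<lambda>p. B\<^sup>2 * (f p)\<^sup>2)"
      using L f by (auto simp: L2_real_iff)
    show "(g p * f p)\<^sup>2 \<le> B\<^sup>2 * (f p)\<^sup>2" if "p \<in> space (lebesgue_on \<Omega>)" for p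
      using power_mono[OF B(1)[of p] abs_ge_zero, of 2] that by (simp add: power_mult_distrib mult_right_mono)
  qed
  also have "\<dots> = B\<^sup>2 * (nrm \<Omega> f)\<^sup>2"
    unfolding nrm_sq ip_real by (simp add: power2_eq_square)
  finally show "(nrm \<Omega> (\<lambda>p. g p * f p))\<^sup>2 \<le> (B * nrm \<Omega> f)\<^sup>2" by (simp add: power_mult_distrib)
qed (use B in simp)

text \<open>Integrate \<open>\<partial>\<^sub>x ((x - x\<^sub>1) w\<^sup>2)\<close>, where \<open>x\<^sub>1\<close> is the right end of the rectangle.\<close>

lemma Poincare_smooth:
  assumes w: "smooth w"
  shows "(nrm \<Omega> w)\<^sup>2 \<le> (fst b - fst a) * boundary_integral a b (\<lambda>p. (w p)\<^sup>2) + 2 * ((fst b - fst a) * (nrm \<Omega> w * nrm \<Omega> (cpd (1, 0) w)))"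
proof -
  let ?L = "fst b - fst a"
  let ?g = "\<lambda>p. fst p - fst b"
  have g: "smooth ?g" using smooth_diff[OF smooth_fst smooth_const] .
  have "(?g has_derivative (\<lambda>e. fst e)) (at p)" for p :: plane
    by (auto intro!: derivative_eq_intros)
  from cpd_eq[OF this] have "cpd (1, 0) ?g = (\<lambda>p. 1)" by (intro ext) simp
  then have "ip \<Omega> (cpd (1, 0) (\<lambda>p. w p * w p)) ?g
     = integral {snd a..snd b} (\<lambda>y. ?L * (w (fst a, y))\<^sup>2) - ip \<Omega> (\<lambda>p. w p * w p) (\<lambda>p. 1)"
    using ip_cpd_fst[OF smooth_mult[OF w w] g] by (simp add: power2_eq_square algebra_simps)
  moreover have "ip \<Omega> (\<lambda>p. w p * w p) (\<lambda>p. 1) = (nrm \<Omega> w)\<^sup>2"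
    unfolding nrm_sq ip_real by simp
  moreover have "ip \<Omega> (cpd (1, 0) (\<lambda>p. w p * w p)) ?g = 2 * ip \<Omega> w (\<lambda>p. ?g p * cpd (1, 0) w p)"
    unfolding cpd_mult[OF w w] ip_scale_right[symmetric] unfolding ip_real
    by (intro Bochner_Integration.integral_cong) (auto simp: algebra_simps)
  ultimately have eq: "(nrm \<Omega> w)\<^sup>2 = ?L * integral {snd a..snd b} (\<lambda>y. (w (fst a, y))\<^sup>2) - 2 * ip \<Omega> w (\<lambda>p. ?g p * cpd (1, 0) w p)"
    by simp
  have "integral {snd a..snd b} (\<lambda>y. (w (fst a, y))\<^sup>2) \<le> boundary_integral a b (\<lambda>p. (w p)\<^sup>2)"
    unfolding boundary_integral_smooth[OF smooth_square[OF w]]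
    using integral_square_nonneg[of "{fst a..fst b}" "\<lambda>s. w (s, snd a)"] integral_square_nonneg[of "{fst a..fst b}" "\<lambda>s. w (s, snd b)"]
      integral_square_nonneg[of "{snd a..snd b}" "\<lambda>s. w (fst b, s)"]
    by simp
  then have 1: "?L * integral {snd a..snd b} (\<lambda>y. (w (fst a, y))\<^sup>2) \<le> ?L * boundary_integral a b (\<lambda>p. (w p)\<^sup>2)"
    using ab by (intro mult_left_mono) auto
  have "\<bar>ip \<Omega> w (\<lambda>p. ?g p * cpd (1, 0) w p)\<bar> \<le> nrm \<Omega> w * nrm \<Omega> (\<lambda>p. ?g p * cpd (1, 0) w p)"
    by (intro ip_Cauchy_Schwarz smooth_L2 smooth_mult g w smooth_cpd(1))
  also have "\<dots> \<le> nrm \<Omega> w * (?L * nrm \<Omega> (cpd (1, 0) w))"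
  proof (intro mult_left_mono nrm_bounded_mult smooth_L2[OF smooth_cpd(1)[OF w]])
    show "?g \<in> borel_measurable (lebesgue_on \<Omega>)" using smooth_L2[OF g] by (simp add: L2_real_iff)
    show "\<bar>?g p\<bar> \<le> ?L" if "p \<in> \<Omega>" for p using that by (simp add: mem_box_plane)
  qed (use ab in auto)
  finally have "- ip \<Omega> w (\<lambda>p. ?g p * cpd (1, 0) w p) \<le> ?L * (nrm \<Omega> w * nrm \<Omega> (cpd (1, 0) w))"
    by (simp add: mult_ac)
  then show ?thesis using eq 1 by linarith
qed

text \<open>The boundary term in \<open>Poincare_smooth\<close> tends to zero along the
  approximants, and one factor \<open>nrm \<Omega> v\<close> cancels. The factor 2 comes from
  differentiating w^2.\<close>

lemma Poincare:
  assumes v: "v \<in> H10 a b"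
  shows "nrm \<Omega> v \<le> 2 * (fst b - fst a) * nrm \<Omega> (dx \<Omega> v)"
proof -
  let ?L = "fst b - fst a"
  have v1: "v \<in> H1 \<Omega>" using v by (simp add: H10_def)
  obtain w where w: "\<And>n. smooth (w n)" and lim: "(\<lambda>n. nrm \<Omega> (\<lambda>p. w n p - v p)) \<longlonglongrightarrow> 0"
    "(\<lambda>n. nrm \<Omega> (\<lambda>p. cpd (1, 0) (w n) p - dx \<Omega> v p)) \<longlonglongrightarrow> 0"
    "(\<lambda>n. boundary_integral a b (\<lambda>p. (w n p)\<^sup>2)) \<longlonglongrightarrow> 0"
    by (rule zero_traceE[OF v]) (rule that)
  have l: "(\<lambda>n. nrm \<Omega> (w n)) \<longlonglongrightarrow> nrm \<Omega> v" "(\<lambda>n. nrm \<Omega> (cpd (1, 0) (w n))) \<longlonglongrightarrow> nrm \<Omega> (dx \<Omega> v)"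
    using nrm_tendsto[OF smooth_L2[OF w] H1_L2(1)[OF v1] lim(1)]
      nrm_tendsto[OF smooth_L2[OF smooth_cpd(1)[OF w]] H1_L2(2)[OF v1] lim(2)] .
  have "(nrm \<Omega> v)\<^sup>2 \<le> ?L * 0 + 2 * (?L * (nrm \<Omega> v * nrm \<Omega> (dx \<Omega> v)))"
  proof (rule LIMSEQ_le)
    show "(\<lambda>n. (nrm \<Omega> (w n))\<^sup>2) \<longlonglongrightarrow> (nrm \<Omega> v)\<^sup>2" by (intro tendsto_intros l)
    show "(\<lambda>n. ?L * boundary_integral a b (\<lambda>p. (w n p)\<^sup>2) + 2 * (?L * (nrm \<Omega> (w n) * nrm \<Omega> (cpd (1, 0) (w n)))))
      \<longlonglongrightarrow> ?L * 0 + 2 * (?L * (nrm \<Omega> v * nrm \<Omega> (dx \<Omega> v)))"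
      by (intro tendsto_intros l lim(3))
  qed (use Poincare_smooth[OF w] in blast)
  then have "nrm \<Omega> v * nrm \<Omega> v \<le> nrm \<Omega> v * (2 * ?L * nrm \<Omega> (dx \<Omega> v))"
    by (simp add: power2_eq_square algebra_simps)
  moreover have "0 \<le> 2 * ?L * nrm \<Omega> (dx \<Omega> v)" using ab by simp
  ultimately show ?thesis
    by (cases "nrm \<Omega> v = 0") (auto simp: less_le)
qed

text \<open>The first derivatives of the approximants are smooth and, together with their own
  derivatives, bounded in L2 because they converge there. So \<open>integrable_power4_limit\<close>
  applies to them.\<close>

lemma wpd_power4_integrable:
  assumes v: "v \<in> H20 a b" and e: "e \<in> {(1, 0), (0, 1)}"
  shows "integrable (lebesgue_on \<Omega>) (\<lambda>p. (wpd \<Omega> e v p)^4)"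
proof -
  have v2: "v \<in> H2 \<Omega>" using v by (simp add: H20_def)
  have D: "has_wpd e v" "has_wpd (1, 0) (wpd \<Omega> e v)" "has_wpd (0, 1) (wpd \<Omega> e v)"
    using H2_D[OF v2] e by auto
  obtain w where w: "\<And>n. smooth (w n)" and l0: "(\<lambda>n. nrm \<Omega> (\<lambda>p. w n p - v p)) \<longlonglongrightarrow> 0" and
    l1: "\<And>e. e \<in> {(1, 0), (0, 1)} \<Longrightarrow> (\<lambda>n. nrm \<Omega> (\<lambda>p. cpd e (w n) p - wpd \<Omega> e v p)) \<longlonglongrightarrow> 0" and
    l2: "\<And>e e'. e \<in> {(1, 0), (0, 1)} \<Longrightarrow> e' \<in> {(1, 0), (0, 1)} \<Longrightarrow>
      (\<lambda>n. nrm \<Omega> (\<lambda>p. cpd e' (cpd e (w n)) p - wpd \<Omega> e' (wpd \<Omega> e v) p)) \<longlonglongrightarrow> 0" and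
    bd: "(\<lambda>n. boundary_integral a b (\<lambda>p. (w n p)\<^sup>2)) \<longlonglongrightarrow> 0"
      "(\<lambda>n. boundary_integral a b (\<lambda>p. (normal_deriv a b (w n) p)\<^sup>2)) \<longlonglongrightarrow> 0"
    by (rule zero_trace_and_normal_derivE[OF v]) (rule that)
  have s: "smooth (cpd e (w n))" for n using e smooth_cpd[OF w] by auto
  have "\<exists>M. \<forall>n. nrm \<Omega> (cpd e (w n)) \<le> M"
    by (rule convergent_bounded_above[OF nrm_tendsto[OF smooth_L2[OF s] has_wpd_L2(1)[OF D(1)] l1[OF e]]])
  then obtain M0 where M0: "\<And>n. nrm \<Omega> (cpd e (w n)) \<le> M0" by blast
  have "\<exists>M. \<forall>n. nrm \<Omega> (cpd (1, 0) (cpd e (w n))) \<le> M"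
    by (rule convergent_bounded_above[OF nrm_tendsto[OF smooth_L2[OF smooth_cpd(1)[OF s]] has_wpd_L2(1)[OF D(2)] l2[OF e]]]) simp
  then obtain M1 where M1: "\<And>n. nrm \<Omega> (cpd (1, 0) (cpd e (w n))) \<le> M1" by blast
  have "\<exists>M. \<forall>n. nrm \<Omega> (cpd (0, 1) (cpd e (w n))) \<le> M"
    by (rule convergent_bounded_above[OF nrm_tendsto[OF smooth_L2[OF smooth_cpd(2)[OF s]] has_wpd_L2(1)[OF D(3)] l2[OF e]]]) simp
  then obtain M2 where M2: "\<And>n. nrm \<Omega> (cpd (0, 1) (cpd e (w n))) \<le> M2" by blast
  show ?thesis
    by (rule integrable_power4_limit[OF s has_wpd_L2(1)[OF D(1)] l1[OF e], where M="max M0 (max M1 M2)"])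
      (use M0 M1 M2 in \<open>auto simp: le_max_iff_disj\<close>)
qed

section \<open>The \<open>H\<^sup>2\<close> seminorm is the norm of the Laplacian\<close>

text \<open>
  On a horizontal side the tangential derivative is controlled only in \<open>L\<^sup>2\<close>, while the trace itself
  tends to zero; one integrates by parts along the side. The corner values tend to zero by
  interpolation between these two facts.
\<close>

lemma tangential_boundary_tendsto_0:
  assumes w: "\<And>n. smooth (w n)" and z: "smooth z" and y: "y \<in> {snd a..snd b}"
    and lim: "(\<lambda>n. integral {fst a..fst b} (\<lambda>x. (w n (x, y))\<^sup>2)) \<longlonglongrightarrow> 0"
    and M: "\<And>n. integral {fst a..fst b} (\<lambda>x. (cpd (1, 0) (w n) (x, y))\<^sup>2) \<le> M"
  shows "(\<lambda>n. integral {fst a..fst b} (\<lambda>x. cpd (1, 0) (w n) (x, y) * z (x, y))) \<longlonglongrightarrow> 0"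
proof -
  have corner: "(\<lambda>n. w n (x, y)) \<longlonglongrightarrow> 0" if x: "x \<in> {fst a..fst b}" for x
  proof -
    have "(\<lambda>n. (w n (x, y))\<^sup>2) \<longlonglongrightarrow> 0"
    proof (rule tendsto_zero_interpolation[OF lim])
      fix \<epsilon> :: real and n assume e: "\<epsilon> > 0"
      have "\<epsilon> * integral {fst a..fst b} (\<lambda>x. (cpd (1, 0) (w n) (x, y))\<^sup>2) \<le> \<epsilon> * M"
        using M e by (intro mult_left_mono) auto
      then show "(w n (x, y))\<^sup>2 \<le> (1 / (fst b - fst a) + 1 / \<epsilon>) * integral {fst a..fst b} (\<lambda>x. (w n (x, y))\<^sup>2) + \<epsilon> * M"
        using sup_square_le_fst[OF w e x, of n y] by linarith
    qed simp
    then show ?thesis by simp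
  qed
  have parts: "integral {fst a..fst b} (\<lambda>x. cpd (1, 0) (w n) (x, y) * z (x, y))
    = w n (fst b, y) * z (fst b, y) - w n (fst a, y) * z (fst a, y)
      - integral {fst a..fst b} (\<lambda>x. w n (x, y) * cpd (1, 0) z (x, y))" for n
  proof -
    have c: "continuous_on {fst a..fst b} (\<lambda>x. w n (x, y) * cpd (1, 0) z (x, y))"
      "continuous_on {fst a..fst b} (\<lambda>x. cpd (1, 0) (w n) (x, y) * z (x, y))"
      by (intro continuous_on_mult smooth_continuous_fst w z smooth_cpd(1)[OF w] smooth_cpd(1)[OF z])+
    have "((\<lambda>x. w n (x, y) * cpd (1, 0) z (x, y) + cpd (1, 0) (w n) (x, y) * z (x, y)) has_integral
       (w n (fst b, y) * z (fst b, y) - w n (fst a, y) * z (fst a, y))) {fst a..fst b}"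
    proof (rule fundamental_theorem_of_calculus)
      fix x
      have "((\<lambda>x. w n (x, y) * z (x, y)) has_real_derivative
          (w n (x, y) * cpd (1, 0) z (x, y) + cpd (1, 0) (w n) (x, y) * z (x, y))) (at x within {fst a..fst b})"
        using DERIV_mult'[OF smooth_DERIV_fst[OF w] smooth_DERIV_fst[OF z]]
        by (rule has_field_derivative_at_within)
      then show "((\<lambda>x. w n (x, y) * z (x, y)) has_vector_derivative
          (w n (x, y) * cpd (1, 0) z (x, y) + cpd (1, 0) (w n) (x, y) * z (x, y))) (at x within {fst a..fst b})"
        by (simp add: has_real_derivative_iff_has_vector_derivative)
    qed (use ab in simp)
    from integral_unique[OF this] show ?thesis
      using c by (simp add: integral_add integrable_continuous_real)
  qed
  have "(\<lambda>n. w n (fst b, y) * z (fst b, y) - w n (fst a, y) * z (fst a, y)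
      - integral {fst a..fst b} (\<lambda>x. w n (x, y) * cpd (1, 0) z (x, y))) \<longlonglongrightarrow> 0 * z (fst b, y) - 0 * z (fst a, y) - 0"
  proof (intro tendsto_diff tendsto_mult tendsto_const corner)
    show "(\<lambda>n. integral {fst a..fst b} (\<lambda>x. w n (x, y) * cpd (1, 0) z (x, y))) \<longlonglongrightarrow> 0"
      by (rule integral_mult_tendsto_0[OF _ _ lim]) (auto intro: smooth_continuous_fst w smooth_cpd(1)[OF z])
  qed (use ab in auto)
  then show ?thesis unfolding parts by simp
qed

text \<open>Integration by parts turns both sides into the x-derivative of \<open>v\<close> against
  the same third derivative of \<open>z\<close>. With \<open>z\<close> fixed, the boundary terms
  pair boundary values of the approximants of \<open>v\<close> with fixed smooth functions.\<close>

lemma Hessian_smooth: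
  assumes v: "v \<in> H20 a b" and z: "smooth z"
  shows "ip \<Omega> (dx \<Omega> (dx \<Omega> v)) (cpd (0, 1) (cpd (0, 1) z)) = ip \<Omega> (dy \<Omega> (dx \<Omega> v)) (cpd (0, 1) (cpd (1, 0) z))"
proof -
  have v2: "v \<in> H2 \<Omega>" using v by (simp add: H20_def)
  note D = H2_D[OF v2]
  note zy = smooth_cpd(2)[OF z] note zx = smooth_cpd(1)[OF z]
  note zyy = smooth_cpd(2)[OF zy] note zxy = smooth_cpd(2)[OF zx]
  obtain w where w: "\<And>n. smooth (w n)" and l0: "(\<lambda>n. nrm \<Omega> (\<lambda>p. w n p - v p)) \<longlonglongrightarrow> 0" and
    l1: "\<And>e. e \<in> {(1, 0), (0, 1)} \<Longrightarrow> (\<lambda>n. nrm \<Omega> (\<lambda>p. cpd e (w n) p - wpd \<Omega> e v p)) \<longlonglongrightarrow> 0" and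
    l2: "\<And>e e'. e \<in> {(1, 0), (0, 1)} \<Longrightarrow> e' \<in> {(1, 0), (0, 1)} \<Longrightarrow>
      (\<lambda>n. nrm \<Omega> (\<lambda>p. cpd e' (cpd e (w n)) p - wpd \<Omega> e' (wpd \<Omega> e v) p)) \<longlonglongrightarrow> 0" and
    bd: "(\<lambda>n. boundary_integral a b (\<lambda>p. (w n p)\<^sup>2)) \<longlonglongrightarrow> 0"
      "(\<lambda>n. boundary_integral a b (\<lambda>p. (normal_deriv a b (w n) p)\<^sup>2)) \<longlonglongrightarrow> 0"
    by (rule zero_trace_and_normal_derivE[OF v]) (rule that)
  note wx = smooth_cpd(1)[OF w]
  let ?V = "\<lambda>n x. integral {snd a..snd b} (\<lambda>y. cpd (1, 0) (w n) (x, y) * cpd (0, 1) (cpd (0, 1) z) (x, y))"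
  let ?H = "\<lambda>n y. integral {fst a..fst b} (\<lambda>x. cpd (1, 0) (w n) (x, y) * cpd (0, 1) (cpd (1, 0) z) (x, y))"
  have nonneg: "0 \<le> integral {fst a..fst b} (\<lambda>s. (f (s, t))\<^sup>2)" "0 \<le> integral {snd a..snd b} (\<lambda>s. (f (t, s))\<^sup>2)"
    for f :: "plane \<Rightarrow> real" and t
    by (rule integral_square_nonneg)+
  \<comment> \<open>On the vertical sides the x-derivative is the normal derivative up to sign, and
    it tends to zero in L2.\<close>
  have V: "(\<lambda>n. ?V n x) \<longlonglongrightarrow> 0" if "x = fst a \<or> x = fst b" for x
  proof (rule integral_mult_tendsto_0)
    have "integral {snd a..snd b} (\<lambda>s. (cpd (1, 0) (w n) (x, s))\<^sup>2) \<le> boundary_integral a b (\<lambda>p. (normal_deriv a b (w n) p)\<^sup>2)" for n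
      using that nonneg(1)[of "cpd (0, 1) (w n)" "snd a"] nonneg(1)[of "cpd (0, 1) (w n)" "snd b"]
        nonneg(2)[of "cpd (1, 0) (w n)" "fst a"] nonneg(2)[of "cpd (1, 0) (w n)" "fst b"]
      unfolding boundary_integral_normal_deriv[OF w] by (elim disjE) simp_all
    then show "(\<lambda>n. integral {snd a..snd b} (\<lambda>y. (cpd (1, 0) (w n) (x, y))\<^sup>2)) \<longlonglongrightarrow> 0"
      by (intro tendsto_sandwich[OF _ _ tendsto_const bd(2)]) (auto simp: nonneg)
  qed (auto intro: smooth_continuous_snd smooth_mult wx zyy)
  have "\<exists>M. \<forall>n. K\<^sub>2 * ((nrm \<Omega> (cpd (1, 0) (w n)))\<^sup>2 + (nrm \<Omega> (cpd (0, 1) (cpd (1, 0) (w n))))\<^sup>2) \<le> M"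
  proof (rule convergent_bounded_above)
    show "(\<lambda>n. K\<^sub>2 * ((nrm \<Omega> (cpd (1, 0) (w n)))\<^sup>2 + (nrm \<Omega> (cpd (0, 1) (cpd (1, 0) (w n))))\<^sup>2))
      \<longlonglongrightarrow> K\<^sub>2 * ((nrm \<Omega> (dx \<Omega> v))\<^sup>2 + (nrm \<Omega> (dy \<Omega> (dx \<Omega> v)))\<^sup>2)"
      by (intro tendsto_intros nrm_tendsto smooth_L2 wx smooth_cpd(2)[OF wx] has_wpd_L2(1)[OF D(1)] has_wpd_L2(1)[OF D(4)] l1 l2) auto
  qed
  then obtain M where M: "\<And>n. K\<^sub>2 * ((nrm \<Omega> (cpd (1, 0) (w n)))\<^sup>2 + (nrm \<Omega> (cpd (0, 1) (cpd (1, 0) (w n))))\<^sup>2) \<le> M"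
    by blast
  \<comment> \<open>On the horizontal sides the x-derivative is tangential and only bounded in L2,
    by \<open>trace_snd_le\<close>.\<close>
  have H: "(\<lambda>n. ?H n y) \<longlonglongrightarrow> 0" if "y = snd a \<or> y = snd b" for y
  proof (rule tangential_boundary_tendsto_0[OF w zxy])
    show y: "y \<in> {snd a..snd b}" using that ab by auto
    have "integral {fst a..fst b} (\<lambda>s. (w n (s, y))\<^sup>2) \<le> boundary_integral a b (\<lambda>p. (w n p)\<^sup>2)" for n
      using that nonneg(1)[of "w n" "snd a"] nonneg(1)[of "w n" "snd b"] nonneg(2)[of "w n" "fst a"] nonneg(2)[of "w n" "fst b"]
      unfolding boundary_integral_smooth[OF smooth_square[OF w]] by (elim disjE) simp_all
    then show "(\<lambda>n. integral {fst a..fst b} (\<lambda>x. (w n (x, y))\<^sup>2)) \<longlonglongrightarrow> 0"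
      by (intro tendsto_sandwich[OF _ _ tendsto_const bd(1)]) (auto simp: nonneg)
    show "integral {fst a..fst b} (\<lambda>x. (cpd (1, 0) (w n) (x, y))\<^sup>2) \<le> M" for n
      using trace_snd_le[OF wx y] M by (rule order_trans)
  qed
  have eq: "ip \<Omega> (cpd (1, 0) (cpd (1, 0) (w n))) (cpd (0, 1) (cpd (0, 1) z))
      - ip \<Omega> (cpd (0, 1) (cpd (1, 0) (w n))) (cpd (0, 1) (cpd (1, 0) z))
      = (?V n (fst b) - ?V n (fst a)) - (?H n (snd b) - ?H n (snd a))" for n
  proof -
    have "ip \<Omega> (cpd (1, 0) (cpd (1, 0) (w n))) (cpd (0, 1) (cpd (0, 1) z))
      = (?V n (fst b) - ?V n (fst a)) - ip \<Omega> (cpd (1, 0) (w n)) (cpd (1, 0) (cpd (0, 1) (cpd (0, 1) z)))"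
      unfolding ip_cpd_fst[OF wx zyy]
      by (subst integral_diff) (auto intro!: integrable_continuous_real continuous_on_mult smooth_continuous_snd smooth_mult wx zyy)
    moreover have "ip \<Omega> (cpd (0, 1) (cpd (1, 0) (w n))) (cpd (0, 1) (cpd (1, 0) z))
      = (?H n (snd b) - ?H n (snd a)) - ip \<Omega> (cpd (1, 0) (w n)) (cpd (0, 1) (cpd (0, 1) (cpd (1, 0) z)))"
      unfolding ip_cpd_snd[OF wx zxy]
      by (subst integral_diff) (auto intro!: integrable_continuous_real continuous_on_mult smooth_continuous_fst smooth_mult wx zxy)
    moreover have "cpd (1, 0) (cpd (0, 1) (cpd (0, 1) z)) = cpd (0, 1) (cpd (0, 1) (cpd (1, 0) z))"
      unfolding cpd_symmetric[OF zy] cpd_symmetric[OF z] ..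
    ultimately show ?thesis by simp
  qed
  have "(\<lambda>n. ip \<Omega> (cpd (1, 0) (cpd (1, 0) (w n))) (cpd (0, 1) (cpd (0, 1) z))
      - ip \<Omega> (cpd (0, 1) (cpd (1, 0) (w n))) (cpd (0, 1) (cpd (1, 0) z))) \<longlonglongrightarrow> (0 - 0) - (0 - 0)"
    unfolding eq by (intro tendsto_diff V H) auto
  moreover have "(\<lambda>n. ip \<Omega> (cpd (1, 0) (cpd (1, 0) (w n))) (cpd (0, 1) (cpd (0, 1) z))
      - ip \<Omega> (cpd (0, 1) (cpd (1, 0) (w n))) (cpd (0, 1) (cpd (1, 0) z)))
    \<longlonglongrightarrow> ip \<Omega> (dx \<Omega> (dx \<Omega> v)) (cpd (0, 1) (cpd (0, 1) z)) - ip \<Omega> (dy \<Omega> (dx \<Omega> v)) (cpd (0, 1) (cpd (1, 0) z))"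
    by (intro tendsto_diff ip_tendsto_left smooth_L2 smooth_cpd(1)[OF wx] smooth_cpd(2)[OF wx] zyy zxy
        has_wpd_L2(1)[OF D(3)] has_wpd_L2(1)[OF D(4)] l2) auto
  ultimately show ?thesis using LIMSEQ_unique by fastforce
qed

text \<open>\<open>Hessian_smooth\<close> with the approximants of \<open>v\<close> in place of
  \<open>z\<close>, followed by the limit. Taking the two limits one after the other avoids boundary
  terms in which both factors vary.\<close>

lemma Hessian:
  assumes v: "v \<in> H20 a b"
  shows "ip \<Omega> (dx \<Omega> (dx \<Omega> v)) (dy \<Omega> (dy \<Omega> v)) = (nrm \<Omega> (dy \<Omega> (dx \<Omega> v)))\<^sup>2"
proof -
  have v2: "v \<in> H2 \<Omega>" using v by (simp add: H20_def)
  note D = H2_D[OF v2]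
  obtain w where w: "\<And>n. smooth (w n)" and l0: "(\<lambda>n. nrm \<Omega> (\<lambda>p. w n p - v p)) \<longlonglongrightarrow> 0" and
    l1: "\<And>e. e \<in> {(1, 0), (0, 1)} \<Longrightarrow> (\<lambda>n. nrm \<Omega> (\<lambda>p. cpd e (w n) p - wpd \<Omega> e v p)) \<longlonglongrightarrow> 0" and
    l2: "\<And>e e'. e \<in> {(1, 0), (0, 1)} \<Longrightarrow> e' \<in> {(1, 0), (0, 1)} \<Longrightarrow>
      (\<lambda>n. nrm \<Omega> (\<lambda>p. cpd e' (cpd e (w n)) p - wpd \<Omega> e' (wpd \<Omega> e v) p)) \<longlonglongrightarrow> 0" and
    bd: "(\<lambda>n. boundary_integral a b (\<lambda>p. (w n p)\<^sup>2)) \<longlonglongrightarrow> 0"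
      "(\<lambda>n. boundary_integral a b (\<lambda>p. (normal_deriv a b (w n) p)\<^sup>2)) \<longlonglongrightarrow> 0"
    by (rule zero_trace_and_normal_derivE[OF v]) (rule that)
  have "(\<lambda>n. ip \<Omega> (cpd (0, 1) (cpd (0, 1) (w n))) (dx \<Omega> (dx \<Omega> v))) \<longlonglongrightarrow> ip \<Omega> (dy \<Omega> (dy \<Omega> v)) (dx \<Omega> (dx \<Omega> v))"
    by (intro ip_tendsto_left smooth_L2 smooth_cpd(2)[OF smooth_cpd(2)[OF w]] has_wpd_L2(1)[OF D(3)] has_wpd_L2(1)[OF D(6)] l2) auto
  moreover have "(\<lambda>n. ip \<Omega> (cpd (0, 1) (cpd (1, 0) (w n))) (dy \<Omega> (dx \<Omega> v))) \<longlonglongrightarrow> ip \<Omega> (dy \<Omega> (dx \<Omega> v)) (dy \<Omega> (dx \<Omega> v))"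
    by (intro ip_tendsto_left smooth_L2 smooth_cpd(2)[OF smooth_cpd(1)[OF w]] has_wpd_L2(1)[OF D(4)] l2) auto
  moreover have "ip \<Omega> (cpd (0, 1) (cpd (0, 1) (w n))) (dx \<Omega> (dx \<Omega> v)) = ip \<Omega> (cpd (0, 1) (cpd (1, 0) (w n))) (dy \<Omega> (dx \<Omega> v))" for n
    using Hessian_smooth[OF v w, of n]
    unfolding ip_commute[of \<Omega> "dx \<Omega> (dx \<Omega> v)"] ip_commute[of \<Omega> "dy \<Omega> (dx \<Omega> v)"] .
  ultimately have "ip \<Omega> (dy \<Omega> (dy \<Omega> v)) (dx \<Omega> (dx \<Omega> v)) = ip \<Omega> (dy \<Omega> (dx \<Omega> v)) (dy \<Omega> (dx \<Omega> v))"
    by (simp only: LIMSEQ_unique)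
  then show ?thesis
    unfolding nrm_sq by (simp only: ip_commute[of \<Omega> "dx \<Omega> (dx \<Omega> v)"])
qed

text \<open>In the square of the Laplacian the cross term is twice the squared norm of the mixed
  derivative, by \<open>Hessian\<close>, and the two orders of the mixed derivative agree almost
  everywhere.\<close>

lemma semi2_eq_lap:
  assumes v: "v \<in> H20 a b"
  shows "semi2 \<Omega> v = nrm \<Omega> (lap \<Omega> v)"
proof -
  have v2: "v \<in> H2 \<Omega>" using v by (simp add: H20_def)
  note D = H2_D[OF v2]
  note L = has_wpd_L2(1)[OF D(3)] has_wpd_L2(1)[OF D(6)]
  have "nrm \<Omega> (dx \<Omega> (dy \<Omega> v)) = nrm \<Omega> (dy \<Omega> (dx \<Omega> v))"
    by (rule nrm_cong_AE'[OF wpd_commute[OF v2] has_wpd_L2(1)[OF D(4)]])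
  moreover have "(nrm \<Omega> (lap \<Omega> v))\<^sup>2 = (nrm \<Omega> (dx \<Omega> (dx \<Omega> v)))\<^sup>2 + 2 * ip \<Omega> (dx \<Omega> (dx \<Omega> v)) (dy \<Omega> (dy \<Omega> v)) + (nrm \<Omega> (dy \<Omega> (dy \<Omega> v)))\<^sup>2"
    unfolding nrm_sq lap_def[abs_def] using L
    by (simp add: ip_add_left ip_add_right L2_add ip_commute[of \<Omega> "dy \<Omega> (dy \<Omega> v)" "dx \<Omega> (dx \<Omega> v)"])
  ultimately have "(nrm \<Omega> (lap \<Omega> v))\<^sup>2 = (nrm \<Omega> (dx \<Omega> (dx \<Omega> v)))\<^sup>2 + (nrm \<Omega> (dy \<Omega> (dx \<Omega> v)))\<^sup>2
     + (nrm \<Omega> (dx \<Omega> (dy \<Omega> v)))\<^sup>2 + (nrm \<Omega> (dy \<Omega> (dy \<Omega> v)))\<^sup>2"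
    by (simp add: Hessian[OF v])
  then show ?thesis
    unfolding semi2_def by (metis nrm_nonneg real_sqrt_abs abs_of_nonneg)
qed

section \<open>The trilinear form\<close>

text \<open>The Jacobian of the pair (\<phi>, \<psi>). With it b is an L2 inner product, and
  linearity of b reduces to that of \<open>ip\<close>.\<close>

definition jac :: "(plane \<Rightarrow> real) \<Rightarrow> (plane \<Rightarrow> real) \<Rightarrow> plane \<Rightarrow> real" where
  "jac \<psi> \<phi> p = dy \<Omega> \<psi> p * dx \<Omega> \<phi> p - dx \<Omega> \<psi> p * dy \<Omega> \<phi> p"

lemma trilin_ip: "trilin \<Omega> \<xi> \<psi> \<phi> = ip \<Omega> (lap \<Omega> \<xi>) (jac \<psi> \<phi>)"
  by (simp add: trilin_def ip_real jac_def)

lemma L2_mult_L4: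
  fixes f g :: "plane \<Rightarrow> real"
  assumes f: "f \<in> borel_measurable (lebesgue_on \<Omega>)" "integrable (lebesgue_on \<Omega>) (\<lambda>p. (f p)^4)"
    and g: "g \<in> borel_measurable (lebesgue_on \<Omega>)" "integrable (lebesgue_on \<Omega>) (\<lambda>p. (g p)^4)"
  shows "(\<lambda>p. f p * g p) \<in> L2 \<Omega>"
proof -
  have "integrable (lebesgue_on \<Omega>) (\<lambda>p. (f p * g p)\<^sup>2)"
  proof (rule Bochner_Integration.integrable_bound)
    show "integrable (lebesgue_on \<Omega>) (\<lambda>p. (f p)^4 + (g p)^4)" using f g by simp
    show "(\<lambda>p. (f p * g p)\<^sup>2) \<in> borel_measurable (lebesgue_on \<Omega>)" using f g by measurable
    have "(x * y)\<^sup>2 \<le> x^4 + y^4" for x y :: real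
    proof -
      have "2 * (x\<^sup>2 * y\<^sup>2) \<le> x^4 + y^4"
        using sum_squares_bound[of "x\<^sup>2" "y\<^sup>2"] by simp
      moreover have "0 \<le> x\<^sup>2 * y\<^sup>2" by simp
      ultimately have "x\<^sup>2 * y\<^sup>2 \<le> x^4 + y^4" by linarith
      then show ?thesis by (simp add: power_mult_distrib)
    qed
    then show "AE p in lebesgue_on \<Omega>. norm ((f p * g p)\<^sup>2) \<le> norm ((f p)^4 + (g p)^4)" by simp
  qed
  then show ?thesis using f g by (auto simp: L2_real_iff)
qed

text \<open>Products of two functions in L4 are in L2, and \<open>wpd_power4_integrable\<close> puts
  the factors in L4. Without this the integral in \<open>trilin\<close> could take the default value
  0 and additivity would not follow.\<close>

lemma jac_L2:
  assumes "\<psi> \<in> H20 a b" "\<phi> \<in> H20 a b"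
  shows "jac \<psi> \<phi> \<in> L2 \<Omega>"
proof -
  have "wpd \<Omega> e v \<in> borel_measurable (lebesgue_on \<Omega>)" if "v \<in> H20 a b" "e \<in> {(1, 0), (0, 1)}" for e v
    using that H2_D(1,2)[of v] has_wpd_L2(1)[of e v] by (auto simp: H20_def L2_real_iff)
  then show ?thesis
    unfolding jac_def[abs_def] using assms by (intro L2_diff L2_mult_L4 wpd_power4_integrable) auto
qed

lemma H20_has_wpd: "v \<in> H20 a b \<Longrightarrow> has_wpd (1, 0) v" "v \<in> H20 a b \<Longrightarrow> has_wpd (0, 1) v"
  using H2_D by (auto simp: H20_def)

lemma H20_H2: "v \<in> H20 a b \<Longrightarrow> v \<in> H2 \<Omega>" and H20_H1: "v \<in> H20 a b \<Longrightarrow> v \<in> H1 \<Omega>"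
  by (auto simp: H20_def H2_def)

lemma jac_add_left:
  assumes "\<psi> \<in> H20 a b" "\<psi>' \<in> H20 a b"
  shows "AE p in lebesgue_on \<Omega>. jac (\<lambda>p. \<psi> p + \<psi>' p) \<phi> p = jac \<psi> \<phi> p + jac \<psi>' \<phi> p"
  using wpd_add[OF H20_has_wpd(1)[OF assms(1)] H20_has_wpd(1)[OF assms(2)]] wpd_add[OF H20_has_wpd(2)[OF assms(1)] H20_has_wpd(2)[OF assms(2)]]
  by eventually_elim (simp add: jac_def algebra_simps)

lemma jac_scale_left:
  assumes "\<psi> \<in> H20 a b"
  shows "AE p in lebesgue_on \<Omega>. jac (\<lambda>p. c * \<psi> p) \<phi> p = c * jac \<psi> \<phi> p"
  using wpd_scale[OF H20_has_wpd(1)[OF assms(1)], of c] wpd_scale[OF H20_has_wpd(2)[OF assms(1)], of c]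
  by eventually_elim (simp add: jac_def algebra_simps)

lemma jac_swap: "jac \<psi> \<phi> p = - jac \<phi> \<psi> p"
  by (simp add: jac_def)

lemma ip_cong_AE_L2:
  fixes f g f' g' :: "plane \<Rightarrow> real"
  assumes "AE p in lebesgue_on \<Omega>. f p = f' p" "AE p in lebesgue_on \<Omega>. g p = g' p" "f' \<in> L2 \<Omega>" "g' \<in> L2 \<Omega>"
  shows "ip \<Omega> f g = ip \<Omega> f' g'"
  using assms L2_cong_AE[OF assms(1)] L2_cong_AE[OF assms(2)] by (intro ip_cong_AE) (auto simp: L2_real_iff)

lemma trilin_add1:
  assumes "\<xi> \<in> H20 a b" "\<xi>' \<in> H20 a b" "\<psi> \<in> H20 a b" "\<phi> \<in> H20 a b"
  shows "trilin \<Omega> (\<lambda>p. \<xi> p + \<xi>' p) \<psi> \<phi> = trilin \<Omega> \<xi> \<psi> \<phi> + trilin \<Omega> \<xi>' \<psi> \<phi>"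
proof -
  note L = lap_L2[OF H20_H2[OF assms(1)]] lap_L2[OF H20_H2[OF assms(2)]] jac_L2[OF assms(3,4)]
  show ?thesis
    unfolding trilin_ip ip_add_left[OF L, symmetric]
    by (rule ip_cong_AE_L2[OF lap_add[OF H20_H2[OF assms(1)] H20_H2[OF assms(2)]] _ L2_add[OF L(1,2)] L(3)]) simp
qed

lemma trilin_add2:
  assumes "\<xi> \<in> H20 a b" "\<psi> \<in> H20 a b" "\<psi>' \<in> H20 a b" "\<phi> \<in> H20 a b"
  shows "trilin \<Omega> \<xi> (\<lambda>p. \<psi> p + \<psi>' p) \<phi> = trilin \<Omega> \<xi> \<psi> \<phi> + trilin \<Omega> \<xi> \<psi>' \<phi>"
proof -
  note L = lap_L2[OF H20_H2[OF assms(1)]] jac_L2[OF assms(2,4)] jac_L2[OF assms(3,4)]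
  show ?thesis
    unfolding trilin_ip ip_add_right[OF L(2,3,1), symmetric]
    by (rule ip_cong_AE_L2[OF _ jac_add_left[OF assms(2,3)] L(1) L2_add[OF L(2,3)]]) simp
qed

lemma trilin_scale2:
  assumes "\<xi> \<in> H20 a b" "\<psi> \<in> H20 a b" "\<phi> \<in> H20 a b"
  shows "trilin \<Omega> \<xi> (\<lambda>p. c * \<psi> p) \<phi> = c * trilin \<Omega> \<xi> \<psi> \<phi>"
proof -
  note L = lap_L2[OF H20_H2[OF assms(1)]] jac_L2[OF assms(2,3)]
  show ?thesis
    unfolding trilin_ip ip_scale_right[symmetric]
    by (rule ip_cong_AE_L2[OF _ jac_scale_left[OF assms(2)] L(1) L2_scale[OF L(2)]]) simp
qed

lemma trilin_swap: "trilin \<Omega> \<xi> \<psi> \<phi> = - trilin \<Omega> \<xi> \<phi> \<psi>"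
  unfolding trilin_ip jac_swap[of \<psi> \<phi>, abs_def] by (simp add: ip_real)

lemma trilin_self: "trilin \<Omega> \<xi> \<psi> \<psi> = 0"
  using trilin_swap[of \<xi> \<psi> \<psi>] by simp

end

section \<open>Absolutely continuous functions and Gronwall's inequality\<close>

text \<open>The product is an integral over the square [0,t]^2, which is cut along the diagonal into
  two triangles that are integrated in different orders. This is integration by parts for absolutely
  continuous functions vanishing at 0.\<close>

lemma integral_triangle_Fubini:
  fixes f g :: "real \<Rightarrow> real"
  assumes f: "integrable (lebesgue_on {0..t}) f" and g: "integrable (lebesgue_on {0..t}) g"
  shows "(LINT s|lebesgue_on {0..t}. f s) * (LINT s|lebesgue_on {0..t}. g s) =
    (LINT s|lebesgue_on {0..t}. f s * (LINT r|lebesgue_on {0..s}. g r)) +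
    (LINT r|lebesgue_on {0..t}. (LINT s|lebesgue_on {0..r}. f s) * g r)"
proof -
  let ?M = "lebesgue_on {0..t}"
  interpret M: finite_measure ?M by (rule finite_measure_lebesgue_on) simp
  interpret P: pair_sigma_finite ?M ?M ..
  have [measurable]: "f \<in> borel_measurable ?M" "g \<in> borel_measurable ?M" using f g by auto
  have id: "(\<lambda>x. x) \<in> borel_measurable ?M"
    using id_borel_measurable_lebesgue_on[of "{0..t}"] by (simp add: id_def)
  have fs: "(\<lambda>z. fst z) \<in> borel_measurable (?M \<Otimes>\<^sub>M ?M)" "(\<lambda>z. snd z) \<in> borel_measurable (?M \<Otimes>\<^sub>M ?M)"
    using measurable_compose[OF measurable_fst id] measurable_compose[OF measurable_snd id] by auto
  \<comment> \<open>The closed triangle on which the second coordinate is the earlier time.\<close>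
  define A where "A = {z \<in> space (?M \<Otimes>\<^sub>M ?M). snd z \<le> fst z}"
  have A: "A \<in> sets (?M \<Otimes>\<^sub>M ?M)"
    unfolding A_def by (rule borel_measurable_le[OF fs(2) fs(1)])
  define F where "F z = f (fst z) * g (snd z)" for z
  have F: "integrable (?M \<Otimes>\<^sub>M ?M) F"
  proof (rule P.Fubini_integrable)
    show "F \<in> borel_measurable (?M \<Otimes>\<^sub>M ?M)" unfolding F_def by measurable
    show "integrable ?M (\<lambda>x. LINT y|?M. norm (F (x, y)))"
      unfolding F_def using f g by (simp add: abs_mult)
    show "AE x in ?M. integrable ?M (\<lambda>y. F (x, y))"
      unfolding F_def using g by simp
  qed
  have FA: "integrable (?M \<Otimes>\<^sub>M ?M) (\<lambda>z. indicator A z * F z)"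
    using integrable_mult_indicator[OF A F] by simp
  have FB: "integrable (?M \<Otimes>\<^sub>M ?M) (\<lambda>z. (1 - indicator A z) * F z)"
    using Bochner_Integration.integrable_diff[OF F FA] by (simp add: algebra_simps)
  have "(LINT s|?M. f s) * (LINT s|?M. g s) = (LINT s|?M. (LINT r|?M. F (s, r)))"
    unfolding F_def by simp
  also have "\<dots> = integral\<^sup>L (?M \<Otimes>\<^sub>M ?M) F"
    by (rule P.integral_fst'[OF F])
  also have "\<dots> = integral\<^sup>L (?M \<Otimes>\<^sub>M ?M) (\<lambda>z. indicator A z * F z) + integral\<^sup>L (?M \<Otimes>\<^sub>M ?M) (\<lambda>z. (1 - indicator A z) * F z)"
    using Bochner_Integration.integral_add[OF FA FB] by (simp add: algebra_simps)
  also have "integral\<^sup>L (?M \<Otimes>\<^sub>M ?M) (\<lambda>z. indicator A z * F z) = (LINT s|?M. (LINT r|?M. indicator A (s, r) * F (s, r)))"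
    by (rule P.integral_fst'[OF FA, symmetric])
  also have "\<dots> = (LINT s|?M. f s * (LINT r|lebesgue_on {0..s}. g r))"
  proof (intro Bochner_Integration.integral_cong refl)
    fix s assume s: "s \<in> space ?M"
    have "(LINT r|?M. indicator A (s, r) * F (s, r)) = (LINT r|?M. f s * (if r \<in> {0..s} then g r else 0))"
      using s by (intro Bochner_Integration.integral_cong) (auto simp: A_def F_def space_pair_measure indicator_def)
    also have "\<dots> = f s * (LINT r|?M. (if r \<in> {0..s} then g r else 0))" by simp
    also have "(LINT r|?M. (if r \<in> {0..s} then g r else 0)) = (LINT r|lebesgue_on {0..s}. g r)"
      using s by (intro Lebesgue_Measure.integral_restrict) auto
    finally show "(LINT r|?M. indicator A (s, r) * F (s, r)) = f s * (LINT r|lebesgue_on {0..s}. g r)" .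
  qed
  also have "integral\<^sup>L (?M \<Otimes>\<^sub>M ?M) (\<lambda>z. (1 - indicator A z) * F z) = (LINT r|?M. (LINT s|?M. (1 - indicator A (s, r)) * F (s, r)))"
    using P.integral_snd[of "\<lambda>s r. (1 - indicator A (s, r)) * F (s, r)"] FB by (simp add: case_prod_beta')
  also have "\<dots> = (LINT r|?M. (LINT s|lebesgue_on {0..r}. f s) * g r)"
  proof (intro Bochner_Integration.integral_cong refl)
    fix r assume r: "r \<in> space ?M"
    have "(LINT s|?M. (1 - indicator A (s, r)) * F (s, r)) = (LINT s|?M. (if s \<in> {0..<r} then f s else 0) * g r)"
      using r by (intro Bochner_Integration.integral_cong) (auto simp: A_def F_def space_pair_measure indicator_def)
    also have "\<dots> = (LINT s|?M. (if s \<in> {0..<r} then f s else 0)) * g r" by simp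
    \<comment> \<open>The other triangle is open at the diagonal; adding the single point
      \<open>s = r\<close> leaves the inner integral unchanged.\<close>
    also have "(LINT s|?M. (if s \<in> {0..<r} then f s else 0)) = (LINT s|?M. (if s \<in> {0..r} then f s else 0))"
    proof (rule integral_cong_AE)
      have "{s \<in> {0..t}. s \<in> {0..<r}} \<in> sets ?M"
        unfolding sets_restrict_space by (rule image_eqI[of _ _ "{0..<r}"]) auto
      then show "(\<lambda>s. if s \<in> {0..<r} then f s else 0) \<in> borel_measurable ?M"
        by (intro measurable_If) (simp_all only: space_lebesgue_on, measurable)
      have "{s \<in> {0..t}. s \<in> {0..r}} \<in> sets ?M"
        unfolding sets_restrict_space by (rule image_eqI[of _ _ "{0..r}"]) auto
      then show "(\<lambda>s. if s \<in> {0..r} then f s else 0) \<in> borel_measurable ?M"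
        by (intro measurable_If) (simp_all only: space_lebesgue_on, measurable)
      have "AE s in lebesgue. s \<noteq> r" using AE_completion[OF AE_lborel_singleton] .
      then have "AE s in lebesgue. s \<in> {0..t} \<longrightarrow> (if s \<in> {0..<r} then f s else 0) = (if s \<in> {0..r} then f s else 0)"
        by eventually_elim auto
      then show "AE s in ?M. (if s \<in> {0..<r} then f s else 0) = (if s \<in> {0..r} then f s else 0)"
        by (simp add: AE_restrict_space_iff)
    qed
    also have "\<dots> = (LINT s|lebesgue_on {0..r}. f s)"
      using r by (intro Lebesgue_Measure.integral_restrict) auto
    finally show "(LINT s|?M. (1 - indicator A (s, r)) * F (s, r)) = (LINT s|lebesgue_on {0..r}. f s) * g r" .
  qed
  finally show ?thesis .
qed

lemma abs_cont_deriv_integrable: "abs_cont_deriv T f f' \<Longrightarrow> t \<le> T \<Longrightarrow> integrable (lebesgue_on {0..t}) f'"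
  unfolding abs_cont_deriv_def by (rule integrable_subinterval[of 0 T]) auto

lemma abs_cont_deriv_eq: "abs_cont_deriv T f f' \<Longrightarrow> t \<in> {0..T} \<Longrightarrow> f t = f 0 + (LINT s|lebesgue_on {0..t}. f' s)"
  unfolding abs_cont_deriv_def by blast

lemma abs_cont_deriv_time: "abs_cont_deriv T f f' \<Longrightarrow> integrable (time T) f'"
  unfolding abs_cont_deriv_def by blast

lemma abs_cont_deriv_continuous:
  assumes "abs_cont_deriv T f f'"
  shows "continuous_on {0..T} f"
proof -
  have "continuous_on {0..T} (\<lambda>t. f 0 + (LINT s|lebesgue_on {0..t}. f' s))"
    by (intro continuous_on_add continuous_on_const indefinite_integral_continuous_real abs_cont_deriv_time[OF assms])
  then show ?thesis
    by (rule continuous_on_eq) (rule abs_cont_deriv_eq[OF assms, symmetric])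
qed

lemma abs_cont_deriv_add:
  assumes "abs_cont_deriv T f f'" "abs_cont_deriv T g g'"
  shows "abs_cont_deriv T (\<lambda>t. f t + g t) (\<lambda>t. f' t + g' t)"
  unfolding abs_cont_deriv_def
proof (intro conjI ballI)
  show "integrable (time T) (\<lambda>t. f' t + g' t)" using abs_cont_deriv_time[OF assms(1)] abs_cont_deriv_time[OF assms(2)] by simp
  fix t assume t: "t \<in> {0..T}"
  have "integrable (lebesgue_on {0..t}) f'" "integrable (lebesgue_on {0..t}) g'"
    using abs_cont_deriv_integrable[OF assms(1)] abs_cont_deriv_integrable[OF assms(2)] t by auto
  then show "f t + g t = f 0 + g 0 + (LINT s|lebesgue_on {0..t}. f' s + g' s)"
    unfolding abs_cont_deriv_eq[OF assms(1) t] abs_cont_deriv_eq[OF assms(2) t] by simp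
qed

lemma abs_cont_deriv_scale:
  assumes "abs_cont_deriv T f f'"
  shows "abs_cont_deriv T (\<lambda>t. c * f t) (\<lambda>t. c * f' t)"
  unfolding abs_cont_deriv_def
proof (intro conjI ballI)
  show "integrable (time T) (\<lambda>t. c * f' t)" using abs_cont_deriv_time[OF assms(1)] by simp
  fix t assume t: "t \<in> {0..T}"
  show "c * f t = c * f 0 + (LINT s|lebesgue_on {0..t}. c * f' s)"
    unfolding abs_cont_deriv_eq[OF assms(1) t] by (simp add: distrib_left)
qed

lemma abs_cont_deriv_diff:
  assumes "abs_cont_deriv T f f'" "abs_cont_deriv T g g'"
  shows "abs_cont_deriv T (\<lambda>t. f t - g t) (\<lambda>t. f' t - g' t)"
  using abs_cont_deriv_add[OF assms(1) abs_cont_deriv_scale[OF assms(2), of "-1"]] by simp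

lemma abs_cont_deriv_cong:
  assumes "abs_cont_deriv T f f'" "\<And>t. t \<in> {0..T} \<Longrightarrow> g t = f t" "0 \<le> T"
  shows "abs_cont_deriv T g f'"
  unfolding abs_cont_deriv_def
proof (intro conjI ballI abs_cont_deriv_time[OF assms(1)])
  fix t assume t: "t \<in> {0..T}"
  have "g 0 = f 0" using assms(2,3) by simp
  then show "g t = g 0 + (LINT s|lebesgue_on {0..t}. f' s)"
    using abs_cont_deriv_eq[OF assms(1) t] assms(2)[OF t] by metis
qed

lemma abs_cont_deriv_sum:
  assumes "finite I" "\<And>i. i \<in> I \<Longrightarrow> abs_cont_deriv T (f i) (f' i)"
  shows "abs_cont_deriv T (\<lambda>t. \<Sum>i\<in>I. f i t) (\<lambda>t. \<Sum>i\<in>I. f' i t)"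
  using assms
proof (induction I rule: finite_induct)
  case empty
  then show ?case by (simp add: abs_cont_deriv_def)
next
  case (insert i I)
  have "abs_cont_deriv T (\<lambda>t. f i t + (\<Sum>i\<in>I. f i t)) (\<lambda>t. f' i t + (\<Sum>i\<in>I. f' i t))"
    by (rule abs_cont_deriv_add) (use insert in auto)
  then show ?case using insert by simp
qed

lemma integrable_mult_continuous:
  fixes f g :: "real \<Rightarrow> real"
  assumes f: "integrable (lebesgue_on {c..d}) f" and g: "continuous_on {c..d} g"
  shows "integrable (lebesgue_on {c..d}) (\<lambda>t. f t * g t)"
proof -
  obtain B where B: "\<And>t. t \<in> {c..d} \<Longrightarrow> \<bar>g t\<bar> \<le> B"
  proof -
    have "bounded (g ` {c..d})" using compact_imp_bounded[OF compact_continuous_image[OF g compact_Icc]] .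
    then obtain B where "\<forall>x\<in>g ` {c..d}. norm x \<le> B" unfolding bounded_iff by blast
    then show ?thesis using that[of B] by fastforce
  qed
  show ?thesis
  proof (rule Bochner_Integration.integrable_bound)
    show "integrable (lebesgue_on {c..d}) (\<lambda>t. B * f t)" using f by simp
    have "g \<in> borel_measurable (lebesgue_on {c..d})"
      using g by (rule continuous_imp_measurable_on_sets_lebesgue) simp
    then show "(\<lambda>t. f t * g t) \<in> borel_measurable (lebesgue_on {c..d})" using f by auto
    have "\<bar>f t * g t\<bar> \<le> \<bar>B * f t\<bar>" if "t \<in> {c..d}" for t
    proof -
      have "\<bar>g t\<bar> \<le> \<bar>B\<bar>" using B[OF that] by linarith
      from mult_left_mono[OF this abs_ge_zero[of "f t"]] show ?thesis by (simp add: abs_mult mult.commute)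
    qed
    then show "AE t in lebesgue_on {c..d}. norm (f t * g t) \<le> norm (B * f t)"
      by (intro AE_I2) simp
  qed
qed

text \<open>With f = f(0) + F and g = g(0) + G for the indefinite integrals F and G, everything but
  the product F G is linear, and F G is \<open>integral_triangle_Fubini\<close>.\<close>

lemma abs_cont_deriv_mult:
  assumes f: "abs_cont_deriv T f f'" and g: "abs_cont_deriv T g g'"
  shows "abs_cont_deriv T (\<lambda>t. f t * g t) (\<lambda>t. f' t * g t + f t * g' t)"
  unfolding abs_cont_deriv_def
proof (intro conjI ballI)
  have fi: "integrable (lebesgue_on {0..t}) f'" and gi: "integrable (lebesgue_on {0..t}) g'" if "t \<le> T" for t
    using abs_cont_deriv_integrable[OF f that] abs_cont_deriv_integrable[OF g that] .
  have c: "continuous_on {0..t} f" "continuous_on {0..t} g" if "t \<le> T" for t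
    using that continuous_on_subset[OF abs_cont_deriv_continuous[OF f]] continuous_on_subset[OF abs_cont_deriv_continuous[OF g]] by auto
  have i: "integrable (lebesgue_on {0..t}) (\<lambda>s. f' s * g s)" "integrable (lebesgue_on {0..t}) (\<lambda>s. f s * g' s)" if "t \<le> T" for t
    using integrable_mult_continuous[OF fi c(2)] integrable_mult_continuous[OF gi c(1)] that by (auto simp: mult.commute)
  show "integrable (time T) (\<lambda>t. f' t * g t + f t * g' t)" using i[of T] by simp
  fix t assume t: "t \<in> {0..T}"
  let ?F = "\<lambda>s. LINT r|lebesgue_on {0..s}. f' r" and ?G = "\<lambda>s. LINT r|lebesgue_on {0..s}. g' r"
  have t': "t \<le> T" and t0: "t \<in> {0..t}" using t by simp_all
  have FG: "f s = f 0 + ?F s" "g s = g 0 + ?G s" if "s \<in> {0..t}" for s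
    using abs_cont_deriv_eq[OF f, of s] abs_cont_deriv_eq[OF g, of s] t that by auto
  have cF: "continuous_on {0..t} ?F" "continuous_on {0..t} ?G"
    by (rule indefinite_integral_continuous_real[OF fi[OF t']], rule indefinite_integral_continuous_real[OF gi[OF t']])
  have j: "integrable (lebesgue_on {0..t}) (\<lambda>s. f' s * ?G s)" "integrable (lebesgue_on {0..t}) (\<lambda>s. ?F s * g' s)"
    using integrable_mult_continuous[OF fi[OF t'] cF(2)] integrable_mult_continuous[OF gi[OF t'] cF(1)] by (auto simp: mult.commute)
  have "(LINT s|lebesgue_on {0..t}. f' s * g s + f s * g' s)
     = (LINT s|lebesgue_on {0..t}. (g 0 * f' s + f 0 * g' s) + (f' s * ?G s + ?F s * g' s))"
  proof (intro Bochner_Integration.integral_cong refl)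
    fix s assume "s \<in> space (lebesgue_on {0..t})"
    then have s: "s \<in> {0..t}" by simp
    show "f' s * g s + f s * g' s = (g 0 * f' s + f 0 * g' s) + (f' s * ?G s + ?F s * g' s)"
      unfolding FG(1)[OF s] FG(2)[OF s] by (simp add: algebra_simps)
  qed
  also have "\<dots> = g 0 * ?F t + f 0 * ?G t + ?F t * ?G t"
    using j fi[OF t'] gi[OF t'] integral_triangle_Fubini[OF fi[OF t'] gi[OF t']] by simp
  finally show "f t * g t = f 0 * g 0 + (LINT s|lebesgue_on {0..t}. f' s * g s + f s * g' s)"
    unfolding FG(1)[OF t0] FG(2)[OF t0] by (simp add: algebra_simps)
qed

lemma abs_cont_deriv_square:
  assumes "abs_cont_deriv T f f'"
  shows "abs_cont_deriv T (\<lambda>t. (f t)\<^sup>2) (\<lambda>t. 2 * (f t * f' t))"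
  using abs_cont_deriv_mult[OF assms assms] by (simp add: power2_eq_square algebra_simps)

lemma LINT_split:
  fixes f :: "real \<Rightarrow> real"
  assumes "integrable (lebesgue_on {0..T}) f" "0 \<le> s" "s \<le> t" "t \<le> T"
  shows "(LINT r|lebesgue_on {0..t}. f r) = (LINT r|lebesgue_on {0..s}. f r) + (LINT r|lebesgue_on {s..t}. f r)"
proof -
  have i: "integrable (lebesgue_on {0..s}) f" "integrable (lebesgue_on {s..t}) f" "integrable (lebesgue_on {0..t}) f"
    by (rule integrable_subinterval[OF assms(1)]; use assms in auto)+
  have "f integrable_on {0..t}" using i(3) by (rule integrable_on_lebesgue_on) simp
  then show ?thesis
    using i assms by (simp add: lebesgue_integral_eq_integral Henstock_Kurzweil_Integration.integral_combine)
qed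

lemma LINT_eq_0: "(LINT s|lebesgue_on {0}. f s) = (0::real)" for f :: "real \<Rightarrow> real"
  by (rule integral_eq_zero_null_sets) simp

lemma LINT_nonneg_mono:
  fixes f :: "real \<Rightarrow> real"
  assumes "integrable (lebesgue_on {0..T}) f" "\<And>t. 0 \<le> f t" "0 \<le> s" "s \<le> t" "t \<le> T"
  shows "(LINT r|lebesgue_on {0..s}. f r) \<le> (LINT r|lebesgue_on {0..t}. f r)"
  unfolding LINT_split[OF assms(1,3-5)] using assms(2) by (simp add: Bochner_Integration.integral_nonneg)

text \<open>
  Cut \<open>[0,t]\<close> into pieces on which \<open>k\<close> has integral at most \<open>1/2\<close>: on each of them the right-hand
  side at most doubles.
\<close>

lemma Gronwall:
  fixes k Y :: "real \<Rightarrow> real"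
  assumes k: "integrable (lebesgue_on {0..T}) k" "\<And>t. 0 \<le> k t"
    and Y: "continuous_on {0..T} Y" "\<And>t. 0 \<le> Y t"
    and le: "\<And>t. t \<in> {0..T} \<Longrightarrow> Y t \<le> A + (LINT s|lebesgue_on {0..t}. k s * Y s)"
    and A: "0 \<le> A" and t: "t \<in> {0..T}" and N: "(LINT s|lebesgue_on {0..t}. k s) \<le> real N / 2"
  shows "A + (LINT s|lebesgue_on {0..t}. k s * Y s) \<le> 2 ^ N * A"
proof -
  define Z where "Z t = A + (LINT s|lebesgue_on {0..t}. k s * Y s)" for t
  define K where "K t = (LINT s|lebesgue_on {0..t}. k s)" for t
  have kY: "integrable (lebesgue_on {0..T}) (\<lambda>s. k s * Y s)"
    by (rule integrable_mult_continuous[OF k(1) Y(1)])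
  have kY0: "0 \<le> k s * Y s" for s using k(2) Y(2) by simp
  have cK: "continuous_on {0..T} K"
    unfolding K_def by (rule indefinite_integral_continuous_real[OF k(1)])
  have Zmono: "Z s \<le> Z t" if "0 \<le> s" "s \<le> t" "t \<le> T" for s t
    unfolding Z_def using LINT_nonneg_mono[OF kY kY0 that] by simp
  \<comment> \<open>\<open>Y\<close> is below \<open>Z\<close> and \<open>Z\<close> is
    nondecreasing, so on the whole piece the weight \<open>k\<close> multiplies at most
    \<open>Z t\<close>.\<close>
  have step: "Z t - Z s \<le> Z t * (K t - K s)" if "0 \<le> s" "s \<le> t" "t \<le> T" for s t
  proof -
    have sub: "{s..t} \<subseteq> {0..T}" using that by auto
    have "Z t - Z s = (LINT r|lebesgue_on {s..t}. k r * Y r)"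
      unfolding Z_def LINT_split[OF kY that] by simp
    also have "\<dots> \<le> (LINT r|lebesgue_on {s..t}. k r * Z t)"
    proof (rule integral_mono)
      show "integrable (lebesgue_on {s..t}) (\<lambda>r. k r * Y r)" by (rule integrable_subinterval[OF kY sub])
      show "integrable (lebesgue_on {s..t}) (\<lambda>r. k r * Z t)" using integrable_subinterval[OF k(1) sub] by simp
      show "k r * Y r \<le> k r * Z t" if r: "r \<in> space (lebesgue_on {s..t})" for r
      proof (rule mult_left_mono[OF _ k(2)])
        have "Y r \<le> Z r" using le[of r] r \<open>0 \<le> s\<close> \<open>t \<le> T\<close> by (auto simp: Z_def)
        also have "Z r \<le> Z t" using Zmono r \<open>0 \<le> s\<close> \<open>t \<le> T\<close> by auto
        finally show "Y r \<le> Z t" .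
      qed
    qed
    also have "\<dots> = Z t * (K t - K s)"
      unfolding K_def LINT_split[OF k(1) that] by simp
    finally show ?thesis .
  qed
  have "\<forall>t\<in>{0..T}. K t \<le> real n / 2 \<longrightarrow> Z t \<le> 2 ^ n * A" for n
  proof (induction n)
    case 0
    have K0: "K 0 = 0" "Z 0 = A" by (auto simp: K_def Z_def LINT_eq_0)
    show ?case
    proof (intro ballI impI)
      fix t assume t: "t \<in> {0..T}" and Kt: "K t \<le> real 0 / 2"
      have "0 \<le> K t" unfolding K_def using k(2) by (simp add: Bochner_Integration.integral_nonneg)
      then have "K t = 0" using Kt by simp
      then show "Z t \<le> 2 ^ 0 * A" using step[of 0 t] t K0 by simp
    qed
  next
    case (Suc n)
    show ?case
    proof (intro ballI impI)
      fix t assume t: "t \<in> {0..T}" and Kt: "K t \<le> real (Suc n) / 2"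
      show "Z t \<le> 2 ^ Suc n * A"
      proof (cases "K t \<le> real n / 2")
        case True
        then have "Z t \<le> 2 ^ n * A" using Suc t by blast
        moreover have "0 \<le> 2 ^ n * A" using A by simp
        ultimately show ?thesis by simp
      next
        case False
        \<comment> \<open>The start of the last piece: the continuous function \<open>K\<close>
          takes the value n/2 at some time, from which it grows by at most 1/2 up to
          \<open>t\<close>. Half of \<open>Z t\<close> can then be absorbed, which costs a factor
          2.\<close>
        have "\<exists>s. 0 \<le> s \<and> s \<le> t \<and> K s = real n / 2"
        proof (rule IVT')
          show "K 0 \<le> real n / 2" by (simp add: K_def LINT_eq_0)
          show "continuous_on {0..t} K" using cK by (rule continuous_on_subset) (use t in auto)
        qed (use False t in auto)
        then obtain s where s: "0 \<le> s" "s \<le> t" "K s = real n / 2" by blast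
        have "Z s \<le> 2 ^ n * A" using Suc s t by auto
        moreover have "Z t - Z s \<le> Z t * (1 / 2)"
        proof -
          have "Z t - Z s \<le> Z t * (K t - K s)" using step s t by auto
          also have "\<dots> \<le> Z t * (1 / 2)"
          proof (rule mult_left_mono)
            show "K t - K s \<le> 1 / 2" using Kt s(3) by (simp add: field_simps)
            have "0 \<le> Z 0" using A by (simp add: Z_def LINT_eq_0)
            then show "0 \<le> Z t" using Zmono[of 0 t] t by auto
          qed
          finally show ?thesis .
        qed
        ultimately show ?thesis by simp
      qed
    qed
  qed
  then show ?thesis using t N by (auto simp: Z_def K_def)
qed

text \<open>The differential inequality, known only almost everywhere, is integrated by absolute
  continuity. Keeping the dissipation \<open>L\<close> on the left throughout bounds
  \<open>Y T\<close> and the integral of \<open>L\<close> at once.\<close>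

lemma energy_Gronwall:
  fixes k d L Y Y' :: "real \<Rightarrow> real"
  assumes T: "0 \<le> T" and Y: "abs_cont_deriv T Y Y'" "\<And>t. 0 \<le> Y t"
    and k: "integrable (time T) k" "\<And>t. 0 \<le> k t"
    and d: "integrable (time T) d" "\<And>t. 0 \<le> d t"
    and L: "integrable (time T) L" "\<And>t. 0 \<le> L t"
    and le: "AE t in time T. Y' t \<le> k t * Y t + d t - L t"
    and N: "(LINT t|time T. k t) \<le> real N / 2"
  shows "Y T + (LINT t|time T. L t) \<le> 2 ^ N * (Y 0 + (LINT t|time T. d t))"
proof -
  \<comment> \<open>The source is integrated over all of [0,T], so that \<open>A\<close> is constant
    in time as \<open>Gronwall\<close> requires.\<close>
  define A where "A = Y 0 + (LINT t|time T. d t)"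
  have cY: "continuous_on {0..T} Y" by (rule abs_cont_deriv_continuous[OF Y(1)])
  have kY: "integrable (time T) (\<lambda>t. k t * Y t)" by (rule integrable_mult_continuous[OF k(1) cY])
  have A: "0 \<le> A" unfolding A_def using Y(2) d(2) by (simp add: Bochner_Integration.integral_nonneg)
  have main: "Y t + (LINT s|lebesgue_on {0..t}. L s) \<le> A + (LINT s|lebesgue_on {0..t}. k s * Y s)" if t: "t \<in> {0..T}" for t
  proof -
    have sub: "{0..t} \<subseteq> {0..T}" using t by auto
    note i = integrable_subinterval[OF kY sub] integrable_subinterval[OF d(1) sub] integrable_subinterval[OF L(1) sub]
    have "(LINT s|lebesgue_on {0..t}. Y' s) \<le> (LINT s|lebesgue_on {0..t}. k s * Y s + d s - L s)"
    proof (rule integral_mono_AE)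
      show "integrable (lebesgue_on {0..t}) Y'" using abs_cont_deriv_integrable[OF Y(1)] t by simp
      show "integrable (lebesgue_on {0..t}) (\<lambda>s. k s * Y s + d s - L s)" using i by simp
      have "AE s in lebesgue. s \<in> {0..T} \<longrightarrow> Y' s \<le> k s * Y s + d s - L s"
        using le by (simp add: AE_restrict_space_iff)
      then have "AE s in lebesgue. s \<in> {0..t} \<longrightarrow> Y' s \<le> k s * Y s + d s - L s"
        by eventually_elim (use sub in auto)
      then show "AE s in lebesgue_on {0..t}. Y' s \<le> k s * Y s + d s - L s"
        by (simp add: AE_restrict_space_iff)
    qed
    also have "\<dots> = (LINT s|lebesgue_on {0..t}. k s * Y s) + (LINT s|lebesgue_on {0..t}. d s) - (LINT s|lebesgue_on {0..t}. L s)"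
      using i by simp
    also have "(LINT s|lebesgue_on {0..t}. d s) \<le> (LINT s|time T. d s)"
      using LINT_nonneg_mono[OF d] t by simp
    finally show ?thesis
      unfolding abs_cont_deriv_eq[OF Y(1) t] by (simp add: A_def)
  qed
  have "Y t \<le> A + (LINT s|lebesgue_on {0..t}. k s * Y s)" if "t \<in> {0..T}" for t
    using main[OF that] Bochner_Integration.integral_nonneg[of "lebesgue_on {0..t}" L] L(2) by fastforce
  from Gronwall[OF k cY Y(2) this A _ N] T
  have "A + (LINT s|time T. k s * Y s) \<le> 2 ^ N * A" by simp
  then show ?thesis using main[of T] T by (simp add: A_def)
qed

section \<open>Finite-dimensional function spaces\<close>

definition fun_space :: "(plane \<Rightarrow> real) set \<Rightarrow> bool" where
  "fun_space X \<longleftrightarrow> (\<lambda>p. 0) \<in> X \<and> (\<forall>u\<in>X. \<forall>v\<in>X. (\<lambda>p. u p + v p) \<in> X) \<and> (\<forall>c. \<forall>v\<in>X. (\<lambda>p. c * v p) \<in> X)"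

lemma fun_space_add: "fun_space X \<Longrightarrow> u \<in> X \<Longrightarrow> v \<in> X \<Longrightarrow> (\<lambda>p. u p + v p) \<in> X"
  and fun_space_scale: "fun_space X \<Longrightarrow> v \<in> X \<Longrightarrow> (\<lambda>p. c * v p) \<in> X"
  and fun_space_zero: "fun_space X \<Longrightarrow> (\<lambda>p. 0) \<in> X"
  by (auto simp: fun_space_def)

lemma fun_space_diff: "fun_space X \<Longrightarrow> u \<in> X \<Longrightarrow> v \<in> X \<Longrightarrow> (\<lambda>p. u p - v p) \<in> X"
  using fun_space_add[of X u "\<lambda>p. (-1) * v p"] fun_space_scale[of X v "-1"] by simp

text \<open>\<open>L\<close> is linear on \<open>X\<close> only, so the induction must carry along
  that the partial sums stay in \<open>X\<close>.\<close>

lemma fun_space_linear_sum: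
  assumes X: "fun_space X" and "finite J" "\<And>j. j \<in> J \<Longrightarrow> \<phi> j \<in> X"
    and add: "\<And>u v. u \<in> X \<Longrightarrow> v \<in> X \<Longrightarrow> L (\<lambda>p. u p + v p) = L u + (L v :: real)"
    and scale: "\<And>c v. v \<in> X \<Longrightarrow> L (\<lambda>p. c * v p) = c * L v"
  shows "(\<lambda>p. \<Sum>j\<in>J. c j * \<phi> j p) \<in> X \<and> L (\<lambda>p. \<Sum>j\<in>J. c j * \<phi> j p) = (\<Sum>j\<in>J. c j * L (\<phi> j))"
  using assms(2,3)
proof (induction J rule: finite_induct)
  case empty
  have "L (\<lambda>p. 0) = 0" using scale[OF fun_space_zero[OF X], of 0] by simp
  then show ?case using fun_space_zero[OF X] by simp
next
  case (insert j J)
  then have IH: "(\<lambda>p. \<Sum>j\<in>J. c j * \<phi> j p) \<in> X" "L (\<lambda>p. \<Sum>j\<in>J. c j * \<phi> j p) = (\<Sum>j\<in>J. c j * L (\<phi> j))"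
    and j: "\<phi> j \<in> X" by auto
  have "(\<lambda>p. \<Sum>j\<in>insert j J. c j * \<phi> j p) = (\<lambda>p. c j * \<phi> j p + (\<Sum>j\<in>J. c j * \<phi> j p))"
    using insert by auto
  then show ?case
    using fun_space_add[OF X fun_space_scale[OF X j] IH(1), of "c j"] add[OF fun_space_scale[OF X j] IH(1), of "c j"]
      scale[OF j] IH(2) insert by simp
qed

lemma fun_space_sum:
  "fun_space X \<Longrightarrow> finite J \<Longrightarrow> (\<And>j. j \<in> J \<Longrightarrow> \<phi> j \<in> X) \<Longrightarrow> (\<lambda>p. \<Sum>j\<in>J. c j * \<phi> j p) \<in> X"
  using fun_space_linear_sum[of X J \<phi> "\<lambda>_. 0" c] by simp

text \<open>Gaussian elimination: with a pivot \<open>j0\<close> the reduced system has one unknown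
  and one equation fewer, and the value at \<open>j0\<close> is recovered from the eliminated
  equation.\<close>

lemma underdetermined_system:
  fixes c :: "'j \<Rightarrow> 'i \<Rightarrow> real"
  assumes "finite I" "finite J" "card I < card J"
  shows "\<exists>\<alpha>. (\<exists>j\<in>J. \<alpha> j \<noteq> 0) \<and> (\<forall>i\<in>I. (\<Sum>j\<in>J. \<alpha> j * c j i) = 0)"
  using assms
proof (induction I arbitrary: J c rule: finite_induct)
  case empty
  then have "J \<noteq> {}" by auto
  then show ?case by (intro exI[of _ "\<lambda>_. 1"]) auto
next
  case (insert i I)
  show ?case
  proof (cases "\<forall>j\<in>J. c j i = 0")
    case True
    have "card I < card J" using insert by simp
    from insert.IH[OF insert.prems(1) this, of c] True show ?thesis by auto
  next
    case False
    then obtain j0 where j0: "j0 \<in> J" "c j0 i \<noteq> 0" by blast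
    have "card I < card (J - {j0})" using insert j0 by simp
    from insert.IH[OF _ this, of "\<lambda>j l. c j l - c j i / c j0 i * c j0 l"] insert.prems(1)
    obtain \<alpha> where \<alpha>: "\<exists>j\<in>J - {j0}. \<alpha> j \<noteq> 0"
      "\<And>l. l \<in> I \<Longrightarrow> (\<Sum>j\<in>J - {j0}. \<alpha> j * (c j l - c j i / c j0 i * c j0 l)) = 0"
      by auto
    define \<beta> where "\<beta> = \<alpha>(j0 := - (\<Sum>j\<in>J - {j0}. \<alpha> j * (c j i / c j0 i)))"
    have \<beta>: "(\<Sum>j\<in>J. \<beta> j * c j l) = (\<Sum>j\<in>J - {j0}. \<alpha> j * (c j l - c j i / c j0 i * c j0 l))" for l
    proof -
      have "(\<Sum>j\<in>J. \<beta> j * c j l) = \<beta> j0 * c j0 l + (\<Sum>j\<in>J - {j0}. \<beta> j * c j l)"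
        using insert.prems(1) j0(1) by (rule sum.remove)
      also have "(\<Sum>j\<in>J - {j0}. \<beta> j * c j l) = (\<Sum>j\<in>J - {j0}. \<alpha> j * c j l)"
        by (intro sum.cong) (auto simp: \<beta>_def)
      also have "\<beta> j0 * c j0 l = - (\<Sum>j\<in>J - {j0}. \<alpha> j * (c j i / c j0 i) * c j0 l)"
        by (simp add: \<beta>_def sum_distrib_right)
      finally show ?thesis
        by (simp add: sum_subtractf[symmetric] algebra_simps)
    qed
    have "(\<Sum>j\<in>J. \<beta> j * c j l) = 0" if "l \<in> insert i I" for l
      using that \<alpha>(2) j0(2) unfolding \<beta> by auto
    moreover have "\<exists>j\<in>J. \<beta> j \<noteq> 0"
      using \<alpha>(1) by (auto simp: \<beta>_def)
    ultimately show ?thesis by blast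
  qed
qed

context rectangle begin

section \<open>The bilinear forms\<close>

abbreviation gp :: "(plane \<Rightarrow> real) \<Rightarrow> (plane \<Rightarrow> real) \<Rightarrow> real" where
  "gp u v \<equiv> ip \<Omega> (grad \<Omega> u) (grad \<Omega> v)"

abbreviation lp :: "(plane \<Rightarrow> real) \<Rightarrow> (plane \<Rightarrow> real) \<Rightarrow> real" where
  "lp u v \<equiv> ip \<Omega> (lap \<Omega> u) (lap \<Omega> v)"

lemma ip_wpd_add:
  assumes "has_wpd e u" "has_wpd e v" "w \<in> L2 \<Omega>"
  shows "ip \<Omega> (wpd \<Omega> e (\<lambda>p. u p + v p)) w = ip \<Omega> (wpd \<Omega> e u) w + ip \<Omega> (wpd \<Omega> e v) w"
proof -
  have "ip \<Omega> (wpd \<Omega> e (\<lambda>p. u p + v p)) w = ip \<Omega> (\<lambda>p. wpd \<Omega> e u p + wpd \<Omega> e v p) w"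
    by (rule ip_cong_AE_L2[OF wpd_add[OF assms(1,2)] AE_I2 L2_add[OF has_wpd_L2(1)[OF assms(1)] has_wpd_L2(1)[OF assms(2)]] assms(3)]) simp
  then show ?thesis
    using ip_add_left[OF has_wpd_L2(1)[OF assms(1)] has_wpd_L2(1)[OF assms(2)] assms(3)] by simp
qed

lemma ip_wpd_scale:
  assumes "has_wpd e u" "w \<in> L2 \<Omega>"
  shows "ip \<Omega> (wpd \<Omega> e (\<lambda>p. c * u p)) w = c * ip \<Omega> (wpd \<Omega> e u) w"
proof -
  have "ip \<Omega> (wpd \<Omega> e (\<lambda>p. c * u p)) w = ip \<Omega> (\<lambda>p. c * wpd \<Omega> e u p) w"
    by (rule ip_cong_AE_L2[OF wpd_scale[OF assms(1)] AE_I2 L2_scale[OF has_wpd_L2(1)[OF assms(1)]] assms(2)]) simp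
  then show ?thesis by (simp add: ip_scale_left)
qed

lemma gp_add:
  assumes "u \<in> H1 \<Omega>" "v \<in> H1 \<Omega>" "w \<in> H1 \<Omega>"
  shows "gp (\<lambda>p. u p + v p) w = gp u w + gp v w"
  unfolding ip_grad[OF H1_add[OF assms(1,2)] assms(3)] ip_grad[OF assms(1,3)] ip_grad[OF assms(2,3)]
  using assms ip_wpd_add[of "(1,0)" u v "dx \<Omega> w"] ip_wpd_add[of "(0,1)" u v "dy \<Omega> w"]
  by (simp add: H1_iff has_wpd_L2)

lemma gp_scale:
  assumes "u \<in> H1 \<Omega>" "w \<in> H1 \<Omega>"
  shows "gp (\<lambda>p. c * u p) w = c * gp u w"
  unfolding ip_grad[OF H1_scale[OF assms(1)] assms(2)] ip_grad[OF assms]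
  using assms ip_wpd_scale[of "(1,0)" u "dx \<Omega> w" c] ip_wpd_scale[of "(0,1)" u "dy \<Omega> w" c]
  by (simp add: H1_iff has_wpd_L2 distrib_left)

lemma gp_add_right:
  assumes "u \<in> H1 \<Omega>" "v \<in> H1 \<Omega>" "w \<in> H1 \<Omega>"
  shows "gp w (\<lambda>p. u p + v p) = gp w u + gp w v"
  using gp_add[OF assms] ip_commute[of \<Omega> "grad \<Omega> w"] by metis

lemma gp_scale_right:
  assumes "u \<in> H1 \<Omega>" "w \<in> H1 \<Omega>"
  shows "gp w (\<lambda>p. c * u p) = c * gp w u"
  using gp_scale[OF assms] ip_commute[of \<Omega> "grad \<Omega> w"] by metis

lemma gp_diff:
  assumes "u \<in> H1 \<Omega>" "v \<in> H1 \<Omega>" "w \<in> H1 \<Omega>"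
  shows "gp (\<lambda>p. u p - v p) w = gp u w - gp v w"
  using gp_add[OF assms(1) H1_scale[OF assms(2), of "-1"] assms(3)] gp_scale[OF assms(2,3), of "-1"] by simp

lemma gp_Cauchy_Schwarz:
  assumes "u \<in> H1 \<Omega>" "v \<in> H1 \<Omega>"
  shows "\<bar>gp u v\<bar> \<le> nrm \<Omega> (grad \<Omega> u) * nrm \<Omega> (grad \<Omega> v)"
proof -
  have "0 \<le> gp u u + t * (2 * gp u v) + t\<^sup>2 * gp v v" for t
  proof -
    let ?w = "\<lambda>p. u p + t * v p"
    have tv: "(\<lambda>p. t * v p) \<in> H1 \<Omega>" using assms(2) by (rule H1_scale)
    have w: "?w \<in> H1 \<Omega>" using assms(1) tv by (rule H1_add)
    have "gp ?w ?w = gp u ?w + t * gp v ?w"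
      using gp_add[OF assms(1) tv w] gp_scale[OF assms(2) w, of t] by simp
    also have "gp u ?w = gp u u + t * gp u v"
      using gp_add_right[OF assms(1) tv assms(1)] gp_scale_right[OF assms(2,1), of t] by simp
    also have "gp v ?w = gp u v + t * gp v v"
      using gp_add_right[OF assms(1) tv assms(2)] gp_scale_right[OF assms(2,2), of t] ip_commute[of \<Omega> "grad \<Omega> v" "grad \<Omega> u"] by simp
    finally show ?thesis
      using ip_self_nonneg[of \<Omega> "grad \<Omega> ?w"] by (simp add: algebra_simps power2_eq_square)
  qed
  then have "(gp u v)\<^sup>2 \<le> gp u u * gp v v"
    using ip_self_nonneg by (rule discriminant_le)
  then have "sqrt ((gp u v)\<^sup>2) \<le> sqrt (gp u u * gp v v)" by (rule real_sqrt_le_mono)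
  then show ?thesis by (simp add: nrm_def real_sqrt_mult)
qed

lemma lp_add:
  assumes "u \<in> H2 \<Omega>" "v \<in> H2 \<Omega>" "w \<in> H2 \<Omega>"
  shows "lp (\<lambda>p. u p + v p) w = lp u w + lp v w"
proof -
  have "lp (\<lambda>p. u p + v p) w = ip \<Omega> (\<lambda>p. lap \<Omega> u p + lap \<Omega> v p) (lap \<Omega> w)"
    by (rule ip_cong_AE_L2[OF lap_add[OF assms(1,2)] AE_I2 L2_add[OF lap_L2[OF assms(1)] lap_L2[OF assms(2)]] lap_L2[OF assms(3)]]) simp
  then show ?thesis by (simp add: ip_add_left lap_L2 assms)
qed

lemma lp_scale:
  assumes "u \<in> H2 \<Omega>" "w \<in> H2 \<Omega>"
  shows "lp (\<lambda>p. c * u p) w = c * lp u w"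
proof -
  have "lp (\<lambda>p. c * u p) w = ip \<Omega> (\<lambda>p. c * lap \<Omega> u p) (lap \<Omega> w)"
    by (rule ip_cong_AE_L2[OF lap_scale[OF assms(1)] AE_I2 L2_scale[OF lap_L2[OF assms(1)]] lap_L2[OF assms(2)]]) simp
  then show ?thesis by (simp add: ip_scale_left)
qed

lemma nrm_square_add_le:
  assumes "f \<in> L2 \<Omega>" "g \<in> L2 \<Omega>"
  shows "(nrm \<Omega> (\<lambda>p. f p + g p :: real))\<^sup>2 \<le> 2 * (nrm \<Omega> f)\<^sup>2 + 2 * (nrm \<Omega> g)\<^sup>2"
proof -
  have "(nrm \<Omega> (\<lambda>p. f p + g p))\<^sup>2 \<le> (nrm \<Omega> f + nrm \<Omega> g)\<^sup>2"
    by (intro power_mono nrm_triangle assms) simp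
  also have "\<dots> \<le> 2 * (nrm \<Omega> f)\<^sup>2 + 2 * (nrm \<Omega> g)\<^sup>2"
    using sum_squares_bound[of "nrm \<Omega> f" "nrm \<Omega> g"] by (simp add: power2_sum)
  finally show ?thesis .
qed

lemma nrm_lap_add_le:
  assumes "u \<in> H2 \<Omega>" "v \<in> H2 \<Omega>"
  shows "(nrm \<Omega> (lap \<Omega> (\<lambda>p. u p + v p)))\<^sup>2 \<le> 2 * (nrm \<Omega> (lap \<Omega> u))\<^sup>2 + 2 * (nrm \<Omega> (lap \<Omega> v))\<^sup>2"
  using nrm_cong_AE'[OF lap_add[OF assms] L2_add[OF lap_L2[OF assms(1)] lap_L2[OF assms(2)]]]
    nrm_square_add_le[OF lap_L2[OF assms(1)] lap_L2[OF assms(2)]] by simp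

lemma nrm_lap_minus:
  assumes "u \<in> H2 \<Omega>"
  shows "nrm \<Omega> (lap \<Omega> (\<lambda>p. - u p)) = nrm \<Omega> (lap \<Omega> u)"
  using nrm_cong_AE'[OF lap_scale[OF assms, of "-1"] L2_scale[OF lap_L2[OF assms]]] nrm_scale[of \<Omega> "-1" "lap \<Omega> u"] by simp

lemma nrm_lap_diff_le:
  assumes "u \<in> H2 \<Omega>" "v \<in> H2 \<Omega>"
  shows "(nrm \<Omega> (lap \<Omega> (\<lambda>p. u p - v p)))\<^sup>2 \<le> 2 * (nrm \<Omega> (lap \<Omega> u))\<^sup>2 + 2 * (nrm \<Omega> (lap \<Omega> v))\<^sup>2"
  using nrm_lap_add_le[OF assms(1) H2_scale[OF assms(2), of "-1"]] nrm_lap_minus[OF assms(2)] by simp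

lemma nrm_grad_add_le:
  assumes "u \<in> H1 \<Omega>" "v \<in> H1 \<Omega>"
  shows "(nrm \<Omega> (grad \<Omega> (\<lambda>p. u p + v p)))\<^sup>2 \<le> 2 * (nrm \<Omega> (grad \<Omega> u))\<^sup>2 + 2 * (nrm \<Omega> (grad \<Omega> v))\<^sup>2"
proof -
  have s: "(\<lambda>p. u p + v p) \<in> H1 \<Omega>" using assms by (rule H1_add)
  have "gp (\<lambda>p. u p + v p) (\<lambda>p. u p + v p) = gp u u + 2 * gp u v + gp v v"
    using gp_add[OF assms s] gp_add_right[OF assms assms(1)] gp_add_right[OF assms assms(2)] ip_commute[of \<Omega> "grad \<Omega> v" "grad \<Omega> u"]
    by simp
  moreover have "2 * gp u v \<le> (nrm \<Omega> (grad \<Omega> u))\<^sup>2 + (nrm \<Omega> (grad \<Omega> v))\<^sup>2"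
    using gp_Cauchy_Schwarz[OF assms] sum_squares_bound[of "nrm \<Omega> (grad \<Omega> u)" "nrm \<Omega> (grad \<Omega> v)"] by linarith
  ultimately show ?thesis by (simp add: nrm_sq)
qed

lemma nrm_grad_diff_le:
  assumes "u \<in> H1 \<Omega>" "v \<in> H1 \<Omega>"
  shows "(nrm \<Omega> (grad \<Omega> (\<lambda>p. u p - v p)))\<^sup>2 \<le> 2 * (nrm \<Omega> (grad \<Omega> u))\<^sup>2 + 2 * (nrm \<Omega> (grad \<Omega> v))\<^sup>2"
  using nrm_grad_add_le[OF assms(1) H1_scale[OF assms(2), of "-1"]] nrm_grad_scale[OF assms(2), of "-1"] by simp

section \<open>Orthonormal bases of finite element spaces\<close>

definition orthonormal :: "nat \<Rightarrow> (nat \<Rightarrow> plane \<Rightarrow> real) \<Rightarrow> bool" where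
  "orthonormal m \<phi> \<longleftrightarrow> (\<forall>i<m. \<forall>j<m. gp (\<phi> i) (\<phi> j) = (if i = j then 1 else 0))"

lemma H1_zero: "(\<lambda>p. 0) \<in> H1 \<Omega>"
  by (rule H1_smooth[OF smooth_const])

lemma gp_sum:
  fixes m :: nat
  assumes X: "fun_space X" "X \<subseteq> H1 \<Omega>" and \<phi>: "\<And>j. j < m \<Longrightarrow> \<phi> j \<in> X" and v: "v \<in> H1 \<Omega>"
  shows "gp (\<lambda>p. \<Sum>j<m. c j * \<phi> j p) v = (\<Sum>j<m. c j * gp (\<phi> j) v)"
proof (rule fun_space_linear_sum[OF X(1), of "{..<m}" \<phi> "\<lambda>u. gp u v" c, THEN conjunct2])
  show "\<phi> j \<in> X" if "j \<in> {..<m}" for j using \<phi> that by simp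
  show "gp (\<lambda>p. u p + w p) v = gp u v + gp w v" if "u \<in> X" "w \<in> X" for u w
    using that X(2) v by (intro gp_add) auto
  show "gp (\<lambda>p. c * u p) v = c * gp u v" if "u \<in> X" for u c
    using that X(2) v by (intro gp_scale) auto
qed simp

lemma fe_space_fun_space: "fe_space a b h X \<Longrightarrow> fun_space X"
  by (simp add: fe_space_def fun_space_def)

lemma fe_space_subset: "fe_space a b h X \<Longrightarrow> X \<subseteq> H20 a b"
  by (simp add: fe_space_def)

text \<open>A function in \<open>X\<close> is described on the rectangle by finitely many polynomial
  coefficients, one for each triangle and pair of exponents. More orthonormal functions than
  coefficients would have a nontrivial combination with all coefficients zero, hence vanishing on
  the rectangle, which orthonormality forbids.\<close>

lemma fe_space_dimension_bound:
  assumes X: "fe_space a b h X"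
  shows "\<exists>N. \<forall>m \<phi>. (\<forall>j<m. \<phi> j \<in> X) \<longrightarrow> orthonormal m \<phi> \<longrightarrow> m \<le> N"
proof -
  note fs = fe_space_fun_space[OF X]
  have XH: "X \<subseteq> H1 \<Omega>" using fe_space_subset[OF X] H20_H1 by blast
  have "\<exists>\<T>. triangulation \<T> \<and> (\<forall>K\<in>\<T>. 2 simplex K) \<and> \<Union>\<T> = cbox a b \<and> h = Max (diameter ` \<T>) \<and>
        (\<exists>k. \<forall>v\<in>X. \<forall>K\<in>\<T>. \<exists>q. poly2 k q \<and> (\<forall>p\<in>K. v p = q p))"
    using X unfolding fe_space_def by (elim conjE)
  then obtain \<T> k where T: "triangulation \<T>" "\<Union>\<T> = cbox a b"
    and poly': "\<forall>v\<in>X. \<forall>K\<in>\<T>. \<exists>q. poly2 k q \<and> (\<forall>p\<in>K. v p = q p)"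
    by (elim exE conjE) (rule that)
  have poly: "\<exists>q. poly2 k q \<and> (\<forall>p\<in>K. v p = q p)" if "v \<in> X" "K \<in> \<T>" for v K
    by (rule bspec[OF bspec[OF poly' that(1)] that(2)])
  have fin: "finite \<T>" using T(1) by (simp add: triangulation_def)
  have "\<exists>C. \<forall>x y. (x, y) \<in> K \<longrightarrow> v (x, y) = (\<Sum>i\<le>k. \<Sum>l\<le>k - i. C i l * x ^ i * y ^ l)" if vK: "v \<in> X" "K \<in> \<T>" for v K
  proof -
    obtain q c where "\<forall>x y. q (x, y) = (\<Sum>i\<le>k. \<Sum>j\<le>k - i. c i j * x ^ i * y ^ j)" "\<forall>p\<in>K. v p = q p"
      using poly[OF vK] unfolding poly2_def by (elim exE conjE) (rule that)
    then show ?thesis by (intro exI[of _ c]) auto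
  qed
  \<comment> \<open>The coefficients are merely chosen, with no linearity in \<open>v\<close>. This
    suffices, because the combination is formed from the chosen coefficients of the functions
    \<open>\<phi> j\<close> themselves.\<close>
  then have "\<forall>v K. \<exists>C. v \<in> X \<longrightarrow> K \<in> \<T> \<longrightarrow> (\<forall>x y. (x, y) \<in> K \<longrightarrow> v (x, y) = (\<Sum>i\<le>k. \<Sum>l\<le>k - i. C i l * x ^ i * y ^ l))"
    by blast
  from this[unfolded choice_iff] obtain C where C: "\<And>v K x y. v \<in> X \<Longrightarrow> K \<in> \<T> \<Longrightarrow> (x, y) \<in> K \<Longrightarrow>
      v (x, y) = (\<Sum>i\<le>k. \<Sum>l\<le>k - i. C v K i l * x ^ i * y ^ l)"
    by blast
  define I where "I = \<T> \<times> {..k} \<times> {..k}"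
  have "finite I" unfolding I_def using fin by simp
  have "m \<le> card I" if \<phi>: "\<forall>j<m. \<phi> j \<in> X" and on: "orthonormal m \<phi>" for m \<phi>
  proof (rule ccontr)
    assume "\<not> m \<le> card I"
    then have "card I < card {..<m}" by simp
    from underdetermined_system[OF \<open>finite I\<close> _ this, of "\<lambda>j (K, i, l). C (\<phi> j) K i l"]
    obtain \<alpha> where \<alpha>0: "\<exists>j\<in>{..<m}. \<alpha> j \<noteq> 0"
      and \<alpha>': "\<forall>x\<in>I. (\<Sum>j<m. \<alpha> j * (case x of (K, i, l) \<Rightarrow> C (\<phi> j) K i l)) = 0"
      by blast
    have \<alpha>: "(\<Sum>j<m. \<alpha> j * C (\<phi> j) K i l) = 0" if "(K, i, l) \<in> I" for K i l
      using bspec[OF \<alpha>' that] by simp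
    let ?z = "\<lambda>p. \<Sum>j<m. \<alpha> j * \<phi> j p"
    have z0: "?z (x, y) = 0" if "(x, y) \<in> cbox a b" for x y
    proof -
      obtain K where K: "K \<in> \<T>" "(x, y) \<in> K" using \<open>(x, y) \<in> cbox a b\<close> T(2) by blast
      have "?z (x, y) = (\<Sum>j<m. \<Sum>i\<le>k. \<Sum>l\<le>k - i. \<alpha> j * C (\<phi> j) K i l * (x ^ i * y ^ l))"
      proof (rule sum.cong[OF refl])
        fix j assume "j \<in> {..<m}"
        then have "\<phi> j \<in> X" using \<phi> by simp
        show "\<alpha> j * \<phi> j (x, y) = (\<Sum>i\<le>k. \<Sum>l\<le>k - i. \<alpha> j * C (\<phi> j) K i l * (x ^ i * y ^ l))"
          unfolding C[OF \<open>\<phi> j \<in> X\<close> K] by (simp add: sum_distrib_left mult.assoc)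
      qed
      also have "\<dots> = (\<Sum>i\<le>k. \<Sum>j<m. \<Sum>l\<le>k - i. \<alpha> j * C (\<phi> j) K i l * (x ^ i * y ^ l))"
        by (rule sum.swap)
      also have "\<dots> = (\<Sum>i\<le>k. \<Sum>l\<le>k - i. \<Sum>j<m. \<alpha> j * C (\<phi> j) K i l * (x ^ i * y ^ l))"
        by (intro sum.cong refl sum.swap)
      also have "\<dots> = (\<Sum>i\<le>k. \<Sum>l\<le>k - i. (\<Sum>j<m. \<alpha> j * C (\<phi> j) K i l) * (x ^ i * y ^ l))"
        by (simp add: sum_distrib_right)
      also have "\<dots> = 0"
        using K(1) by (intro sum.neutral ballI) (auto simp: \<alpha> I_def)
      finally show ?thesis .
    qed
    have "AE p in lebesgue_on \<Omega>. ?z p = 0"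
    proof (rule AE_I2)
      fix p assume "p \<in> space (lebesgue_on \<Omega>)"
      then have "p \<in> cbox a b" using box_subset_cbox[of a b] by auto
      then show "?z p = 0" using z0[of "fst p" "snd p"] by simp
    qed
    from grad_cong[OF this] have "gp ?z v = gp (\<lambda>p. 0) v" for v by simp
    moreover have "gp (\<lambda>p. 0) v = 0" if "v \<in> H1 \<Omega>" for v
      using gp_scale[OF H1_zero that, of 0] by simp
    ultimately have "(\<Sum>j<m. \<alpha> j * gp (\<phi> j) (\<phi> i)) = 0" if "i < m" for i
      using gp_sum[OF fs XH, of m \<phi> "\<phi> i" \<alpha>] \<phi> that XH by auto
    moreover have "(\<Sum>j<m. \<alpha> j * gp (\<phi> j) (\<phi> i)) = \<alpha> i" if "i < m" for i
    proof -
      have "(\<Sum>j<m. \<alpha> j * gp (\<phi> j) (\<phi> i)) = (\<Sum>j<m. if j = i then \<alpha> j else 0)"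
        using on that by (intro sum.cong) (auto simp: orthonormal_def)
      then show ?thesis using that by simp
    qed
    ultimately show False using \<alpha>0 by auto
  qed
  then show ?thesis by blast
qed

text \<open>By \<open>Poincare\<close> the x-derivative controls the function. So \<open>gp\<close>
  is definite modulo null sets on \<open>H10\<close>, which is what an orthonormal basis
  needs.\<close>

lemma grad_zero_imp_zero:
  assumes v: "v \<in> H10 a b" and 0: "gp v v = 0"
  shows "AE p in lebesgue_on \<Omega>. v p = 0"
proof -
  have v1: "v \<in> H1 \<Omega>" using v by (simp add: H10_def)
  have "(nrm \<Omega> (dx \<Omega> v))\<^sup>2 + (nrm \<Omega> (dy \<Omega> v))\<^sup>2 = 0"
    using nrm_grad[OF v1] 0 by (simp add: nrm_sq)
  then have "nrm \<Omega> (dx \<Omega> v) = 0" by (simp add: sum_power2_eq_zero_iff)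
  then have "nrm \<Omega> v = 0" using Poincare[OF v] nrm_nonneg[of \<Omega> v] by simp
  then show ?thesis using nrm_zero_iff[OF H1_L2(1)[OF v1]] by simp
qed

text \<open>A largest orthonormal family exists by the dimension bound; if some \<open>v\<close>
  differed from its expansion, the normalised remainder could be appended. The product
  \<open>gp\<close> is used because the weak equations give absolute continuity of exactly the
  coefficients \<open>gp v (\<phi> j)\<close>.\<close>

lemma fe_space_orthonormal_basis:
  assumes X: "fe_space a b h X"
  obtains m \<phi> where "\<And>j. j < m \<Longrightarrow> \<phi> j \<in> X" "orthonormal m \<phi>"
    "\<And>v. v \<in> X \<Longrightarrow> AE p in lebesgue_on \<Omega>. v p = (\<Sum>j<m. gp v (\<phi> j) * \<phi> j p)"
proof -
  note fs = fe_space_fun_space[OF X]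
  have XH: "X \<subseteq> H1 \<Omega>" using fe_space_subset[OF X] H20_H1 by blast
  define P where "P m \<longleftrightarrow> (\<exists>\<phi>. (\<forall>j<m. \<phi> j \<in> X) \<and> orthonormal m \<phi>)" for m
  obtain N where N: "\<And>m. P m \<Longrightarrow> m \<le> N"
    using fe_space_dimension_bound[OF X] unfolding P_def by blast
  have "P 0" by (simp add: P_def orthonormal_def)
  then have "P (GREATEST m. P m)" and greatest: "\<And>m. P m \<Longrightarrow> m \<le> (GREATEST m. P m)"
    using GreatestI_nat[of P 0 N] Greatest_le_nat[of P _ N] N by blast+
  then obtain m \<phi> where m: "m = (GREATEST m. P m)" and \<phi>: "\<And>j. j < m \<Longrightarrow> \<phi> j \<in> X" and on: "orthonormal m \<phi>"
    unfolding P_def by blast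
  have "AE p in lebesgue_on \<Omega>. v p = (\<Sum>j<m. gp v (\<phi> j) * \<phi> j p)" if v: "v \<in> X" for v
  proof -
    let ?s = "\<lambda>p. \<Sum>j<m. gp v (\<phi> j) * \<phi> j p"
    let ?z = "\<lambda>p. v p - ?s p"
    have s: "?s \<in> X" using \<phi> by (intro fun_space_sum[OF fs]) auto
    have z: "?z \<in> X" using fun_space_diff[OF fs v s] .
    have z\<phi>: "gp ?z (\<phi> i) = 0" if i: "i < m" for i
    proof -
      have "gp ?s (\<phi> i) = (\<Sum>j<m. gp v (\<phi> j) * gp (\<phi> j) (\<phi> i))"
        by (rule gp_sum[OF fs XH \<phi>]) (use \<phi>[OF i] XH in auto)
      also have "\<dots> = (\<Sum>j<m. if j = i then gp v (\<phi> j) else 0)"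
        using on i by (intro sum.cong) (auto simp: orthonormal_def)
      also have "\<dots> = gp v (\<phi> i)" using i by simp
      finally show ?thesis
        using gp_diff[OF subsetD[OF XH v] subsetD[OF XH s] subsetD[OF XH \<phi>[OF i]]] by simp
    qed
    have "gp ?z ?z = 0"
    proof (rule ccontr)
      assume "gp ?z ?z \<noteq> 0"
      then have pos: "gp ?z ?z > 0" using ip_self_nonneg[of \<Omega> "grad \<Omega> ?z"] by simp
      define c where "c = 1 / sqrt (gp ?z ?z)"
      define \<phi>' where "\<phi>' = \<phi>(m := (\<lambda>p. c * ?z p))"
      have cz: "(\<lambda>p. c * ?z p) \<in> X" using fun_space_scale[OF fs z] .
      have H: "?z \<in> H1 \<Omega>" "(\<lambda>p. c * ?z p) \<in> H1 \<Omega>" and H\<phi>: "\<And>i. i < m \<Longrightarrow> \<phi> i \<in> H1 \<Omega>" using z cz \<phi> XH by blast+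
      have "gp (\<lambda>p. c * ?z p) (\<lambda>p. c * ?z p) = c * (c * gp ?z ?z)"
        unfolding gp_scale[OF H(1) H(2)] gp_scale_right[OF H(1) H(1)] ..
      also have "\<dots> = 1" using pos by (simp add: c_def)
      finally have 1: "gp (\<lambda>p. c * ?z p) (\<lambda>p. c * ?z p) = 1" .
      have 2: "gp (\<lambda>p. c * ?z p) (\<phi> i) = 0" "gp (\<phi> i) (\<lambda>p. c * ?z p) = 0" if "i < m" for i
        unfolding gp_scale[OF H(1) H\<phi>[OF that]] gp_scale_right[OF H(1) H\<phi>[OF that]]
          ip_commute[of \<Omega> "grad \<Omega> (\<phi> i)" "grad \<Omega> ?z"] z\<phi>[OF that] by simp_all
      have "orthonormal (Suc m) \<phi>'"
        using on 1 2 unfolding orthonormal_def \<phi>'_def by (auto simp: less_Suc_eq)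
      moreover have "\<forall>j<Suc m. \<phi>' j \<in> X" using \<phi> cz by (auto simp: \<phi>'_def less_Suc_eq)
      ultimately have "P (Suc m)" unfolding P_def by blast
      then show False using greatest m by fastforce
    qed
    moreover have "?z \<in> H10 a b" using z fe_space_subset[OF X] H20_subset_H10 by blast
    ultimately have "AE p in lebesgue_on \<Omega>. ?z p = 0" by (intro grad_zero_imp_zero)
    then show ?thesis by simp
  qed
  with \<phi> on show ?thesis by (rule that)
qed

end

section \<open>The energy inequality\<close>

lemma Young: "0 < \<delta> \<Longrightarrow> 2 * (x * y) \<le> \<delta> * y\<^sup>2 + x\<^sup>2 / (\<delta>::real)"
proof -
  assume d: "0 < \<delta>"
  have "0 \<le> (sqrt \<delta> * y - x / sqrt \<delta>)\<^sup>2" by simp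
  also have "\<dots> = \<delta> * y\<^sup>2 + x\<^sup>2 / \<delta> - 2 * (x * y)"
    using d by (simp add: power2_diff power_mult_distrib power_divide)
  finally show ?thesis by simp
qed

lemma square_add_le: "(x + y)\<^sup>2 \<le> 2 * x\<^sup>2 + 2 * (y::real)\<^sup>2"
  using sum_squares_bound[of x y] by (simp add: power2_sum)

lemma power4_add_le: "(x + y)^4 \<le> 8 * (x^4 + (y::real)^4)"
proof -
  have "(x + y)^4 = ((x + y)\<^sup>2)\<^sup>2" by simp
  also have "\<dots> \<le> (2 * x\<^sup>2 + 2 * y\<^sup>2)\<^sup>2" by (rule power_mono[OF square_add_le]) simp
  also have "\<dots> \<le> 2 * (2 * x\<^sup>2)\<^sup>2 + 2 * (2 * y\<^sup>2)\<^sup>2" by (rule square_add_le)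
  also have "\<dots> = 8 * (x^4 + y^4)" by (simp add: power_mult_distrib)
  finally show ?thesis .
qed

text \<open>The letters stand for the norms in \<open>residual_le\<close>. Of the dissipation 2
  \<nu> D^2 one half is spent: \<nu>/4 on the viscous term, \<nu>/4 on the trilinear terms linear in
  \<theta>, \<nu>/2 on those with D^(3/2) g^(1/2). The last ones need Young's inequality twice,
  which raises A + E to the fourth power; 128 is 16 from there times 8 from
  \<open>power4_add_le\<close>.\<close>

lemma energy_Young:
  fixes A E D g h S \<nu> \<rho> P \<Gamma> \<Gamma>\<^sub>0 \<Gamma>\<^sub>3 :: real
  assumes nonneg: "0 \<le> A" "0 \<le> E" "0 \<le> D" "0 \<le> g" "0 \<le> h" and \<nu>: "0 < \<nu>"
    and c: "0 \<le> \<rho>" "0 \<le> P" "0 \<le> \<Gamma>\<^sub>0"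
    and S: "S \<le> h * g + \<nu> * (E * D) - \<nu> * D\<^sup>2 + \<Gamma> * (2 * (A * E) + E\<^sup>2) * D + \<Gamma>\<^sub>3 * (A + E) * (sqrt g * sqrt D) * D
      + \<rho> * \<Gamma>\<^sub>0 * P * (E * g) + \<rho> * P * g\<^sup>2"
  shows "2 * S \<le> (1 + \<rho> * \<Gamma>\<^sub>0 * P + 2 * (\<rho> * P) + 128 * \<Gamma>\<^sub>3^4 / \<nu>^3 * (A^4 + E^4)) * g\<^sup>2
     + (h\<^sup>2 + (4 * \<nu> + \<rho> * \<Gamma>\<^sub>0 * P) * E\<^sup>2 + 4 * \<Gamma>\<^sup>2 / \<nu> * (8 * (A\<^sup>2 * E\<^sup>2) + 2 * E^4)) - \<nu> * D\<^sup>2"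
proof -
  have 1: "2 * (h * g) \<le> h\<^sup>2 + g\<^sup>2" using Young[of 1 h g] by simp
  have 2: "2 * (\<nu> * (E * D)) \<le> \<nu> / 4 * D\<^sup>2 + 4 * \<nu> * E\<^sup>2"
    using Young[of "\<nu> / 4" "\<nu> * E" D] \<nu> by (simp add: power_mult_distrib power2_eq_square mult_ac)
  define B where "B = \<Gamma> * (2 * (A * E) + E\<^sup>2)"
  have B: "B\<^sup>2 \<le> \<Gamma>\<^sup>2 * (8 * (A\<^sup>2 * E\<^sup>2) + 2 * E^4)"
  proof -
    have "(2 * (A * E) + E\<^sup>2)\<^sup>2 \<le> 2 * (2 * (A * E))\<^sup>2 + 2 * (E\<^sup>2)\<^sup>2" by (rule square_add_le)
    also have "\<dots> = 8 * (A\<^sup>2 * E\<^sup>2) + 2 * E^4" by (simp add: power_mult_distrib)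
    finally show ?thesis unfolding B_def power_mult_distrib by (intro mult_left_mono) auto
  qed
  have 3: "2 * (B * D) \<le> \<nu> / 4 * D\<^sup>2 + 4 * \<Gamma>\<^sup>2 / \<nu> * (8 * (A\<^sup>2 * E\<^sup>2) + 2 * E^4)"
  proof -
    have "2 * (B * D) \<le> \<nu> / 4 * D\<^sup>2 + B\<^sup>2 / (\<nu> / 4)" using \<nu> by (intro Young) simp
    also have "B\<^sup>2 / (\<nu> / 4) \<le> (\<Gamma>\<^sup>2 * (8 * (A\<^sup>2 * E\<^sup>2) + 2 * E^4)) / (\<nu> / 4)"
      using B \<nu> by (intro divide_right_mono) auto
    finally show ?thesis by (simp add: mult_ac)
  qed
  define Q where "Q = \<Gamma>\<^sub>3 * (A + E)"
  define s where "s = sqrt g * sqrt D"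
  have s: "s\<^sup>2 = g * D" using nonneg by (simp add: s_def power_mult_distrib)
  have 4: "2 * (Q * s * D) \<le> \<nu> / 2 * D\<^sup>2 + 128 * \<Gamma>\<^sub>3^4 / \<nu>^3 * (A^4 + E^4) * g\<^sup>2"
  proof -
    have "2 * (Q * s * D) \<le> \<nu> / 4 * D\<^sup>2 + (Q * s)\<^sup>2 / (\<nu> / 4)" using \<nu> by (intro Young) simp
    also have "(Q * s)\<^sup>2 / (\<nu> / 4) = 2 * ((2 * Q\<^sup>2 * g / \<nu>) * D)" by (simp add: power_mult_distrib s mult_ac)
    also have "\<dots> \<le> \<nu> / 4 * D\<^sup>2 + (2 * Q\<^sup>2 * g / \<nu>)\<^sup>2 / (\<nu> / 4)" using \<nu> by (intro Young) simp
    also have "(2 * Q\<^sup>2 * g / \<nu>)\<^sup>2 / (\<nu> / 4) = 16 / \<nu>^3 * Q^4 * g\<^sup>2"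
      using \<nu> by (simp add: power_mult_distrib power_divide power2_eq_square power3_eq_cube field_simps eval_nat_numeral)
    also have "\<dots> \<le> 16 / \<nu>^3 * (\<Gamma>\<^sub>3^4 * (8 * (A^4 + E^4))) * g\<^sup>2"
      unfolding Q_def power_mult_distrib using \<nu>
      by (intro mult_right_mono mult_left_mono power4_add_le) auto
    finally show ?thesis by (simp add: mult_ac)
  qed
  have 5: "2 * (\<rho> * \<Gamma>\<^sub>0 * P * (E * g)) \<le> \<rho> * \<Gamma>\<^sub>0 * P * (E\<^sup>2 + g\<^sup>2)"
  proof -
    have "2 * (E * g) \<le> E\<^sup>2 + g\<^sup>2" using Young[of 1 E g] by simp
    then have "\<rho> * \<Gamma>\<^sub>0 * P * (2 * (E * g)) \<le> \<rho> * \<Gamma>\<^sub>0 * P * (E\<^sup>2 + g\<^sup>2)" using c by (intro mult_left_mono) auto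
    then show ?thesis by simp
  qed
  have "2 * S \<le> 2 * (h * g) + 2 * (\<nu> * (E * D)) - 2 * (\<nu> * D\<^sup>2) + 2 * (B * D) + 2 * (Q * s * D)
     + 2 * (\<rho> * \<Gamma>\<^sub>0 * P * (E * g)) + 2 * (\<rho> * P * g\<^sup>2)"
    using S unfolding B_def Q_def s_def by (simp add: algebra_simps)
  also have "\<dots> \<le> (h\<^sup>2 + g\<^sup>2) + (\<nu> / 4 * D\<^sup>2 + 4 * \<nu> * E\<^sup>2) - 2 * (\<nu> * D\<^sup>2) + (\<nu> / 4 * D\<^sup>2 + 4 * \<Gamma>\<^sup>2 / \<nu> * (8 * (A\<^sup>2 * E\<^sup>2) + 2 * E^4))
     + (\<nu> / 2 * D\<^sup>2 + 128 * \<Gamma>\<^sub>3^4 / \<nu>^3 * (A^4 + E^4) * g\<^sup>2) + \<rho> * \<Gamma>\<^sub>0 * P * (E\<^sup>2 + g\<^sup>2) + 2 * (\<rho> * P * g\<^sup>2)"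
    by (intro add_mono diff_mono 1 2 3 4 5 order_refl)
  also have "\<dots> = (1 + \<rho> * \<Gamma>\<^sub>0 * P + 2 * (\<rho> * P) + 128 * \<Gamma>\<^sub>3^4 / \<nu>^3 * (A^4 + E^4)) * g\<^sup>2
     + (h\<^sup>2 + (4 * \<nu> + \<rho> * \<Gamma>\<^sub>0 * P) * E\<^sup>2 + 4 * \<Gamma>\<^sup>2 / \<nu> * (8 * (A\<^sup>2 * E\<^sup>2) + 2 * E^4)) - \<nu> * D\<^sup>2"
    unfolding distrib_right distrib_left by simp
  finally show ?thesis .
qed

text \<open>The solution and the finite element space remain outside the locale, so the constants
  defined in it cannot depend on them.\<close>

locale flow = rectangle +
  fixes T Rey Ros \<Gamma>\<^sub>0 \<Gamma>\<^sub>3 :: real and F :: "real \<Rightarrow> (plane \<Rightarrow> real) \<Rightarrow> real"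
  assumes pos: "T > 0" "Rey > 0" "Ros > 0"
    and F: "AE t in time T. F t \<in> dual_H20 a b" "integrable (time T) (\<lambda>t. (dual_norm a b (F t))\<^sup>2)"
    and \<Gamma>_pos: "\<Gamma>\<^sub>0 > 0" "\<Gamma>\<^sub>3 > 0"
    and \<Gamma>\<^sub>0: "\<And>u. u \<in> H20 a b \<Longrightarrow> nrm \<Omega> (grad \<Omega> u) \<le> \<Gamma>\<^sub>0 * nrm \<Omega> (lap \<Omega> u)"
    and \<Gamma>\<^sub>3: "\<And>u v w. u \<in> H20 a b \<Longrightarrow> v \<in> H20 a b \<Longrightarrow> w \<in> H20 a b \<Longrightarrow>
              trilin \<Omega> u v w \<le> \<Gamma>\<^sub>3 * nrm \<Omega> (lap \<Omega> u) * nrm \<Omega> (lap \<Omega> v)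
                * sqrt (nrm \<Omega> (grad \<Omega> w)) * sqrt (nrm \<Omega> (lap \<Omega> w))"
begin

definition "\<nu> = inverse Rey"
definition "\<rho> = inverse Ros"
text \<open>The constant of \<open>Poincare\<close>.\<close>

definition "P = 2 * (fst b - fst a)"
text \<open>What \<open>\<Gamma>\<^sub>3\<close> becomes when the half power of the gradient norm is
  replaced by the Laplacian norm through \<open>\<Gamma>\<^sub>0\<close>.\<close>

definition "\<Gamma> = \<Gamma>\<^sub>3 * sqrt \<Gamma>\<^sub>0"

lemma const_pos: "\<nu> > 0" "\<rho> > 0" "P > 0" "\<Gamma> > 0"
  using pos ab \<Gamma>_pos by (auto simp: \<nu>_def \<rho>_def P_def \<Gamma>_def)

lemma trilin_scale3:
  assumes "\<xi> \<in> H20 a b" "\<psi> \<in> H20 a b" "\<phi> \<in> H20 a b"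
  shows "trilin \<Omega> \<xi> \<psi> (\<lambda>p. c * \<phi> p) = c * trilin \<Omega> \<xi> \<psi> \<phi>"
  using trilin_scale2[OF assms(1,3,2), of c] trilin_swap[of \<xi> \<psi> "\<lambda>p. c * \<phi> p"] trilin_swap[of \<xi> \<psi> \<phi>] by simp

lemma trilin_add3:
  assumes "\<xi> \<in> H20 a b" "\<psi> \<in> H20 a b" "\<phi> \<in> H20 a b" "\<phi>' \<in> H20 a b"
  shows "trilin \<Omega> \<xi> \<psi> (\<lambda>p. \<phi> p + \<phi>' p) = trilin \<Omega> \<xi> \<psi> \<phi> + trilin \<Omega> \<xi> \<psi> \<phi>'"
  using trilin_add2[OF assms(1,3,4,2)] trilin_swap[of \<xi> \<psi> "\<lambda>p. \<phi> p + \<phi>' p"] trilin_swap[of \<xi> \<psi> \<phi>] trilin_swap[of \<xi> \<psi> \<phi>'] by simp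

text \<open>The hypothesis on \<open>\<Gamma>\<^sub>3\<close> is one-sided; applying it to -w as
  well bounds the absolute value.\<close>

lemma trilin_abs_le:
  assumes "u \<in> H20 a b" "v \<in> H20 a b" "w \<in> H20 a b"
  shows "\<bar>trilin \<Omega> u v w\<bar> \<le> \<Gamma>\<^sub>3 * nrm \<Omega> (lap \<Omega> u) * nrm \<Omega> (lap \<Omega> v) * (sqrt (nrm \<Omega> (grad \<Omega> w)) * sqrt (nrm \<Omega> (lap \<Omega> w)))"
proof -
  have m: "(\<lambda>p. (-1) * w p) \<in> H20 a b" by (rule H20_scale[OF assms(3)])
  have "trilin \<Omega> u v (\<lambda>p. (-1) * w p) = - trilin \<Omega> u v w"
    using trilin_scale3[OF assms, of "-1"] by simp
  moreover have "nrm \<Omega> (lap \<Omega> (\<lambda>p. (-1) * w p)) = nrm \<Omega> (lap \<Omega> w)"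
    using nrm_lap_minus[OF H20_H2[OF assms(3)]] by simp
  moreover have "nrm \<Omega> (grad \<Omega> (\<lambda>p. (-1) * w p)) = nrm \<Omega> (grad \<Omega> w)"
    unfolding nrm_grad_scale[OF H20_H1[OF assms(3)]] by simp
  ultimately show ?thesis
    using \<Gamma>\<^sub>3[OF assms] \<Gamma>\<^sub>3[OF assms(1,2) m] by (simp add: abs_le_iff mult.assoc)
qed

lemma trilin_abs_le':
  assumes "u \<in> H20 a b" "v \<in> H20 a b" "w \<in> H20 a b"
  shows "\<bar>trilin \<Omega> u v w\<bar> \<le> \<Gamma> * (nrm \<Omega> (lap \<Omega> u) * nrm \<Omega> (lap \<Omega> v)) * nrm \<Omega> (lap \<Omega> w)"
proof -
  have "sqrt (nrm \<Omega> (grad \<Omega> w)) * sqrt (nrm \<Omega> (lap \<Omega> w)) \<le> sqrt (\<Gamma>\<^sub>0 * nrm \<Omega> (lap \<Omega> w)) * sqrt (nrm \<Omega> (lap \<Omega> w))"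
    by (intro mult_right_mono real_sqrt_le_mono \<Gamma>\<^sub>0 assms) simp
  also have "\<dots> = sqrt \<Gamma>\<^sub>0 * nrm \<Omega> (lap \<Omega> w)" by (simp add: real_sqrt_mult)
  finally have "\<Gamma>\<^sub>3 * nrm \<Omega> (lap \<Omega> u) * nrm \<Omega> (lap \<Omega> v) * (sqrt (nrm \<Omega> (grad \<Omega> w)) * sqrt (nrm \<Omega> (lap \<Omega> w)))
     \<le> \<Gamma>\<^sub>3 * nrm \<Omega> (lap \<Omega> u) * nrm \<Omega> (lap \<Omega> v) * (sqrt \<Gamma>\<^sub>0 * nrm \<Omega> (lap \<Omega> w))"
    using \<Gamma>_pos by (intro mult_left_mono) auto
  then show ?thesis using trilin_abs_le[OF assms] by (simp add: \<Gamma>_def mult_ac)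
qed

lemma nrm_dx_le_grad:
  assumes "u \<in> H1 \<Omega>"
  shows "nrm \<Omega> (dx \<Omega> u) \<le> nrm \<Omega> (grad \<Omega> u)"
  by (rule power2_le_imp_le) (simp_all add: nrm_grad[OF assms])

text \<open>Both factors are gradient norms: for u = w the rotation term then enters the Gronwall
  weight and uses up no dissipation.\<close>

lemma ip_dx_le:
  assumes "u \<in> H20 a b" "w \<in> H20 a b"
  shows "\<bar>ip \<Omega> (dx \<Omega> u) w\<bar> \<le> P * (nrm \<Omega> (grad \<Omega> u) * nrm \<Omega> (grad \<Omega> w))"
proof -
  have "\<bar>ip \<Omega> (dx \<Omega> u) w\<bar> \<le> nrm \<Omega> (dx \<Omega> u) * nrm \<Omega> w"
    by (intro ip_Cauchy_Schwarz H1_L2 H20_H1 assms)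
  also have "\<dots> \<le> nrm \<Omega> (grad \<Omega> u) * (P * nrm \<Omega> (grad \<Omega> w))"
  proof (rule mult_mono)
    show "nrm \<Omega> (dx \<Omega> u) \<le> nrm \<Omega> (grad \<Omega> u)" by (rule nrm_dx_le_grad[OF H20_H1[OF assms(1)]])
    have "nrm \<Omega> w \<le> P * nrm \<Omega> (dx \<Omega> w)"
      using Poincare[OF H20_subset_H10[OF assms(2)]] by (simp add: P_def)
    also have "\<dots> \<le> P * nrm \<Omega> (grad \<Omega> w)"
      using const_pos by (intro mult_left_mono nrm_dx_le_grad H20_H1 assms) auto
    finally show "nrm \<Omega> w \<le> P * nrm \<Omega> (grad \<Omega> w)" .
  qed auto
  finally show ?thesis by (simp add: mult_ac)
qed

text \<open>The time derivative of (\<nabla>(uh - \<mu>), \<nabla>\<theta>) for a fixed test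
  function \<theta>, written with uh - \<mu> = \<eta> - u + uh and with both weak equations
  inserted; the load F has cancelled. Linearity in \<theta> allows it to be evaluated through a
  basis.\<close>

definition residual :: "(plane \<Rightarrow> real) \<Rightarrow> (plane \<Rightarrow> real) \<Rightarrow> (plane \<Rightarrow> real) \<Rightarrow> (plane \<Rightarrow> real) \<Rightarrow> real" where
  "residual u uh \<eta>' \<theta> = gp \<eta>' \<theta> + \<nu> * (lp u \<theta> - lp uh \<theta>) + (trilin \<Omega> u u \<theta> - trilin \<Omega> uh uh \<theta>)
     - \<rho> * (ip \<Omega> (dx \<Omega> u) \<theta> - ip \<Omega> (dx \<Omega> uh) \<theta>)"

lemma lp_add_right: "u \<in> H2 \<Omega> \<Longrightarrow> v \<in> H2 \<Omega> \<Longrightarrow> w \<in> H2 \<Omega> \<Longrightarrow> lp w (\<lambda>p. u p + v p) = lp w u + lp w v"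
  using lp_add[of u v w] ip_commute[of \<Omega> "lap \<Omega> w"] by metis

lemma lp_scale_right: "u \<in> H2 \<Omega> \<Longrightarrow> w \<in> H2 \<Omega> \<Longrightarrow> lp w (\<lambda>p. c * u p) = c * lp w u"
  using lp_scale[of u w c] ip_commute[of \<Omega> "lap \<Omega> w"] by metis

lemma residual_add:
  assumes "u \<in> H20 a b" "uh \<in> H20 a b" "\<eta>' \<in> H1 \<Omega>" "v \<in> H20 a b" "w \<in> H20 a b"
  shows "residual u uh \<eta>' (\<lambda>p. v p + w p) = residual u uh \<eta>' v + residual u uh \<eta>' w"
  unfolding residual_def using assms
  by (simp add: gp_add_right lp_add_right trilin_add3 ip_add_right H20_H1 H20_H2 H1_L2 algebra_simps)

lemma residual_scale:
  assumes "u \<in> H20 a b" "uh \<in> H20 a b" "\<eta>' \<in> H1 \<Omega>" "v \<in> H20 a b"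
  shows "residual u uh \<eta>' (\<lambda>p. c * v p) = c * residual u uh \<eta>' v"
  unfolding residual_def using assms
  by (simp add: gp_scale_right lp_scale_right trilin_scale3 ip_scale_right H20_H1 H20_H2 H1_L2 algebra_simps)

text \<open>
  With \<open>\<eta> = u - \<mu>\<close> and \<open>uh = \<mu> + \<theta>\<close> the nonlinear terms combine to
  \<open>b(u;\<eta>,\<theta>) + b(\<eta>;u,\<theta>) - b(\<eta>;\<eta>,\<theta>) - b(\<theta>;u,\<theta>) + b(\<theta>;\<eta>,\<theta>)\<close>. So no bound on \<open>uh\<close> is needed.
\<close>

lemma residual_le:
  assumes u: "u \<in> H20 a b" and \<mu>: "\<mu> \<in> H20 a b" and \<theta>: "\<theta> \<in> H20 a b" and \<eta>': "\<eta>' \<in> H1 \<Omega>"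
  defines "A \<equiv> nrm \<Omega> (lap \<Omega> u)" and "E \<equiv> nrm \<Omega> (lap \<Omega> (\<lambda>p. u p - \<mu> p))" and "D \<equiv> nrm \<Omega> (lap \<Omega> \<theta>)"
    and "g \<equiv> nrm \<Omega> (grad \<Omega> \<theta>)" and "h \<equiv> nrm \<Omega> (grad \<Omega> \<eta>')"
  shows "2 * residual u (\<lambda>p. \<mu> p + \<theta> p) \<eta>' \<theta> \<le> (1 + \<rho> * \<Gamma>\<^sub>0 * P + 2 * (\<rho> * P) + 128 * \<Gamma>\<^sub>3^4 / \<nu>^3 * (A^4 + E^4)) * g\<^sup>2
     + (h\<^sup>2 + (4 * \<nu> + \<rho> * \<Gamma>\<^sub>0 * P) * E\<^sup>2 + 4 * \<Gamma>\<^sup>2 / \<nu> * (8 * (A\<^sup>2 * E\<^sup>2) + 2 * E^4)) - \<nu> * D\<^sup>2"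
proof (rule energy_Young)
  define \<eta> where "\<eta> = (\<lambda>p. u p - \<mu> p)"
  let ?uh = "\<lambda>p. \<mu> p + \<theta> p"
  have \<eta>: "\<eta> \<in> H20 a b" unfolding \<eta>_def by (rule H20_diff[OF u \<mu>])
  have u_eq: "u = (\<lambda>p. \<eta> p + \<mu> p)" and \<mu>_eq: "\<mu> = (\<lambda>p. u p + (-1) * \<eta> p)" by (auto simp: \<eta>_def)
  have m\<eta>: "(\<lambda>p. (-1) * \<eta> p) \<in> H20 a b" by (rule H20_scale[OF \<eta>])
  have uh: "?uh \<in> H20 a b" by (rule H20_add[OF \<mu> \<theta>])
  have lin: "lp u \<theta> - lp ?uh \<theta> = lp \<eta> \<theta> - D\<^sup>2"
  proof -
    have "lp u \<theta> = lp \<eta> \<theta> + lp \<mu> \<theta>"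
      using lp_add[OF H20_H2[OF \<eta>] H20_H2[OF \<mu>] H20_H2[OF \<theta>]] unfolding u_eq[symmetric] .
    moreover have "lp ?uh \<theta> = lp \<mu> \<theta> + lp \<theta> \<theta>"
      by (rule lp_add[OF H20_H2[OF \<mu>] H20_H2[OF \<theta>] H20_H2[OF \<theta>]])
    ultimately show ?thesis by (simp add: D_def nrm_sq)
  qed
  have dx: "ip \<Omega> (dx \<Omega> u) \<theta> - ip \<Omega> (dx \<Omega> ?uh) \<theta> = ip \<Omega> (dx \<Omega> \<eta>) \<theta> - ip \<Omega> (dx \<Omega> \<theta>) \<theta>"
  proof -
    have "ip \<Omega> (dx \<Omega> u) \<theta> = ip \<Omega> (dx \<Omega> \<eta>) \<theta> + ip \<Omega> (dx \<Omega> \<mu>) \<theta>"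
      using ip_wpd_add[OF H20_has_wpd(1)[OF \<eta>] H20_has_wpd(1)[OF \<mu>] H1_L2(1)[OF H20_H1[OF \<theta>]]] unfolding u_eq[symmetric] .
    moreover have "ip \<Omega> (dx \<Omega> ?uh) \<theta> = ip \<Omega> (dx \<Omega> \<mu>) \<theta> + ip \<Omega> (dx \<Omega> \<theta>) \<theta>"
      by (rule ip_wpd_add[OF H20_has_wpd(1)[OF \<mu>] H20_has_wpd(1)[OF \<theta>] H1_L2(1)[OF H20_H1[OF \<theta>]]])
    ultimately show ?thesis by simp
  qed
  have tri: "trilin \<Omega> u u \<theta> - trilin \<Omega> ?uh ?uh \<theta>
    = trilin \<Omega> u \<eta> \<theta> + (trilin \<Omega> \<eta> u \<theta> - trilin \<Omega> \<eta> \<eta> \<theta>) - (trilin \<Omega> \<theta> u \<theta> - trilin \<Omega> \<theta> \<eta> \<theta>)"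
  proof -
    have sub: "trilin \<Omega> \<xi> \<mu> \<theta> = trilin \<Omega> \<xi> u \<theta> - trilin \<Omega> \<xi> \<eta> \<theta>" if "\<xi> \<in> H20 a b" for \<xi>
      using trilin_add2[OF that u m\<eta> \<theta>] trilin_scale2[OF that \<eta> \<theta>, of "-1"] unfolding \<mu>_eq[symmetric] by simp
    \<comment> \<open>Since b vanishes when its last two arguments are both \<theta>, the second
      argument \<open>\<mu> + \<theta>\<close> reduces to \<open>\<mu>\<close>, which is then
      replaced by u - \<eta>.\<close>
    have "trilin \<Omega> ?uh ?uh \<theta> = trilin \<Omega> \<mu> \<mu> \<theta> + trilin \<Omega> \<theta> \<mu> \<theta>"
      using trilin_add2[OF uh \<mu> \<theta> \<theta>] trilin_self[of ?uh \<theta>] trilin_add1[OF \<mu> \<theta> \<mu> \<theta>] by simp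
    moreover have "trilin \<Omega> u \<mu> \<theta> = trilin \<Omega> \<eta> \<mu> \<theta> + trilin \<Omega> \<mu> \<mu> \<theta>"
      using trilin_add1[OF \<eta> \<mu> \<mu> \<theta>] unfolding u_eq[symmetric] .
    ultimately show ?thesis using sub[OF u] sub[OF \<eta>] sub[OF \<theta>] by simp
  qed
  have E: "E = nrm \<Omega> (lap \<Omega> \<eta>)" by (simp add: E_def \<eta>_def)
  have b1: "gp \<eta>' \<theta> \<le> h * g"
    using gp_Cauchy_Schwarz[OF \<eta>' H20_H1[OF \<theta>]] by (simp add: h_def g_def)
  have b2: "\<nu> * lp \<eta> \<theta> \<le> \<nu> * (E * D)"
    using ip_Cauchy_Schwarz[OF lap_L2[OF H20_H2[OF \<eta>]] lap_L2[OF H20_H2[OF \<theta>]]] const_pos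
    by (intro mult_left_mono) (auto simp: E D_def)
  have b3: "trilin \<Omega> u \<eta> \<theta> \<le> \<Gamma> * (A * E) * D" "trilin \<Omega> \<eta> u \<theta> \<le> \<Gamma> * (E * A) * D" "- trilin \<Omega> \<eta> \<eta> \<theta> \<le> \<Gamma> * (E * E) * D"
    using trilin_abs_le'[OF u \<eta> \<theta>] trilin_abs_le'[OF \<eta> u \<theta>] trilin_abs_le'[OF \<eta> \<eta> \<theta>]
    unfolding A_def E D_def by (auto simp: abs_le_iff)
  \<comment> \<open>With \<theta> in the first and third argument, the estimate by
    \<open>\<Gamma>\<close> would give A D^2, which the dissipation cannot absorb in general. The
    half power of \<open>g\<close> leaves only D^(3/2).\<close>
  have b4: "- trilin \<Omega> \<theta> u \<theta> \<le> \<Gamma>\<^sub>3 * D * A * (sqrt g * sqrt D)" "trilin \<Omega> \<theta> \<eta> \<theta> \<le> \<Gamma>\<^sub>3 * D * E * (sqrt g * sqrt D)"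
    using trilin_abs_le[OF \<theta> u \<theta>] trilin_abs_le[OF \<theta> \<eta> \<theta>]
    unfolding A_def E D_def g_def by (auto simp: abs_le_iff)
  have b5: "- (\<rho> * ip \<Omega> (dx \<Omega> \<eta>) \<theta>) \<le> \<rho> * \<Gamma>\<^sub>0 * P * (E * g)"
  proof -
    have "- ip \<Omega> (dx \<Omega> \<eta>) \<theta> \<le> P * (nrm \<Omega> (grad \<Omega> \<eta>) * g)"
      using ip_dx_le[OF \<eta> \<theta>] by (simp add: g_def abs_le_iff)
    also have "\<dots> \<le> P * ((\<Gamma>\<^sub>0 * E) * g)"
      unfolding E using const_pos \<Gamma>\<^sub>0[OF \<eta>] by (intro mult_left_mono mult_right_mono) (auto simp: g_def)
    finally have "\<rho> * (- ip \<Omega> (dx \<Omega> \<eta>) \<theta>) \<le> \<rho> * (P * ((\<Gamma>\<^sub>0 * E) * g))"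
      using const_pos by (intro mult_left_mono) auto
    then show ?thesis by (simp add: mult_ac)
  qed
  have b6: "\<rho> * ip \<Omega> (dx \<Omega> \<theta>) \<theta> \<le> \<rho> * P * g\<^sup>2"
  proof -
    have "ip \<Omega> (dx \<Omega> \<theta>) \<theta> \<le> P * (g * g)"
      using ip_dx_le[OF \<theta> \<theta>] by (simp add: g_def abs_le_iff)
    then have "\<rho> * ip \<Omega> (dx \<Omega> \<theta>) \<theta> \<le> \<rho> * (P * (g * g))"
      using const_pos by (intro mult_left_mono) auto
    then show ?thesis by (simp add: power2_eq_square mult_ac)
  qed
  have "residual u ?uh \<eta>' \<theta> = gp \<eta>' \<theta> + (\<nu> * lp \<eta> \<theta> - \<nu> * D\<^sup>2) +
     (trilin \<Omega> u \<eta> \<theta> + (trilin \<Omega> \<eta> u \<theta> + - trilin \<Omega> \<eta> \<eta> \<theta>) + (- trilin \<Omega> \<theta> u \<theta> + trilin \<Omega> \<theta> \<eta> \<theta>))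
     + (- (\<rho> * ip \<Omega> (dx \<Omega> \<eta>) \<theta>) + \<rho> * ip \<Omega> (dx \<Omega> \<theta>) \<theta>)"
    unfolding residual_def lin dx tri by (simp add: right_diff_distrib)
  also have "\<dots> \<le> h * g + (\<nu> * (E * D) - \<nu> * D\<^sup>2) +
     (\<Gamma> * (A * E) * D + (\<Gamma> * (E * A) * D + \<Gamma> * (E * E) * D) + (\<Gamma>\<^sub>3 * D * A * (sqrt g * sqrt D) + \<Gamma>\<^sub>3 * D * E * (sqrt g * sqrt D)))
     + (\<rho> * \<Gamma>\<^sub>0 * P * (E * g) + \<rho> * P * g\<^sup>2)"
    by (intro add_mono diff_right_mono b1 b2 b3 b4 b5 b6)
  also have "\<dots> = h * g + \<nu> * (E * D) - \<nu> * D\<^sup>2 + \<Gamma> * (2 * (A * E) + E\<^sup>2) * D + \<Gamma>\<^sub>3 * (A + E) * (sqrt g * sqrt D) * D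
      + \<rho> * \<Gamma>\<^sub>0 * P * (E * g) + \<rho> * P * g\<^sup>2"
    by (simp add: algebra_simps power2_eq_square)
  finally show "residual u ?uh \<eta>' \<theta> \<le> h * g + \<nu> * (E * D) - \<nu> * D\<^sup>2 + \<Gamma> * (2 * (A * E) + E\<^sup>2) * D
      + \<Gamma>\<^sub>3 * (A + E) * (sqrt g * sqrt D) * D + \<rho> * \<Gamma>\<^sub>0 * P * (E * g) + \<rho> * P * g\<^sup>2" .
qed (use const_pos \<Gamma>_pos in \<open>auto simp: A_def E_def D_def g_def h_def\<close>)

text \<open>The seminorm in the definition of the dual norm is the norm of the Laplacian; where it vanishes so does \<open>G v\<close>.\<close>

lemma dual_le:
  assumes G: "G \<in> dual_H20 a b" and v: "v \<in> H20 a b"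
  shows "G v \<le> dual_norm a b G * nrm \<Omega> (lap \<Omega> v)"
proof -
  obtain K where K: "\<And>v. v \<in> H20 a b \<Longrightarrow> \<bar>G v\<bar> \<le> K * semi2 \<Omega> v"
    using G unfolding dual_H20_def by blast
  have s: "semi2 \<Omega> v = nrm \<Omega> (lap \<Omega> v)" by (rule semi2_eq_lap[OF v])
  show ?thesis
  proof (cases "semi2 \<Omega> v = 0")
    case True
    then show ?thesis using K[OF v] s by simp
  next
    case False
    then have pos: "semi2 \<Omega> v > 0" using s nrm_nonneg[of \<Omega> "lap \<Omega> v"] by linarith
    have "\<not> (AE p in lebesgue_on \<Omega>. v p = 0)"
    proof
      assume "AE p in lebesgue_on \<Omega>. v p = 0"
      then have "AE p in lebesgue_on \<Omega>. v p = 0 * v p" by simp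
      from lap_cong[OF this] have "nrm \<Omega> (lap \<Omega> v) = \<bar>0\<bar> * nrm \<Omega> (lap \<Omega> v)"
        using nrm_cong_AE'[OF lap_scale[OF H20_H2[OF v], of 0] L2_scale[OF lap_L2[OF H20_H2[OF v]]]]
          nrm_scale[of \<Omega> 0 "lap \<Omega> v"] by simp
      then show False using pos s by simp
    qed
    \<comment> \<open>The supremum dominates its elements only for a bounded set; membership in
      \<open>dual_H20\<close> supplies the bound. Where the seminorm is zero the quotient is
      0.\<close>
    moreover have "bdd_above {G v / semi2 \<Omega> v | v. v \<in> H20 a b \<and> \<not> (AE p in lebesgue_on \<Omega>. v p = 0)}"
    proof (rule bdd_aboveI)
      fix x assume "x \<in> {G v / semi2 \<Omega> v | v. v \<in> H20 a b \<and> \<not> (AE p in lebesgue_on \<Omega>. v p = 0)}"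
      then obtain w where w: "x = G w / semi2 \<Omega> w" "w \<in> H20 a b" by blast
      have "0 \<le> semi2 \<Omega> w" using semi2_eq_lap[OF w(2)] by simp
      then show "x \<le> \<bar>K\<bar>"
      proof (cases "semi2 \<Omega> w = 0")
        case False
        then have "0 < semi2 \<Omega> w" using \<open>0 \<le> semi2 \<Omega> w\<close> by simp
        moreover have "G w \<le> \<bar>K\<bar> * semi2 \<Omega> w"
          using K[OF w(2)] mult_right_mono[OF abs_ge_self[of K] \<open>0 \<le> semi2 \<Omega> w\<close>] by linarith
        ultimately show ?thesis using w(1) by (simp add: pos_divide_le_eq)
      qed (simp add: w(1))
    qed
    ultimately have "G v / semi2 \<Omega> v \<le> dual_norm a b G"
      unfolding dual_norm_def using v by (intro cSup_upper) auto
    then show ?thesis using pos s by (simp add: pos_divide_le_eq)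
  qed
qed

end

section \<open>Integrals in time and expansions in a finite basis\<close>

lemma integral_Cauchy_Schwarz_measure:
  fixes f g :: "'a \<Rightarrow> real"
  assumes "f \<in> borel_measurable M" "g \<in> borel_measurable M" "integrable M (\<lambda>x. (f x)\<^sup>2)" "integrable M (\<lambda>x. (g x)\<^sup>2)"
  shows "integrable M (\<lambda>x. f x * g x)"
    and "(\<integral>x. f x * g x \<partial>M) \<le> sqrt (\<integral>x. (f x)\<^sup>2 \<partial>M) * sqrt (\<integral>x. (g x)\<^sup>2 \<partial>M)"
proof -
  show i: "integrable M (\<lambda>x. f x * g x)"
  proof (rule Bochner_Integration.integrable_bound)
    show "integrable M (\<lambda>x. (f x)\<^sup>2 + (g x)\<^sup>2)" using assms by simp
    show "(\<lambda>x. f x * g x) \<in> borel_measurable M" using assms by simp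
    have "\<bar>u * v\<bar> \<le> u\<^sup>2 + v\<^sup>2" for u v :: real
    proof -
      have "2 * \<bar>u * v\<bar> \<le> u\<^sup>2 + v\<^sup>2" using sum_squares_bound[of "\<bar>u\<bar>" "\<bar>v\<bar>"] by (simp add: abs_mult)
      then show ?thesis using abs_ge_zero[of "u * v"] by linarith
    qed
    then show "AE x in M. norm (f x * g x) \<le> norm ((f x)\<^sup>2 + (g x)\<^sup>2)" by simp
  qed
  have "0 \<le> (\<integral>x. (f x)\<^sup>2 \<partial>M) + t * (2 * (\<integral>x. f x * g x \<partial>M)) + t\<^sup>2 * (\<integral>x. (g x)\<^sup>2 \<partial>M)" for t
  proof -
    have "0 \<le> (\<integral>x. (f x + t * g x)\<^sup>2 \<partial>M)" by (rule Bochner_Integration.integral_nonneg) simp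
    also have "(\<lambda>x. (f x + t * g x)\<^sup>2) = (\<lambda>x. (f x)\<^sup>2 + (2 * t) * (f x * g x) + t\<^sup>2 * (g x)\<^sup>2)"
      by (simp add: power2_eq_square algebra_simps)
    also have "(\<integral>x. (f x)\<^sup>2 + (2 * t) * (f x * g x) + t\<^sup>2 * (g x)\<^sup>2 \<partial>M)
      = (\<integral>x. (f x)\<^sup>2 \<partial>M) + t * (2 * (\<integral>x. f x * g x \<partial>M)) + t\<^sup>2 * (\<integral>x. (g x)\<^sup>2 \<partial>M)"
      using assms i by simp
    finally show ?thesis .
  qed
  then have "(\<integral>x. f x * g x \<partial>M)\<^sup>2 \<le> (\<integral>x. (f x)\<^sup>2 \<partial>M) * (\<integral>x. (g x)\<^sup>2 \<partial>M)"
    by (rule discriminant_le) simp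
  then have "sqrt ((\<integral>x. f x * g x \<partial>M)\<^sup>2) \<le> sqrt ((\<integral>x. (f x)\<^sup>2 \<partial>M) * (\<integral>x. (g x)\<^sup>2 \<partial>M))"
    by (rule real_sqrt_le_mono)
  then show "(\<integral>x. f x * g x \<partial>M) \<le> sqrt (\<integral>x. (f x)\<^sup>2 \<partial>M) * sqrt (\<integral>x. (g x)\<^sup>2 \<partial>M)"
    using abs_ge_self[of "\<integral>x. f x * g x \<partial>M"] by (simp add: real_sqrt_mult)
qed

lemma LINT_const: "0 \<le> T \<Longrightarrow> integrable (time T) (\<lambda>t. c) \<and> (LINT t|time T. c) = c * T" for c :: real
proof -
  assume "0 \<le> T"
  have i: "integrable (time T) (\<lambda>t. c)" by (rule continuous_imp_integrable_real) simp
  then have "(LINT t|time T. c) = integral {0..T} (\<lambda>t. c)"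
    by (rule lebesgue_integral_eq_integral) simp
  then show ?thesis using i \<open>0 \<le> T\<close> by simp
qed

text \<open>Every test function has its own exceptional null set of times; for finitely many of them
  the union is still null.\<close>

lemma AE_all_less:
  fixes m :: nat
  assumes "\<And>j. j < m \<Longrightarrow> AE t in M. Q j t"
  shows "AE t in M. \<forall>j<m. Q j t"
proof -
  have "AE t in M. \<forall>j\<in>{..<m}. Q j t"
    by (rule eventually_ball_finite) (use assms in auto)
  then show ?thesis by (rule eventually_mono) auto
qed

context rectangle begin

lemma trilin_cong:
  assumes "AE p in lebesgue_on \<Omega>. u p = u' p"
  shows "trilin \<Omega> u u w = trilin \<Omega> u' u' w"
  unfolding trilin_def lap_cong[OF assms] wpd_cong[OF assms] ..

text \<open>As a quadratic polynomial in the coefficients this squared norm is continuous in time as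
  soon as they are, which makes the dissipation integrable.\<close>

lemma lap_sum_square:
  fixes m :: nat
  assumes X: "fun_space X" "X \<subseteq> H20 a b" and \<phi>: "\<And>j. j < m \<Longrightarrow> \<phi> j \<in> X"
  shows "(nrm \<Omega> (lap \<Omega> (\<lambda>p. \<Sum>j<m. c j * \<phi> j p)))\<^sup>2 = (\<Sum>i<m. c i * (\<Sum>j<m. c j * lp (\<phi> j) (\<phi> i)))"
proof -
  let ?v = "\<lambda>p. \<Sum>j<m. c j * \<phi> j p"
  have v: "?v \<in> X" using \<phi> by (intro fun_space_sum[OF X(1)]) auto
  have s: "lp ?v w = (\<Sum>j<m. c j * lp (\<phi> j) w)" if w: "w \<in> X" for w
  proof (rule fun_space_linear_sum[OF X(1), of "{..<m}" \<phi> "\<lambda>u. lp u w" c, THEN conjunct2])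
    show "\<phi> j \<in> X" if "j \<in> {..<m}" for j using \<phi> that by simp
    show "lp (\<lambda>p. u p + u' p) w = lp u w + lp u' w" if "u \<in> X" "u' \<in> X" for u u'
      using that w X(2) H20_H2 by (intro lp_add) auto
    show "lp (\<lambda>p. c * u p) w = c * lp u w" if "u \<in> X" for u c
      using that w X(2) H20_H2 by (intro lp_scale) auto
  qed simp
  have "lp ?v ?v = (\<Sum>i<m. c i * lp (\<phi> i) ?v)" by (rule s[OF v])
  also have "\<dots> = (\<Sum>i<m. c i * (\<Sum>j<m. c j * lp (\<phi> j) (\<phi> i)))"
    using s[OF \<phi>] by (intro sum.cong refl) (simp add: ip_commute[of \<Omega> "lap \<Omega> (\<phi> _)" "lap \<Omega> ?v"])
  finally show ?thesis by (simp add: nrm_sq)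
qed

text \<open>Parseval's identity. With it the energy is a finite sum of squares of absolutely
  continuous coefficients and can be differentiated term by term.\<close>

lemma grad_sum_square:
  fixes m :: nat
  assumes X: "fun_space X" "X \<subseteq> H20 a b" and \<phi>: "\<And>j. j < m \<Longrightarrow> \<phi> j \<in> X" and on: "orthonormal m \<phi>"
  shows "(nrm \<Omega> (grad \<Omega> (\<lambda>p. \<Sum>j<m. c j * \<phi> j p)))\<^sup>2 = (\<Sum>j<m. (c j)\<^sup>2)"
proof -
  let ?v = "\<lambda>p. \<Sum>j<m. c j * \<phi> j p"
  have XH: "X \<subseteq> H1 \<Omega>" using X(2) H20_H1 by blast
  have v: "?v \<in> X" using \<phi> by (intro fun_space_sum[OF X(1)]) auto
  have vi: "gp ?v (\<phi> i) = c i" if i: "i < m" for i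
  proof -
    have "gp ?v (\<phi> i) = (\<Sum>j<m. c j * gp (\<phi> j) (\<phi> i))"
      by (rule gp_sum[OF X(1) XH \<phi>]) (use \<phi>[OF i] XH in auto)
    also have "\<dots> = (\<Sum>j<m. if j = i then c j else 0)"
      using on i by (intro sum.cong) (auto simp: orthonormal_def)
    finally show ?thesis using i by simp
  qed
  have "gp ?v ?v = (\<Sum>j<m. c j * gp (\<phi> j) ?v)"
    by (rule gp_sum[OF X(1) XH \<phi>]) (use v XH in auto)
  also have "\<dots> = (\<Sum>j<m. (c j)\<^sup>2)"
  proof (intro sum.cong refl)
    fix j assume "j \<in> {..<m}"
    then have "gp (\<phi> j) ?v = c j" using vi[of j] ip_commute[of \<Omega> "grad \<Omega> (\<phi> j)" "grad \<Omega> ?v"] by simp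
    then show "c j * gp (\<phi> j) ?v = (c j)\<^sup>2" by (simp add: power2_eq_square)
  qed
  finally show ?thesis by (simp add: nrm_sq)
qed

lemma lap_sum_square_integrable:
  fixes m :: nat
  assumes X: "fun_space X" "X \<subseteq> H20 a b" and \<phi>: "\<And>j. j < m \<Longrightarrow> \<phi> j \<in> X"
    and c: "\<And>j. j < m \<Longrightarrow> continuous_on {0..T} (c j)"
  shows "integrable (time T) (\<lambda>t. (nrm \<Omega> (lap \<Omega> (\<lambda>p. \<Sum>j<m. c j t * \<phi> j p)))\<^sup>2)"
proof -
  have eq: "(\<lambda>t. (nrm \<Omega> (lap \<Omega> (\<lambda>p. \<Sum>j<m. c j t * \<phi> j p)))\<^sup>2)
    = (\<lambda>t. \<Sum>i<m. c i t * (\<Sum>j<m. c j t * lp (\<phi> j) (\<phi> i)))"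
    by (intro ext lap_sum_square[OF X \<phi>])
  show ?thesis
    unfolding eq using c
    by (intro continuous_imp_integrable_real continuous_on_sum continuous_on_mult continuous_on_const) auto
qed

end

context flow begin

section \<open>Estimates for the discrete solution\<close>

lemma weak_solution_derivative:
  assumes "weak_solution a b T Rey Ros F V u0 u" "\<phi> \<in> V"
  shows "\<exists>r. abs_cont_deriv T (\<lambda>t. gp (u t) \<phi>) r \<and>
    (AE t in time T. r t = \<rho> * F t \<phi> - \<nu> * lp (u t) \<phi> - trilin \<Omega> (u t) (u t) \<phi> + \<rho> * ip \<Omega> (dx \<Omega> (u t)) \<phi>)"
proof -
  have "\<forall>\<phi>\<in>V. \<exists>r. abs_cont_deriv T (\<lambda>t. gp (u t) \<phi>) r \<and>
         (AE t in time T. r t + inverse Rey * lp (u t) \<phi> + trilin \<Omega> (u t) (u t) \<phi>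
              - inverse Ros * ip \<Omega> (dx \<Omega> (u t)) \<phi> = inverse Ros * F t \<phi>)"
    using assms(1) unfolding weak_solution_def Let_def by (elim conjE)
  from bspec[OF this assms(2)] obtain r where r: "abs_cont_deriv T (\<lambda>t. gp (u t) \<phi>) r"
    "AE t in time T. r t + inverse Rey * lp (u t) \<phi> + trilin \<Omega> (u t) (u t) \<phi>
              - inverse Ros * ip \<Omega> (dx \<Omega> (u t)) \<phi> = inverse Ros * F t \<phi>"
    by (elim exE conjE) (rule that)
  have "AE t in time T. r t = \<rho> * F t \<phi> - \<nu> * lp (u t) \<phi> - trilin \<Omega> (u t) (u t) \<phi> + \<rho> * ip \<Omega> (dx \<Omega> (u t)) \<phi>"
    using r(2) by eventually_elim (simp add: \<nu>_def \<rho>_def)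
  with r(1) show ?thesis by (intro exI conjI)
qed

lemma weak_solution_D:
  assumes "weak_solution a b T Rey Ros F V u0 u"
  shows "AE t in time T. u t \<in> V" "integrable (time T) (\<lambda>t. (nrm \<Omega> (lap \<Omega> (u t)))\<^sup>2)"
    "\<And>t. t \<in> {0..T} \<Longrightarrow> u t \<in> H1 \<Omega>"
  using assms unfolding weak_solution_def Let_def L2_time_def Linf_time_def H10_def by blast+

text \<open>Testing with \<open>v\<close> itself removes the trilinear term. Half of the dissipation
  absorbs the load F by Young's inequality, the other half remains.\<close>

lemma stability_le:
  assumes G: "G \<in> dual_H20 a b" and v: "v \<in> H20 a b"
  shows "2 * (\<rho> * G v - \<nu> * lp v v - trilin \<Omega> v v v + \<rho> * ip \<Omega> (dx \<Omega> v) v)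
    \<le> 2 * (\<rho> * P) * (nrm \<Omega> (grad \<Omega> v))\<^sup>2 + \<rho>\<^sup>2 / \<nu> * (dual_norm a b G)\<^sup>2 - \<nu> * (nrm \<Omega> (lap \<Omega> v))\<^sup>2"
proof -
  let ?D = "nrm \<Omega> (lap \<Omega> v)" and ?g = "nrm \<Omega> (grad \<Omega> v)" and ?N = "dual_norm a b G"
  have "\<rho> * G v \<le> \<rho> * (?N * ?D)"
    using dual_le[OF G v] const_pos by (intro mult_left_mono) auto
  moreover have "2 * (\<rho> * (?N * ?D)) \<le> \<nu> * ?D\<^sup>2 + \<rho>\<^sup>2 / \<nu> * ?N\<^sup>2"
    using Young[OF const_pos(1), of "\<rho> * ?N" ?D] by (simp add: power_mult_distrib mult_ac)
  moreover have "\<rho> * ip \<Omega> (dx \<Omega> v) v \<le> \<rho> * P * ?g\<^sup>2"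
  proof -
    have "ip \<Omega> (dx \<Omega> v) v \<le> P * ?g\<^sup>2"
      using ip_dx_le[OF v v] by (simp add: abs_le_iff power2_eq_square)
    then have "\<rho> * ip \<Omega> (dx \<Omega> v) v \<le> \<rho> * (P * ?g\<^sup>2)" using const_pos by (intro mult_left_mono) auto
    then show ?thesis by (simp add: mult_ac)
  qed
  moreover have "lp v v = ?D\<^sup>2" by (simp add: nrm_sq)
  ultimately show ?thesis by (simp add: trilin_self)
qed

text \<open>The Gronwall exponent involves only \<rho>, P and T, so the bound is uniform over all
  finite element spaces. The initial value is left in place, to be compared later with that of the
  exact solution.\<close>

lemma discrete_solution_bound:
  assumes X: "fe_space a b h X" and sol: "discrete_solution a b T Rey Ros F X u0 u"
    and N: "2 * (\<rho> * P) * T \<le> real N / 2"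
  shows "(nrm \<Omega> (grad \<Omega> (u T)))\<^sup>2 + \<nu> * (LINT t|time T. (nrm \<Omega> (lap \<Omega> (u t)))\<^sup>2)
    \<le> 2 ^ N * ((nrm \<Omega> (grad \<Omega> (u 0)))\<^sup>2 + \<rho>\<^sup>2 / \<nu> * (LINT t|time T. (dual_norm a b (F t))\<^sup>2))"
proof -
  note fs = fe_space_fun_space[OF X] note XH = fe_space_subset[OF X]
  have ws: "weak_solution a b T Rey Ros F X u0 u" and uX: "\<And>t. t \<in> {0..T} \<Longrightarrow> u t \<in> X"
    using sol by (auto simp: discrete_solution_def)
  obtain m \<phi> where \<phi>: "\<And>j. j < m \<Longrightarrow> \<phi> j \<in> X" and on: "orthonormal m \<phi>"
    and expand: "\<And>v. v \<in> X \<Longrightarrow> AE p in lebesgue_on \<Omega>. v p = (\<Sum>j<m. gp v (\<phi> j) * \<phi> j p)"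
    by (rule fe_space_orthonormal_basis[OF X]) (rule that)
  define c where "c j t = gp (u t) (\<phi> j)" for j t
  \<comment> \<open>At each time in [0,T] this agrees with \<open>u t\<close> almost everywhere on
    \<Omega>, but its dependence on time is explicit, which gives integrability and the product
    rule.\<close>
  define v where "v t = (\<lambda>p. \<Sum>j<m. c j t * \<phi> j p)" for t
  have vX: "v t \<in> X" for t unfolding v_def using \<phi> by (intro fun_space_sum[OF fs]) auto
  have uv: "AE p in lebesgue_on \<Omega>. u t p = v t p" if "t \<in> {0..T}" for t
    using expand[OF uX[OF that]] by (simp add: v_def c_def)
  note lap_uv = lap_cong[OF uv] note grad_uv = grad_cong[OF uv]
  have "\<forall>j. \<exists>r. j < m \<longrightarrow> abs_cont_deriv T (c j) r \<and>
    (AE t in time T. r t = \<rho> * F t (\<phi> j) - \<nu> * lp (u t) (\<phi> j) - trilin \<Omega> (u t) (u t) (\<phi> j) + \<rho> * ip \<Omega> (dx \<Omega> (u t)) (\<phi> j))"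
    using weak_solution_derivative[OF ws \<phi>] unfolding c_def by blast
  from choice[OF this] obtain r where r: "\<And>j. j < m \<Longrightarrow> abs_cont_deriv T (c j) (r j)"
    and r_eq: "\<And>j. j < m \<Longrightarrow> AE t in time T. r j t = \<rho> * F t (\<phi> j) - \<nu> * lp (u t) (\<phi> j) - trilin \<Omega> (u t) (u t) (\<phi> j) + \<rho> * ip \<Omega> (dx \<Omega> (u t)) (\<phi> j)"
    by blast
  define Y where "Y t = (\<Sum>j<m. (c j t)\<^sup>2)" for t
  have Y: "Y t = (nrm \<Omega> (grad \<Omega> (v t)))\<^sup>2" for t
    unfolding Y_def v_def using grad_sum_square[OF fs XH \<phi> on] by simp
  have T0: "0 \<le> T" using pos by simp
  have "Y T + (LINT t|time T. \<nu> * (nrm \<Omega> (lap \<Omega> (v t)))\<^sup>2)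
     \<le> 2 ^ N * (Y 0 + (LINT t|time T. \<rho>\<^sup>2 / \<nu> * (dual_norm a b (F t))\<^sup>2))"
  proof (rule energy_Gronwall[OF T0])
    show "abs_cont_deriv T Y (\<lambda>t. \<Sum>j<m. 2 * (c j t * r j t))"
      unfolding Y_def by (rule abs_cont_deriv_sum) (auto intro: abs_cont_deriv_square r)
    show "integrable (time T) (\<lambda>t. 2 * (\<rho> * P))" using LINT_const[OF T0] by blast
    show "(LINT t|time T. 2 * (\<rho> * P)) \<le> real N / 2"
      unfolding conjunct2[OF LINT_const[OF T0]] by (rule N)
    show "integrable (time T) (\<lambda>t. \<nu> * (nrm \<Omega> (lap \<Omega> (v t)))\<^sup>2)"
      using lap_sum_square_integrable[OF fs XH \<phi> abs_cont_deriv_continuous[OF r]] by (simp add: v_def)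
    have "AE t in time T. \<forall>j<m. r j t = \<rho> * F t (\<phi> j) - \<nu> * lp (u t) (\<phi> j) - trilin \<Omega> (u t) (u t) (\<phi> j) + \<rho> * ip \<Omega> (dx \<Omega> (u t)) (\<phi> j)"
      by (rule AE_all_less[OF r_eq])
    moreover have "AE t in time T. t \<in> {0..T}" by (rule AE_I2) simp
    ultimately show "AE t in time T. (\<Sum>j<m. 2 * (c j t * r j t)) \<le> 2 * (\<rho> * P) * Y t + \<rho>\<^sup>2 / \<nu> * (dual_norm a b (F t))\<^sup>2 - \<nu> * (nrm \<Omega> (lap \<Omega> (v t)))\<^sup>2"
      using F(1)
    proof eventually_elim
      case (elim t)
      \<comment> \<open>The right-hand side of the equation as a functional of the test function. By
        linearity the sum of \<open>c j t * L (\<phi> j)\<close> is its value at \<open>v t\<close>: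
        the solution tests itself.\<close>
      define L where "L w = \<rho> * F t w - \<nu> * lp (v t) w - trilin \<Omega> (v t) (v t) w + \<rho> * ip \<Omega> (dx \<Omega> (v t)) w" for w
      have vH: "v t \<in> H20 a b" using vX XH by blast
      have Fadd: "F t (\<lambda>p. w p + w' p) = F t w + F t w'" if "w \<in> H20 a b" "w' \<in> H20 a b" for w w'
        using elim(3) that unfolding dual_H20_def by blast
      have Fscale: "F t (\<lambda>p. \<alpha> * w p) = \<alpha> * F t w" if "w \<in> H20 a b" for w \<alpha>
        using elim(3) that unfolding dual_H20_def by blast
      have "L (v t) = (\<Sum>j<m. c j t * L (\<phi> j))"
        unfolding v_def[of t]
      proof (rule fun_space_linear_sum[OF fs, of "{..<m}" \<phi> L "\<lambda>j. c j t", THEN conjunct2])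
        show "\<phi> j \<in> X" if "j \<in> {..<m}" for j using \<phi> that by simp
        show "L (\<lambda>p. w p + w' p) = L w + L w'" if "w \<in> X" "w' \<in> X" for w w'
        proof -
          have H: "w \<in> H20 a b" "w' \<in> H20 a b" using that XH by auto
          show ?thesis unfolding L_def Fadd[OF H] lp_add_right[OF H20_H2[OF H(1)] H20_H2[OF H(2)] H20_H2[OF vH]]
              trilin_add3[OF vH vH H] ip_add_right[OF H1_L2(1)[OF H20_H1[OF H(1)]] H1_L2(1)[OF H20_H1[OF H(2)]] H1_L2(2)[OF H20_H1[OF vH]]]
            by (simp add: algebra_simps)
        qed
        show "L (\<lambda>p. \<alpha> * w p) = \<alpha> * L w" if "w \<in> X" for w \<alpha>
        proof -
          have H: "w \<in> H20 a b" using that XH by auto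
          show ?thesis unfolding L_def Fscale[OF H] lp_scale_right[OF H20_H2[OF H] H20_H2[OF vH]]
              trilin_scale3[OF vH vH H] ip_scale_right
            by (simp add: algebra_simps)
        qed
      qed simp
      also have "\<dots> = (\<Sum>j<m. c j t * r j t)"
      proof (intro sum.cong refl)
        fix j assume "j \<in> {..<m}"
        then have "r j t = L (\<phi> j)"
          using elim(1) unfolding L_def trilin_cong[OF uv[OF elim(2)]] lap_uv[OF elim(2)] wpd_cong[OF uv[OF elim(2)]] by simp
        then show "c j t * L (\<phi> j) = c j t * r j t" by simp
      qed
      finally have "(\<Sum>j<m. 2 * (c j t * r j t)) = 2 * L (v t)" by (simp add: sum_distrib_left)
      then show ?case
        using stability_le[OF elim(3) vH] unfolding L_def Y by simp
    qed
  qed (use F const_pos in \<open>auto simp: Y_def intro: sum_nonneg\<close>)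
  moreover have "(LINT t|time T. (nrm \<Omega> (lap \<Omega> (v t)))\<^sup>2) = (LINT t|time T. (nrm \<Omega> (lap \<Omega> (u t)))\<^sup>2)"
    by (intro Bochner_Integration.integral_cong refl) (simp add: lap_uv)
  ultimately show ?thesis
    using grad_uv[of T] grad_uv[of 0] T0 unfolding Y by simp
qed

section \<open>Comparison with the exact solution\<close>

definition "C\<^sub>4 = 128 * \<Gamma>\<^sub>3^4 / \<nu>^3"
text \<open>At least 1 and at least 4 \<nu> + \<rho> \<Gamma>0 P, the coefficients of h^2 and E^2 in
  \<open>residual_le\<close>, so that one factor covers both integrals.\<close>

definition "C\<^sub>d = 1 + (4 * \<nu> + \<rho> * \<Gamma>\<^sub>0 * P)"

text \<open>
  The bound on \<open>\<integral>\<parallel>\<Delta>\<eta>\<parallel>\<^sup>4\<close> serves two purposes: it bounds the Gronwall exponent, and it allows one to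
  estimate the fourth power of the \<open>L\<^sup>4\<close> norm, which comes from \<open>b(\<eta>;\<eta>,\<theta>)\<close>, by its square.
\<close>

lemma error_estimate_small:
  assumes X: "fe_space a b h X" and sol: "weak_solution a b T Rey Ros F (H20 a b) u0 u"
    and u4: "integrable (time T) (\<lambda>t. (nrm \<Omega> (lap \<Omega> (u t)))^4)"
    and solh: "discrete_solution a b T Rey Ros F X uh0 uh"
    and adm: "(\<mu>, \<eta>') \<in> admissible a b T X u"
    and small: "(LINT t|time T. (nrm \<Omega> (lap \<Omega> (\<lambda>p. u t p - \<mu> t p)))^4) \<le> 1"
  defines "A4 \<equiv> LINT t|time T. (nrm \<Omega> (lap \<Omega> (u t)))^4"
  assumes N: "(1 + \<rho> * \<Gamma>\<^sub>0 * P + 2 * (\<rho> * P)) * T + C\<^sub>4 * (A4 + 1) \<le> real N / 2"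
  shows "(nrm \<Omega> (grad \<Omega> (\<lambda>p. u T p - uh T p)))\<^sup>2 + \<nu> * (LINT t|time T. (nrm \<Omega> (lap \<Omega> (\<lambda>p. u t p - uh t p)))\<^sup>2)
    \<le> (2 + 2 * \<nu> + 2 * 2 ^ N * (4 + C\<^sub>d + 4 * \<Gamma>\<^sup>2 / \<nu> * (8 * sqrt A4 + 2)))
      * ((nrm \<Omega> (grad \<Omega> (\<lambda>p. u 0 p - uh 0 p)))\<^sup>2 + approx_error \<Omega> T (\<lambda>t p. u t p - \<mu> t p) \<eta>')"
proof -
  note fs = fe_space_fun_space[OF X] note XH = fe_space_subset[OF X]
  have XH1: "X \<subseteq> H1 \<Omega>" using XH H20_H1 by blast
  have ws: "weak_solution a b T Rey Ros F X uh0 uh" and uhX: "\<And>t. t \<in> {0..T} \<Longrightarrow> uh t \<in> X"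
    using solh by (auto simp: discrete_solution_def)
  define \<eta> where "\<eta> t = (\<lambda>p. u t p - \<mu> t p)" for t
  have \<mu>X: "\<And>t. t \<in> {0..T} \<Longrightarrow> \<mu> t \<in> X"
    and td: "has_time_deriv a b T \<eta> \<eta>'"
    and h2: "integrable (time T) (\<lambda>t. (nrm \<Omega> (grad \<Omega> (\<eta>' t)))\<^sup>2)"
    and E2: "integrable (time T) (\<lambda>t. (nrm \<Omega> (lap \<Omega> (\<eta> t)))\<^sup>2)"
    and E4: "integrable (time T) (\<lambda>t. (nrm \<Omega> (lap \<Omega> (\<eta> t)))^4)"
    using adm unfolding admissible_def Let_def \<eta>_def by auto
  have \<eta>'H: "AE t in time T. \<eta>' t \<in> H1 \<Omega>"
    using td unfolding has_time_deriv_def H10_def by auto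
  have uH1: "\<And>t. t \<in> {0..T} \<Longrightarrow> u t \<in> H1 \<Omega>" and uH20: "AE t in time T. u t \<in> H20 a b"
    and A2: "integrable (time T) (\<lambda>t. (nrm \<Omega> (lap \<Omega> (u t)))\<^sup>2)"
    using weak_solution_D[OF sol] by auto
  obtain m \<phi> where \<phi>: "\<And>j. j < m \<Longrightarrow> \<phi> j \<in> X" and on: "orthonormal m \<phi>"
    and expand: "\<And>v. v \<in> X \<Longrightarrow> AE p in lebesgue_on \<Omega>. v p = (\<Sum>j<m. gp v (\<phi> j) * \<phi> j p)"
    by (rule fe_space_orthonormal_basis[OF X]) (rule that)
  define w where "w t = (\<lambda>p. uh t p - \<mu> t p)" for t
  have wX: "w t \<in> X" if "t \<in> {0..T}" for t
    unfolding w_def by (rule fun_space_diff[OF fs uhX[OF that] \<mu>X[OF that]])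
  define c where "c j t = gp (w t) (\<phi> j)" for j t
  \<comment> \<open>\<open>\<theta> t\<close> represents \<open>w t\<close> up to a null set for t
    in [0,T], and its time dependence is carried by the scalar coefficients alone.\<close>
  define \<theta> where "\<theta> t = (\<lambda>p. \<Sum>j<m. c j t * \<phi> j p)" for t
  have \<theta>X: "\<theta> t \<in> X" for t unfolding \<theta>_def using \<phi> by (intro fun_space_sum[OF fs]) auto
  have w\<theta>: "AE p in lebesgue_on \<Omega>. w t p = \<theta> t p" if "t \<in> {0..T}" for t
    using expand[OF wX[OF that]] by (simp add: \<theta>_def c_def)
  note lap_w = lap_cong[OF w\<theta>] note grad_w = grad_cong[OF w\<theta>]
  have uh\<theta>: "AE p in lebesgue_on \<Omega>. uh t p = \<mu> t p + \<theta> t p" if "t \<in> {0..T}" for t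
    using w\<theta>[OF that] by eventually_elim (simp add: w_def)
  have "\<forall>j. \<exists>r. j < m \<longrightarrow> abs_cont_deriv T (\<lambda>t. gp (uh t) (\<phi> j)) r \<and>
    (AE t in time T. r t = \<rho> * F t (\<phi> j) - \<nu> * lp (uh t) (\<phi> j) - trilin \<Omega> (uh t) (uh t) (\<phi> j) + \<rho> * ip \<Omega> (dx \<Omega> (uh t)) (\<phi> j))"
    using weak_solution_derivative[OF ws \<phi>] by blast
  from choice[OF this] obtain rh where rh: "\<And>j. j < m \<Longrightarrow> abs_cont_deriv T (\<lambda>t. gp (uh t) (\<phi> j)) (rh j)"
    and rh_eq: "\<And>j. j < m \<Longrightarrow> AE t in time T. rh j t = \<rho> * F t (\<phi> j) - \<nu> * lp (uh t) (\<phi> j) - trilin \<Omega> (uh t) (uh t) (\<phi> j) + \<rho> * ip \<Omega> (dx \<Omega> (uh t)) (\<phi> j)"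
    by blast
  have "\<forall>j. \<exists>r. j < m \<longrightarrow> abs_cont_deriv T (\<lambda>t. gp (u t) (\<phi> j)) r \<and>
    (AE t in time T. r t = \<rho> * F t (\<phi> j) - \<nu> * lp (u t) (\<phi> j) - trilin \<Omega> (u t) (u t) (\<phi> j) + \<rho> * ip \<Omega> (dx \<Omega> (u t)) (\<phi> j))"
    using weak_solution_derivative[OF sol subsetD[OF XH \<phi>]] by blast
  from choice[OF this] obtain r where r: "\<And>j. j < m \<Longrightarrow> abs_cont_deriv T (\<lambda>t. gp (u t) (\<phi> j)) (r j)"
    and r_eq: "\<And>j. j < m \<Longrightarrow> AE t in time T. r j t = \<rho> * F t (\<phi> j) - \<nu> * lp (u t) (\<phi> j) - trilin \<Omega> (u t) (u t) (\<phi> j) + \<rho> * ip \<Omega> (dx \<Omega> (u t)) (\<phi> j)"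
    by blast
  have T0: "0 \<le> T" using pos by simp
  \<comment> \<open>Only \<eta> is known to have a time derivative in \<open>H10\<close>; u and uh
    are differentiated only against fixed test functions. The coefficient is therefore written
    through \<eta>, u and uh, and \<open>\<mu>\<close> is never differentiated by itself.\<close>
  have c: "abs_cont_deriv T (c j) (\<lambda>t. gp (\<eta>' t) (\<phi> j) - r j t + rh j t)" if j: "j < m" for j
  proof (rule abs_cont_deriv_cong[OF _ _ T0])
    have "\<phi> j \<in> H10 a b" using \<phi>[OF j] XH H20_subset_H10 by blast
    then have "abs_cont_deriv T (\<lambda>t. gp (\<eta> t) (\<phi> j)) (\<lambda>t. gp (\<eta>' t) (\<phi> j))"
      using td unfolding has_time_deriv_def by blast
    then show "abs_cont_deriv T (\<lambda>t. gp (\<eta> t) (\<phi> j) - gp (u t) (\<phi> j) + gp (uh t) (\<phi> j)) (\<lambda>t. gp (\<eta>' t) (\<phi> j) - r j t + rh j t)"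
      by (intro abs_cont_deriv_add abs_cont_deriv_diff r[OF j] rh[OF j])
    fix t assume t: "t \<in> {0..T}"
    have H: "u t \<in> H1 \<Omega>" "\<mu> t \<in> H1 \<Omega>" "uh t \<in> H1 \<Omega>" "\<phi> j \<in> H1 \<Omega>"
      using uH1[OF t] \<mu>X[OF t] uhX[OF t] \<phi>[OF j] XH1 by auto
    show "c j t = gp (\<eta> t) (\<phi> j) - gp (u t) (\<phi> j) + gp (uh t) (\<phi> j)"
      unfolding c_def w_def \<eta>_def gp_diff[OF H(1,2,4)] gp_diff[OF H(3,2,4)] by simp
  qed
  define A where "A t = nrm \<Omega> (lap \<Omega> (u t))" for t
  define E where "E t = nrm \<Omega> (lap \<Omega> (\<eta> t))" for t
  define hh where "hh t = nrm \<Omega> (grad \<Omega> (\<eta>' t))" for t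
  define D where "D t = nrm \<Omega> (lap \<Omega> (\<theta> t))" for t
  define k where "k t = 1 + \<rho> * \<Gamma>\<^sub>0 * P + 2 * (\<rho> * P) + C\<^sub>4 * ((A t)^4 + (E t)^4)" for t
  define d where "d t = (hh t)\<^sup>2 + (4 * \<nu> + \<rho> * \<Gamma>\<^sub>0 * P) * (E t)\<^sup>2 + 4 * \<Gamma>\<^sup>2 / \<nu> * (8 * ((A t)\<^sup>2 * (E t)\<^sup>2) + 2 * (E t)^4)" for t
  define Y where "Y t = (\<Sum>j<m. (c j t)\<^sup>2)" for t
  have Y: "Y t = (nrm \<Omega> (grad \<Omega> (\<theta> t)))\<^sup>2" for t
    unfolding Y_def \<theta>_def using grad_sum_square[OF fs XH \<phi> on] by simp
  have iE2: "integrable (time T) (\<lambda>t. (E t)\<^sup>2)" and iE4: "integrable (time T) (\<lambda>t. (E t)^4)"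
    and iA4: "integrable (time T) (\<lambda>t. (A t)^4)" and iA2: "integrable (time T) (\<lambda>t. (A t)\<^sup>2)"
    and ih2: "integrable (time T) (\<lambda>t. (hh t)\<^sup>2)"
    using E2 E4 u4 A2 h2 unfolding E_def A_def hh_def by simp_all
  have iD2: "integrable (time T) (\<lambda>t. (D t)\<^sup>2)"
    unfolding D_def \<theta>_def by (rule lap_sum_square_integrable[OF fs XH \<phi> abs_cont_deriv_continuous[OF c]])
  have AE2: "integrable (time T) (\<lambda>t. (A t)\<^sup>2 * (E t)\<^sup>2)"
    "(LINT t|time T. (A t)\<^sup>2 * (E t)\<^sup>2) \<le> sqrt (LINT t|time T. (A t)^4) * sqrt (LINT t|time T. (E t)^4)"
    using integral_Cauchy_Schwarz_measure[of "\<lambda>t. (A t)\<^sup>2" "time T" "\<lambda>t. (E t)\<^sup>2"] iA2 iE2 iA4 iE4 by simp_all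
  define I1 I2 I4 where "I1 = (LINT t|time T. (hh t)\<^sup>2)" and "I2 = (LINT t|time T. (E t)\<^sup>2)" and "I4 = (LINT t|time T. (E t)^4)"
  have I0: "0 \<le> I1" "0 \<le> I2" "0 \<le> I4" "0 \<le> A4"
    unfolding I1_def I2_def I4_def A4_def by (simp_all add: Bochner_Integration.integral_nonneg)
  have I41: "I4 \<le> 1" using small by (simp add: I4_def E_def \<eta>_def)
  \<comment> \<open>The squared L4 norm of \<open>E\<close> that occurs in
    \<open>approx_error\<close>. As I4 \<le> 1, it also dominates I4 itself.\<close>
  define S where "S = sqrt I4"
  have S: "0 \<le> S" "I4 \<le> S"
  proof -
    show "0 \<le> S" using I0 by (simp add: S_def)
    have "S \<le> 1" using I41 by (simp add: S_def)
    then have "S * S \<le> S" using \<open>0 \<le> S\<close> by (simp add: mult_left_le)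
    then show "I4 \<le> S" using I0 by (simp add: S_def)
  qed
  have approx: "approx_error \<Omega> T (\<lambda>t p. u t p - \<mu> t p) \<eta>' =
    (nrm \<Omega> (grad \<Omega> (\<eta> 0)))\<^sup>2 + (I1 + I2) + S + (nrm \<Omega> (grad \<Omega> (\<eta> T)))\<^sup>2"
  proof -
    have "(LINT t|time T. (hh t)\<^sup>2 + (E t)\<^sup>2) = I1 + I2" unfolding I1_def I2_def using ih2 iE2 by simp
    moreover have "(I4 powr (1/4))\<^sup>2 = S"
    proof -
      have "(I4 powr (1/4))\<^sup>2 = I4 powr (1/4 + 1/4)" unfolding power2_eq_square powr_add ..
      also have "\<dots> = S" using I0 by (simp add: S_def powr_half_sqrt)
      finally show ?thesis .
    qed
    ultimately show ?thesis
      unfolding approx_error_def hh_def E_def I4_def \<eta>_def by simp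
  qed
  have C4: "0 \<le> C\<^sub>4" using const_pos by (simp add: C\<^sub>4_def)
  have energy: "Y T + (LINT t|time T. \<nu> * (D t)\<^sup>2) \<le> 2 ^ N * (Y 0 + (LINT t|time T. d t))"
  proof (rule energy_Gronwall[OF T0])
    show "abs_cont_deriv T Y (\<lambda>t. \<Sum>j<m. 2 * (c j t * (gp (\<eta>' t) (\<phi> j) - r j t + rh j t)))"
      unfolding Y_def by (rule abs_cont_deriv_sum) (auto intro: abs_cont_deriv_square c)
    show "0 \<le> Y t" for t unfolding Y_def by (simp add: sum_nonneg)
    show "integrable (time T) k" unfolding k_def
      by (intro Bochner_Integration.integrable_add Bochner_Integration.integrable_mult_right iA4 iE4)
        (use LINT_const[OF T0] in auto)
    show "0 \<le> k t" for t unfolding k_def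
      using const_pos \<Gamma>_pos C4 by (intro add_nonneg_nonneg mult_nonneg_nonneg) auto
    show "integrable (time T) d" unfolding d_def
      by (intro Bochner_Integration.integrable_add Bochner_Integration.integrable_mult_right ih2 iE2 iE4 AE2)
    show "0 \<le> d t" for t unfolding d_def
      using const_pos \<Gamma>_pos by (intro add_nonneg_nonneg mult_nonneg_nonneg divide_nonneg_nonneg) auto
    show "integrable (time T) (\<lambda>t. \<nu> * (D t)\<^sup>2)" using iD2 by simp
    show "0 \<le> \<nu> * (D t)\<^sup>2" for t using const_pos by simp
    have "(LINT t|time T. k t) = (1 + \<rho> * \<Gamma>\<^sub>0 * P + 2 * (\<rho> * P)) * T + C\<^sub>4 * (A4 + I4)"
      unfolding k_def A4_def I4_def
      using LINT_const[OF T0, of "1 + \<rho> * \<Gamma>\<^sub>0 * P + 2 * (\<rho> * P)"] iA4 iE4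
      by (subst Bochner_Integration.integral_add) (auto simp: A_def)
    also have "\<dots> \<le> (1 + \<rho> * \<Gamma>\<^sub>0 * P + 2 * (\<rho> * P)) * T + C\<^sub>4 * (A4 + 1)"
      using C4 I41 by (intro add_left_mono mult_left_mono) auto
    finally show "(LINT t|time T. k t) \<le> real N / 2" using N by linarith
    have "AE t in time T. \<forall>j<m. r j t = \<rho> * F t (\<phi> j) - \<nu> * lp (u t) (\<phi> j) - trilin \<Omega> (u t) (u t) (\<phi> j) + \<rho> * ip \<Omega> (dx \<Omega> (u t)) (\<phi> j)"
      by (rule AE_all_less[OF r_eq])
    moreover have "AE t in time T. \<forall>j<m. rh j t = \<rho> * F t (\<phi> j) - \<nu> * lp (uh t) (\<phi> j) - trilin \<Omega> (uh t) (uh t) (\<phi> j) + \<rho> * ip \<Omega> (dx \<Omega> (uh t)) (\<phi> j)"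
      by (rule AE_all_less[OF rh_eq])
    moreover have "AE t in time T. t \<in> {0..T}" by (rule AE_I2) simp
    ultimately show "AE t in time T. (\<Sum>j<m. 2 * (c j t * (gp (\<eta>' t) (\<phi> j) - r j t + rh j t))) \<le> k t * Y t + d t - \<nu> * (D t)\<^sup>2"
      using uH20 \<eta>'H
    proof eventually_elim
      case (elim t)
      let ?uh = "\<lambda>p. \<mu> t p + \<theta> t p"
      have H: "\<mu> t \<in> H20 a b" "\<theta> t \<in> H20 a b" using \<mu>X[OF elim(3)] \<theta>X XH by auto
      have uhH: "?uh \<in> H20 a b" by (rule H20_add[OF H])
      \<comment> \<open>This sum over the basis is half the derivative of \<open>Y\<close>, so its
        value at \<theta> is what \<open>residual_le\<close> has to bound.\<close>
      have "residual (u t) ?uh (\<eta>' t) (\<theta> t) = (\<Sum>j<m. c j t * residual (u t) ?uh (\<eta>' t) (\<phi> j))"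
        unfolding \<theta>_def[of t]
      proof (rule fun_space_linear_sum[OF fs, of "{..<m}" \<phi> "residual (u t) (\<lambda>p. \<mu> t p + (\<Sum>j<m. c j t * \<phi> j p)) (\<eta>' t)" "\<lambda>j. c j t", THEN conjunct2])
        show "\<phi> j \<in> X" if "j \<in> {..<m}" for j using \<phi> that by simp
      qed (use XH elim(4,5) uhH[unfolded \<theta>_def[of t]] in \<open>auto intro!: residual_add residual_scale\<close>)
      also have "\<dots> = (\<Sum>j<m. c j t * (gp (\<eta>' t) (\<phi> j) - r j t + rh j t))"
      proof (intro sum.cong refl)
        fix j assume "j \<in> {..<m}"
        then have j: "j < m" by simp
        have 1: "r j t = \<rho> * F t (\<phi> j) - \<nu> * lp (u t) (\<phi> j) - trilin \<Omega> (u t) (u t) (\<phi> j) + \<rho> * ip \<Omega> (dx \<Omega> (u t)) (\<phi> j)"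
          using elim(1) j by blast
        have 2: "rh j t = \<rho> * F t (\<phi> j) - \<nu> * lp ?uh (\<phi> j) - trilin \<Omega> ?uh ?uh (\<phi> j) + \<rho> * ip \<Omega> (dx \<Omega> ?uh) (\<phi> j)"
          using elim(2) j unfolding trilin_cong[OF uh\<theta>[OF elim(3)]] lap_cong[OF uh\<theta>[OF elim(3)]] wpd_cong[OF uh\<theta>[OF elim(3)]]
          by blast
        have "gp (\<eta>' t) (\<phi> j) - r j t + rh j t = residual (u t) ?uh (\<eta>' t) (\<phi> j)"
          unfolding 1 2 residual_def by (simp add: algebra_simps)
        then show "c j t * residual (u t) ?uh (\<eta>' t) (\<phi> j) = c j t * (gp (\<eta>' t) (\<phi> j) - r j t + rh j t)" by simp
      qed
      finally have "(\<Sum>j<m. 2 * (c j t * (gp (\<eta>' t) (\<phi> j) - r j t + rh j t))) = 2 * residual (u t) ?uh (\<eta>' t) (\<theta> t)"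
        by (simp add: sum_distrib_left)
      also have "\<dots> \<le> k t * Y t + d t - \<nu> * (D t)\<^sup>2"
        using residual_le[OF elim(4) H elim(5)]
        unfolding k_def d_def Y D_def C\<^sub>4_def A_def E_def \<eta>_def hh_def .
      finally show ?case .
    qed
  qed
  have dint: "(LINT t|time T. d t) \<le> (C\<^sub>d + 4 * \<Gamma>\<^sup>2 / \<nu> * (8 * sqrt A4 + 2)) * (I1 + I2 + S)"
  proof -
    have g: "0 \<le> 4 * \<Gamma>\<^sup>2 / \<nu>" "0 \<le> 4 * \<nu> + \<rho> * \<Gamma>\<^sub>0 * P" using const_pos \<Gamma>_pos by auto
    have "(LINT t|time T. d t) = I1 + (4 * \<nu> + \<rho> * \<Gamma>\<^sub>0 * P) * I2 + 4 * \<Gamma>\<^sup>2 / \<nu> * (8 * (LINT t|time T. (A t)\<^sup>2 * (E t)\<^sup>2) + 2 * I4)"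
      unfolding d_def I1_def I2_def I4_def using ih2 iE2 iE4 AE2(1) by simp
    also have "\<dots> \<le> I1 + (4 * \<nu> + \<rho> * \<Gamma>\<^sub>0 * P) * I2 + 4 * \<Gamma>\<^sup>2 / \<nu> * (8 * (sqrt A4 * S) + 2 * S)"
      using AE2(2) S(2) unfolding S_def I4_def A4_def A_def
      by (intro add_left_mono mult_left_mono add_mono g) auto
    also have "\<dots> = 1 * I1 + (4 * \<nu> + \<rho> * \<Gamma>\<^sub>0 * P) * I2 + (4 * \<Gamma>\<^sup>2 / \<nu> * (8 * sqrt A4 + 2)) * S"
      by (simp add: algebra_simps add_divide_distrib)
    also have "\<dots> \<le> (C\<^sub>d + 4 * \<Gamma>\<^sup>2 / \<nu> * (8 * sqrt A4 + 2)) * I1 + (C\<^sub>d + 4 * \<Gamma>\<^sup>2 / \<nu> * (8 * sqrt A4 + 2)) * I2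
       + (C\<^sub>d + 4 * \<Gamma>\<^sup>2 / \<nu> * (8 * sqrt A4 + 2)) * S"
    proof -
      have q: "0 \<le> 4 * \<Gamma>\<^sup>2 / \<nu> * (8 * sqrt A4 + 2)" using g(1) I0 by (intro mult_nonneg_nonneg) auto
      \<comment> \<open>Each of the three coefficients 1, p, q is replaced by the sum of all
        three.\<close>
      have weights: "1 * x + p * y + q * z \<le> (1 + p + q) * x + (1 + p + q) * y + (1 + p + q) * z"
        if "0 \<le> p" "0 \<le> q" "0 \<le> x" "0 \<le> y" "0 \<le> z" for p q x y z :: real
        using that by (intro add_mono mult_right_mono) auto
      show ?thesis unfolding C\<^sub>d_def by (rule weights[OF g(2) q I0(1,2) S(1)])
    qed
    finally show ?thesis by (simp add: distrib_left)
  qed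
  define e0 where "e0 = (nrm \<Omega> (grad \<Omega> (\<lambda>p. u 0 p - uh 0 p)))\<^sup>2"
  define n0 where "n0 = (nrm \<Omega> (grad \<Omega> (\<eta> 0)))\<^sup>2"
  define nT where "nT = (nrm \<Omega> (grad \<Omega> (\<eta> T)))\<^sup>2"
  have \<eta>H1: "\<eta> t \<in> H1 \<Omega>" if "t \<in> {0..T}" for t
    unfolding \<eta>_def by (intro H1_diff uH1 that) (use \<mu>X[OF that] XH1 in blast)
  have in0: "0 \<in> {0..T}" and inT: "T \<in> {0..T}" using T0 by auto
  \<comment> \<open>w(0) is \<eta>(0) minus the full initial error, which is how both initial terms
    of the claim arise.\<close>
  have Y0: "Y 0 \<le> 2 * n0 + 2 * e0"
  proof -
    have eH: "(\<lambda>p. u 0 p - uh 0 p) \<in> H1 \<Omega>" by (intro H1_diff uH1 in0) (use uhX[OF in0] XH1 in blast)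
    have "w 0 = (\<lambda>p. \<eta> 0 p - (u 0 p - uh 0 p))" by (simp add: w_def \<eta>_def)
    then have "(nrm \<Omega> (grad \<Omega> (w 0)))\<^sup>2 \<le> 2 * n0 + 2 * e0"
      using nrm_grad_diff_le[OF \<eta>H1[OF in0] eH] by (simp add: n0_def e0_def)
    then show ?thesis unfolding Y grad_w[OF in0] .
  qed
  have eT: "(nrm \<Omega> (grad \<Omega> (\<lambda>p. u T p - uh T p)))\<^sup>2 \<le> 2 * nT + 2 * Y T"
  proof -
    have "(\<lambda>p. u T p - uh T p) = (\<lambda>p. \<eta> T p - w T p)" by (simp add: w_def \<eta>_def)
    then have "(nrm \<Omega> (grad \<Omega> (\<lambda>p. u T p - uh T p)))\<^sup>2 \<le> 2 * nT + 2 * (nrm \<Omega> (grad \<Omega> (w T)))\<^sup>2"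
      using nrm_grad_diff_le[OF \<eta>H1[OF inT], of "w T"] wX[OF inT] XH1 unfolding nT_def by auto
    then show ?thesis unfolding Y grad_w[OF inT] .
  qed
  have eL: "(LINT t|time T. (nrm \<Omega> (lap \<Omega> (\<lambda>p. u t p - uh t p)))\<^sup>2) \<le> 2 * I2 + 2 * (LINT t|time T. (D t)\<^sup>2)"
  proof -
    have "AE t in time T. t \<in> {0..T}" by (rule AE_I2) simp
    with uH20 have "AE t in time T. (nrm \<Omega> (lap \<Omega> (\<lambda>p. u t p - uh t p)))\<^sup>2 \<le> 2 * (E t)\<^sup>2 + 2 * (D t)\<^sup>2"
    proof eventually_elim
      case (elim t)
      have H: "\<eta> t \<in> H2 \<Omega>" "w t \<in> H2 \<Omega>"
        using H20_H2[OF H20_diff[OF elim(1), of "\<mu> t"]] \<mu>X[OF elim(2)] wX[OF elim(2)] XH H20_H2 by (auto simp: \<eta>_def)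
      have "(\<lambda>p. u t p - uh t p) = (\<lambda>p. \<eta> t p - w t p)" by (simp add: w_def \<eta>_def)
      then show ?case
        using nrm_lap_diff_le[OF H] unfolding lap_w[OF elim(2)] E_def D_def by simp
    qed
    then have "(LINT t|time T. (nrm \<Omega> (lap \<Omega> (\<lambda>p. u t p - uh t p)))\<^sup>2) \<le> (LINT t|time T. 2 * (E t)\<^sup>2 + 2 * (D t)\<^sup>2)"
      using iE2 iD2 by (intro integral_mono_AE') auto
    then show ?thesis using iE2 iD2 by (simp add: I2_def)
  qed
  define Q where "Q = C\<^sub>d + 4 * \<Gamma>\<^sup>2 / \<nu> * (8 * sqrt A4 + 2)"
  have Q0: "0 \<le> Q"
    unfolding Q_def C\<^sub>d_def using const_pos \<Gamma>_pos I0 by (intro add_nonneg_nonneg mult_nonneg_nonneg divide_nonneg_nonneg) auto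
  have pos0: "0 \<le> e0" "0 \<le> n0" "0 \<le> nT" by (simp_all add: e0_def n0_def nT_def)
  define R where "R = e0 + (n0 + (I1 + I2) + S + nT)"
  have RR: "0 \<le> R" "n0 + e0 \<le> R" "nT \<le> R" "I2 \<le> R" "I1 + I2 + S \<le> R"
    using pos0 I0 S(1) by (auto simp: R_def)
  have "(nrm \<Omega> (grad \<Omega> (\<lambda>p. u T p - uh T p)))\<^sup>2 + \<nu> * (LINT t|time T. (nrm \<Omega> (lap \<Omega> (\<lambda>p. u t p - uh t p)))\<^sup>2)
     \<le> (2 * nT + 2 * Y T) + \<nu> * (2 * I2 + 2 * (LINT t|time T. (D t)\<^sup>2))"
    using eT eL const_pos by (intro add_mono mult_left_mono) auto
  also have "\<dots> = 2 * nT + 2 * \<nu> * I2 + 2 * (Y T + (LINT t|time T. \<nu> * (D t)\<^sup>2))"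
    by (simp add: algebra_simps)
  also have "\<dots> \<le> 2 * nT + 2 * \<nu> * I2 + 2 * (2 ^ N * (Y 0 + (LINT t|time T. d t)))"
    using energy by simp
  also have "\<dots> \<le> 2 * R + 2 * \<nu> * R + 2 * (2 ^ N * (4 * R + Q * R))"
  proof -
    have "Y 0 \<le> 4 * R" using Y0 RR pos0 by linarith
    moreover have "(LINT t|time T. d t) \<le> Q * R"
      using dint mult_left_mono[OF RR(5) Q0] unfolding Q_def by linarith
    ultimately show ?thesis
      using RR const_pos by (intro add_mono mult_left_mono) auto
  qed
  also have "\<dots> = (2 + 2 * \<nu> + 2 * 2 ^ N * (4 + Q)) * R" by (simp add: algebra_simps)
  finally show ?thesis
    unfolding approx R_def Q_def e0_def n0_def nT_def by (simp add: add.assoc)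
qed

text \<open>The squared L4 norm in \<open>approx_error\<close> is the square root of this integral,
  and the other terms are nonnegative.\<close>

lemma approx_error_ge:
  assumes "(\<mu>, \<eta>') \<in> admissible a b T X u"
    and "\<not> (LINT t|time T. (nrm \<Omega> (lap \<Omega> (\<lambda>p. u t p - \<mu> t p)))^4) \<le> 1"
  shows "1 \<le> approx_error \<Omega> T (\<lambda>t p. u t p - \<mu> t p) \<eta>'"
proof -
  define I4 where "I4 = (LINT t|time T. (nrm \<Omega> (lap \<Omega> (\<lambda>p. u t p - \<mu> t p)))^4)"
  have "1 \<le> I4 powr (1/4)" using assms(2) by (simp add: I4_def ge_one_powr_ge_zero)
  then have "1 \<le> (I4 powr (1/4))\<^sup>2" by (rule one_le_power)
  moreover have "0 \<le> (LINT t|time T. (nrm \<Omega> (grad \<Omega> (\<eta>' t)))\<^sup>2 + (nrm \<Omega> (lap \<Omega> (\<lambda>p. u t p - \<mu> t p)))\<^sup>2)"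
    by (rule Bochner_Integration.integral_nonneg) simp
  moreover have "0 \<le> (nrm \<Omega> (grad \<Omega> (\<lambda>p. u 0 p - \<mu> 0 p)))\<^sup>2" "0 \<le> (nrm \<Omega> (grad \<Omega> (\<lambda>p. u T p - \<mu> T p)))\<^sup>2" by simp_all
  ultimately show ?thesis unfolding approx_error_def I4_def by linarith
qed

text \<open>The two equations are not compared here: u and uh are bounded separately and combined by
  the triangle inequality. Quantities that need not be small become multiples of the right-hand side
  because 1 \<le> R.\<close>

lemma error_bound_large:
  assumes X: "fe_space a b h X" and sol: "weak_solution a b T Rey Ros F (H20 a b) u0 u"
    and solh: "discrete_solution a b T Rey Ros F X uh0 uh"
    and N: "2 * (\<rho> * P) * T \<le> real N / 2" and R: "1 \<le> R"
  shows "(nrm \<Omega> (grad \<Omega> (\<lambda>p. u T p - uh T p)))\<^sup>2 + \<nu> * (LINT t|time T. (nrm \<Omega> (lap \<Omega> (\<lambda>p. u t p - uh t p)))\<^sup>2)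
    \<le> (2 * (nrm \<Omega> (grad \<Omega> (u T)))\<^sup>2 + 2 * \<nu> * (LINT t|time T. (nrm \<Omega> (lap \<Omega> (u t)))\<^sup>2)
        + 2 ^ N * (4 + 4 * (nrm \<Omega> (grad \<Omega> (u 0)))\<^sup>2 + 2 * (\<rho>\<^sup>2 / \<nu> * (LINT t|time T. (dual_norm a b (F t))\<^sup>2))))
      * ((nrm \<Omega> (grad \<Omega> (\<lambda>p. u 0 p - uh 0 p)))\<^sup>2 + R)"
proof -
  note XH = fe_space_subset[OF X]
  have XH1: "X \<subseteq> H1 \<Omega>" using XH H20_H1 by blast
  have uhX: "\<And>t. t \<in> {0..T} \<Longrightarrow> uh t \<in> X" and ws: "weak_solution a b T Rey Ros F X uh0 uh"
    using solh by (auto simp: discrete_solution_def)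
  have uH1: "\<And>t. t \<in> {0..T} \<Longrightarrow> u t \<in> H1 \<Omega>" and uH20: "AE t in time T. u t \<in> H20 a b"
    and A2: "integrable (time T) (\<lambda>t. (nrm \<Omega> (lap \<Omega> (u t)))\<^sup>2)"
    using weak_solution_D[OF sol] by auto
  have D2: "integrable (time T) (\<lambda>t. (nrm \<Omega> (lap \<Omega> (uh t)))\<^sup>2)" using weak_solution_D[OF ws] by auto
  have in0: "0 \<in> {0..T}" and inT: "T \<in> {0..T}" using pos by auto
  define e0 where "e0 = (nrm \<Omega> (grad \<Omega> (\<lambda>p. u 0 p - uh 0 p)))\<^sup>2"
  define g0 where "g0 = (nrm \<Omega> (grad \<Omega> (u 0)))\<^sup>2"
  define gT where "gT = (nrm \<Omega> (grad \<Omega> (u T)))\<^sup>2"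
  define IA where "IA = (LINT t|time T. (nrm \<Omega> (lap \<Omega> (u t)))\<^sup>2)"
  define ID where "ID = (LINT t|time T. (nrm \<Omega> (lap \<Omega> (uh t)))\<^sup>2)"
  define FF where "FF = \<rho>\<^sup>2 / \<nu> * (LINT t|time T. (dual_norm a b (F t))\<^sup>2)"
  have nonneg: "0 \<le> e0" "0 \<le> g0" "0 \<le> gT" "0 \<le> IA" "0 \<le> FF"
    unfolding e0_def g0_def gT_def IA_def FF_def using const_pos
    by (auto simp: Bochner_Integration.integral_nonneg intro!: mult_nonneg_nonneg divide_nonneg_nonneg)
  have uhT: "(nrm \<Omega> (grad \<Omega> (uh T)))\<^sup>2 + \<nu> * ID \<le> 2 ^ N * ((nrm \<Omega> (grad \<Omega> (uh 0)))\<^sup>2 + FF)"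
    unfolding ID_def FF_def by (rule discrete_solution_bound[OF X solh N])
  have uh0: "(nrm \<Omega> (grad \<Omega> (uh 0)))\<^sup>2 \<le> 2 * g0 + 2 * e0"
  proof -
    have eH: "(\<lambda>p. u 0 p - uh 0 p) \<in> H1 \<Omega>" by (intro H1_diff uH1 in0) (use uhX[OF in0] XH1 in blast)
    show ?thesis using nrm_grad_diff_le[OF uH1[OF in0] eH] by (simp add: g0_def e0_def)
  qed
  have eT: "(nrm \<Omega> (grad \<Omega> (\<lambda>p. u T p - uh T p)))\<^sup>2 \<le> 2 * gT + 2 * (nrm \<Omega> (grad \<Omega> (uh T)))\<^sup>2"
    unfolding gT_def by (rule nrm_grad_diff_le[OF uH1[OF inT]]) (use uhX[OF inT] XH1 in blast)
  have eL: "(LINT t|time T. (nrm \<Omega> (lap \<Omega> (\<lambda>p. u t p - uh t p)))\<^sup>2) \<le> 2 * IA + 2 * ID"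
  proof -
    have "AE t in time T. t \<in> {0..T}" by (rule AE_I2) simp
    with uH20 have "AE t in time T. (nrm \<Omega> (lap \<Omega> (\<lambda>p. u t p - uh t p)))\<^sup>2 \<le> 2 * (nrm \<Omega> (lap \<Omega> (u t)))\<^sup>2 + 2 * (nrm \<Omega> (lap \<Omega> (uh t)))\<^sup>2"
    proof eventually_elim
      case (elim t)
      have "uh t \<in> H2 \<Omega>" using uhX[OF elim(2)] XH H20_H2 by blast
      from nrm_lap_diff_le[OF H20_H2[OF elim(1)] this] show ?case .
    qed
    then have "(LINT t|time T. (nrm \<Omega> (lap \<Omega> (\<lambda>p. u t p - uh t p)))\<^sup>2)
      \<le> (LINT t|time T. 2 * (nrm \<Omega> (lap \<Omega> (u t)))\<^sup>2 + 2 * (nrm \<Omega> (lap \<Omega> (uh t)))\<^sup>2)"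
      using A2 D2 by (intro integral_mono_AE') auto
    then show ?thesis using A2 D2 by (simp add: IA_def ID_def)
  qed
  have "(nrm \<Omega> (grad \<Omega> (\<lambda>p. u T p - uh T p)))\<^sup>2 + \<nu> * (LINT t|time T. (nrm \<Omega> (lap \<Omega> (\<lambda>p. u t p - uh t p)))\<^sup>2)
    \<le> (2 * gT + 2 * (nrm \<Omega> (grad \<Omega> (uh T)))\<^sup>2) + \<nu> * (2 * IA + 2 * ID)"
    using eT eL const_pos by (intro add_mono mult_left_mono) auto
  also have "\<dots> = 2 * gT + 2 * \<nu> * IA + 2 * ((nrm \<Omega> (grad \<Omega> (uh T)))\<^sup>2 + \<nu> * ID)" by (simp add: algebra_simps)
  also have "\<dots> \<le> 2 * gT + 2 * \<nu> * IA + 2 * (2 ^ N * ((2 * g0 + 2 * e0) + FF))"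
  proof -
    have "2 ^ N * ((nrm \<Omega> (grad \<Omega> (uh 0)))\<^sup>2 + FF) \<le> 2 ^ N * ((2 * g0 + 2 * e0) + FF)"
      using uh0 by (intro mult_left_mono add_right_mono) auto
    with uhT have "(nrm \<Omega> (grad \<Omega> (uh T)))\<^sup>2 + \<nu> * ID \<le> 2 ^ N * ((2 * g0 + 2 * e0) + FF)" by (rule order_trans)
    then show ?thesis by simp
  qed
  \<comment> \<open>Terms without e0 are written with a factor 1, which the next step replaces by e0
    + R.\<close>
  also have "\<dots> = (2 * gT + 2 * \<nu> * IA) * 1 + 2 ^ N * ((4 * g0 + 2 * FF) * 1 + 4 * e0)" by (simp add: algebra_simps)
  also have "\<dots> \<le> (2 * gT + 2 * \<nu> * IA) * (e0 + R) + 2 ^ N * ((4 * g0 + 2 * FF) * (e0 + R) + 4 * (e0 + R))"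
    using nonneg R const_pos by (intro add_mono mult_left_mono) auto
  also have "\<dots> = (2 * gT + 2 * \<nu> * IA + 2 ^ N * (4 + 4 * g0 + 2 * FF)) * (e0 + R)" by (simp add: algebra_simps)
  finally show ?thesis
    unfolding e0_def g0_def gT_def IA_def FF_def .
qed

end

section \<open>Passage to the infimum and choice of the constant\<close>

lemma ereal_le_mult_INF:
  fixes f :: "'i \<Rightarrow> real"
  assumes "0 < C" "\<And>i. i \<in> I \<Longrightarrow> L \<le> C * (e + f i)"
  shows "ereal L \<le> ereal C * (ereal e + (INF i\<in>I. ereal (f i)))"
proof -
  \<comment> \<open>Dividing by \<open>C\<close> and subtracting \<open>e\<close> leaves a real
    number below every term, hence below the infimum; over an empty index set the latter is
    \<infinity>.\<close>
  have "ereal (L / C - e) \<le> (INF i\<in>I. ereal (f i))"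
    using assms by (intro INF_greatest) (simp add: field_simps)
  then have "ereal e + ereal (L / C - e) \<le> ereal e + (INF i\<in>I. ereal (f i))"
    by (rule add_left_mono)
  then have "ereal C * (ereal e + ereal (L / C - e)) \<le> ereal C * (ereal e + (INF i\<in>I. ereal (f i)))"
    using assms(1) by (intro ereal_mult_left_mono) auto
  then show ?thesis using assms(1) by simp
qed

context flow begin

lemma unique_solution_AE:
  assumes "unique_solution a b T (weak_solution a b T Rey Ros F V u0) u"
    and "unique_solution a b T (weak_solution a b T Rey Ros F V u0) v" and "t \<in> {0..T}"
  shows "AE p in lebesgue_on \<Omega>. v t p = u t p"
  using assms unfolding unique_solution_def by blast

lemma approx_error_nonneg: "0 \<le> approx_error \<Omega> T \<eta> \<eta>'"
  unfolding approx_error_def by (intro add_nonneg_nonneg Bochner_Integration.integral_nonneg zero_le_power2)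

text \<open>\<open>C\<close> is fixed before \<psi>, so one solution \<open>u\<close> is picked
  whenever there is one. Any other \<psi> has the same gradients and Laplacians at all times in
  [0,T], hence the same norms. If there is no solution the claim is vacuous.\<close>

lemma error_estimate:
  "\<exists>C>0. \<forall>\<psi> h X \<psi>0h \<psi>h.
    unique_solution a b T (weak_solution a b T Rey Ros F (H20 a b) \<psi>0) \<psi> \<longrightarrow>
    integrable (time T) (\<lambda>t. (nrm \<Omega> (lap \<Omega> (\<psi> t))) ^ 4) \<longrightarrow>
    fe_space a b h X \<longrightarrow> \<psi>0h \<in> X \<longrightarrow>
    unique_solution a b T (discrete_solution a b T Rey Ros F X \<psi>0h) \<psi>h \<longrightarrow>
    ereal ((nrm \<Omega> (grad \<Omega> (\<lambda>p. \<psi> T p - \<psi>h T p)))\<^sup>2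
           + inverse Rey * (LINT t|time T. (nrm \<Omega> (lap \<Omega> (\<lambda>p. \<psi> t p - \<psi>h t p)))\<^sup>2))
    \<le> ereal C * (ereal ((nrm \<Omega> (grad \<Omega> (\<lambda>p. \<psi> 0 p - \<psi>h 0 p)))\<^sup>2)
        + (INF (\<mu>, \<eta>') \<in> admissible a b T X \<psi>.
             ereal (approx_error \<Omega> T (\<lambda>t p. \<psi> t p - \<mu> t p) \<eta>')))"
proof (cases "\<exists>u. unique_solution a b T (weak_solution a b T Rey Ros F (H20 a b) \<psi>0) u")
  case False
  then show ?thesis by (intro exI[of _ 1]) auto
next
  case True
  then obtain u where u: "unique_solution a b T (weak_solution a b T Rey Ros F (H20 a b) \<psi>0) u" by blast
  have in0: "0 \<in> {0..T}" and inT: "T \<in> {0..T}" using pos by auto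
  \<comment> \<open>If this fourth power is not integrable the value is the default 0; then no
    \<psi> meets the integrability premise, because its Laplacian is that of
    \<open>u\<close>.\<close>
  define A4 where "A4 = (LINT t|time T. (nrm \<Omega> (lap \<Omega> (u t)))^4)"
  define A2 where "A2 = (LINT t|time T. (nrm \<Omega> (lap \<Omega> (u t)))\<^sup>2)"
  define FF where "FF = \<rho>\<^sup>2 / \<nu> * (LINT t|time T. (dual_norm a b (F t))\<^sup>2)"
  \<comment> \<open>\<open>Gronwall\<close> counts halves of the exponent, hence the factor 2.
    \<open>N1\<close> serves the case of a small L4 norm and \<open>N2\<close> the other
    one.\<close>
  obtain N1 where N1: "2 * ((1 + \<rho> * \<Gamma>\<^sub>0 * P + 2 * (\<rho> * P)) * T + C\<^sub>4 * (A4 + 1)) \<le> real N1"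
    using real_arch_simple by blast
  obtain N2 where N2: "2 * (2 * (\<rho> * P) * T) \<le> real N2"
    using real_arch_simple by blast
  define C1 where "C1 = 2 + 2 * \<nu> + 2 * 2 ^ N1 * (4 + C\<^sub>d + 4 * \<Gamma>\<^sup>2 / \<nu> * (8 * sqrt A4 + 2))"
  define C2 where "C2 = 2 * (nrm \<Omega> (grad \<Omega> (u T)))\<^sup>2 + 2 * \<nu> * A2 + 2 ^ N2 * (4 + 4 * (nrm \<Omega> (grad \<Omega> (u 0)))\<^sup>2 + 2 * FF)"
  have nonneg: "0 \<le> A4" "0 \<le> A2" "0 \<le> FF"
    unfolding A4_def A2_def FF_def using const_pos
    by (auto simp: Bochner_Integration.integral_nonneg intro!: mult_nonneg_nonneg divide_nonneg_nonneg)
  have "0 \<le> C\<^sub>d" using const_pos \<Gamma>_pos by (simp add: C\<^sub>d_def)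
  then have C1: "0 < C1"
    unfolding C1_def using const_pos nonneg
    by (intro add_pos_nonneg mult_nonneg_nonneg add_nonneg_nonneg divide_nonneg_nonneg) auto
  have C2: "0 \<le> C2"
    unfolding C2_def using const_pos nonneg by (intro add_nonneg_nonneg mult_nonneg_nonneg) auto
  show ?thesis
  \<comment> \<open>In either case the error is at most \<open>C1\<close> or \<open>C2\<close> times
    the same nonnegative quantity, so the sum serves both.\<close>
  proof (intro exI[of _ "C1 + C2"] conjI allI impI)
    show "0 < C1 + C2" using C1 C2 by simp
    fix \<psi> h X \<psi>0h \<psi>h
    assume \<psi>: "unique_solution a b T (weak_solution a b T Rey Ros F (H20 a b) \<psi>0) \<psi>"
      and i4: "integrable (time T) (\<lambda>t. (nrm \<Omega> (lap \<Omega> (\<psi> t))) ^ 4)"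
      and X: "fe_space a b h X"
      and \<psi>h: "unique_solution a b T (discrete_solution a b T Rey Ros F X \<psi>0h) \<psi>h"
    have sol: "weak_solution a b T Rey Ros F (H20 a b) \<psi>0 \<psi>" and solh: "discrete_solution a b T Rey Ros F X \<psi>0h \<psi>h"
      using \<psi> \<psi>h by (simp_all add: unique_solution_def)
    note ae = unique_solution_AE[OF u \<psi>]
    have A4: "(LINT t|time T. (nrm \<Omega> (lap \<Omega> (\<psi> t)))^4) = A4" and A2: "(LINT t|time T. (nrm \<Omega> (lap \<Omega> (\<psi> t)))\<^sup>2) = A2"
      unfolding A4_def A2_def by (intro Bochner_Integration.integral_cong refl; simp add: lap_cong[OF ae])+
    have g: "grad \<Omega> (\<psi> 0) = grad \<Omega> (u 0)" "grad \<Omega> (\<psi> T) = grad \<Omega> (u T)"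
      using grad_cong[OF ae[OF in0]] grad_cong[OF ae[OF inT]] .
    define e0 where "e0 = (nrm \<Omega> (grad \<Omega> (\<lambda>p. \<psi> 0 p - \<psi>h 0 p)))\<^sup>2"
    define L where "L = (nrm \<Omega> (grad \<Omega> (\<lambda>p. \<psi> T p - \<psi>h T p)))\<^sup>2
           + \<nu> * (LINT t|time T. (nrm \<Omega> (lap \<Omega> (\<lambda>p. \<psi> t p - \<psi>h t p)))\<^sup>2)"
    have "L \<le> (C1 + C2) * (e0 + approx_error \<Omega> T (\<lambda>t p. \<psi> t p - \<mu> t p) \<eta>')"
      if adm: "(\<mu>, \<eta>') \<in> admissible a b T X \<psi>" for \<mu> \<eta>'
    proof -
      let ?R = "approx_error \<Omega> T (\<lambda>t p. \<psi> t p - \<mu> t p) \<eta>'"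
      have R: "0 \<le> e0 + ?R" using approx_error_nonneg by (simp add: e0_def add_nonneg_nonneg)
      have "L \<le> C1 * (e0 + ?R) \<or> L \<le> C2 * (e0 + ?R)"
      proof (cases "(LINT t|time T. (nrm \<Omega> (lap \<Omega> (\<lambda>p. \<psi> t p - \<mu> t p)))^4) \<le> 1")
        case True
        have "(1 + \<rho> * \<Gamma>\<^sub>0 * P + 2 * (\<rho> * P)) * T + C\<^sub>4 * ((LINT t|time T. (nrm \<Omega> (lap \<Omega> (\<psi> t)))^4) + 1) \<le> real N1 / 2"
          using N1 unfolding A4 by simp
        from error_estimate_small[OF X sol i4 solh adm True this] show ?thesis
          unfolding A4 L_def e0_def C1_def by blast
      next
        case False
        have "2 * (\<rho> * P) * T \<le> real N2 / 2" using N2 by simp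
        from error_bound_large[OF X sol solh this approx_error_ge[OF adm False]] show ?thesis
          unfolding A2 g FF_def[symmetric] L_def e0_def C2_def by blast
      qed
      moreover have "0 \<le> C1 * (e0 + ?R)" "0 \<le> C2 * (e0 + ?R)"
        using C1 C2 R by (auto intro: mult_nonneg_nonneg)
      ultimately show ?thesis unfolding distrib_right by linarith
    qed
    then have "ereal L \<le> ereal (C1 + C2) * (ereal e0 + (INF i\<in>admissible a b T X \<psi>. ereal (case i of (\<mu>, \<eta>') \<Rightarrow> approx_error \<Omega> T (\<lambda>t p. \<psi> t p - \<mu> t p) \<eta>')))"
      using C1 C2 by (intro ereal_le_mult_INF) auto
    then show "ereal ((nrm \<Omega> (grad \<Omega> (\<lambda>p. \<psi> T p - \<psi>h T p)))\<^sup>2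
           + inverse Rey * (LINT t|time T. (nrm \<Omega> (lap \<Omega> (\<lambda>p. \<psi> t p - \<psi>h t p)))\<^sup>2))
    \<le> ereal (C1 + C2) * (ereal ((nrm \<Omega> (grad \<Omega> (\<lambda>p. \<psi> 0 p - \<psi>h 0 p)))\<^sup>2)
        + (INF (\<mu>, \<eta>') \<in> admissible a b T X \<psi>.
             ereal (approx_error \<Omega> T (\<lambda>t p. \<psi> t p - \<mu> t p) \<eta>')))"
      unfolding L_def e0_def \<nu>_def by (simp add: case_prod_beta')
  qed
qed

end

theorem theorem1:
  fixes a b :: "real \<times> real" and \<Omega> :: "(real \<times> real) set"
    and T Rey Ros \<Gamma>\<^sub>0 \<Gamma>\<^sub>1 \<Gamma>\<^sub>2 \<Gamma>\<^sub>3 \<Gamma>\<^sub>4 :: real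
    and F :: "real \<Rightarrow> (real \<times> real \<Rightarrow> real) \<Rightarrow> real"
    and \<psi>0 :: "real \<times> real \<Rightarrow> real"
  assumes rect: "\<Omega> = box a b" "\<Omega> \<noteq> {}"
    and pos: "T > 0" "Rey > 0" "Ros > 0"
    and F: "AE t in time T. F t \<in> dual_H20 a b"
           "integrable (time T) (\<lambda>t. (dual_norm a b (F t))\<^sup>2)"
    and \<Gamma>_pos: "\<Gamma>\<^sub>0 > 0" "\<Gamma>\<^sub>1 > 0" "\<Gamma>\<^sub>2 > 0" "\<Gamma>\<^sub>3 > 0" "\<Gamma>\<^sub>4 > 0"
    and \<Gamma>\<^sub>0: "\<And>u. u \<in> H20 a b \<Longrightarrow> nrm \<Omega> (grad \<Omega> u) \<le> \<Gamma>\<^sub>0 * nrm \<Omega> (lap \<Omega> u)"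
    and \<Gamma>\<^sub>1: "\<And>u v w. u \<in> H20 a b \<Longrightarrow> v \<in> H20 a b \<Longrightarrow> w \<in> H20 a b \<Longrightarrow>
              trilin \<Omega> u v w \<le> \<Gamma>\<^sub>1 * semi2 \<Omega> u * semi2 \<Omega> v * semi2 \<Omega> w"
    and \<Gamma>\<^sub>2: "\<And>u w. u \<in> H20 a b \<Longrightarrow> w \<in> H20 a b \<Longrightarrow>
              ip \<Omega> (dx \<Omega> u) w \<le> \<Gamma>\<^sub>2 * semi2 \<Omega> u * semi2 \<Omega> w"
    and \<Gamma>\<^sub>3: "\<And>u v w. u \<in> H20 a b \<Longrightarrow> v \<in> H20 a b \<Longrightarrow> w \<in> H20 a b \<Longrightarrow>
              trilin \<Omega> u v w \<le> \<Gamma>\<^sub>3 * nrm \<Omega> (lap \<Omega> u) * nrm \<Omega> (lap \<Omega> v)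
                * sqrt (nrm \<Omega> (grad \<Omega> w)) * sqrt (nrm \<Omega> (lap \<Omega> w))"
    and \<Gamma>\<^sub>4: "\<And>u v w. u \<in> H20 a b \<Longrightarrow> v \<in> H20 a b \<Longrightarrow> w \<in> H20 a b \<Longrightarrow>
              trilin \<Omega> u v w \<le> \<Gamma>\<^sub>4 * sqrt (nrm \<Omega> (grad \<Omega> u)) * sqrt (nrm \<Omega> (lap \<Omega> u))
                * nrm \<Omega> (lap \<Omega> v) * nrm \<Omega> (lap \<Omega> w)"
  shows "\<exists>C>0. \<forall>\<psi> h X \<psi>0h \<psi>h.
    unique_solution a b T (weak_solution a b T Rey Ros F (H20 a b) \<psi>0) \<psi> \<longrightarrow>
    integrable (time T) (\<lambda>t. (nrm \<Omega> (lap \<Omega> (\<psi> t))) ^ 4) \<longrightarrow>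
    fe_space a b h X \<longrightarrow> \<psi>0h \<in> X \<longrightarrow>
    unique_solution a b T (discrete_solution a b T Rey Ros F X \<psi>0h) \<psi>h \<longrightarrow>
    ereal ((nrm \<Omega> (grad \<Omega> (\<lambda>p. \<psi> T p - \<psi>h T p)))\<^sup>2
           + inverse Rey * (LINT t|time T. (nrm \<Omega> (lap \<Omega> (\<lambda>p. \<psi> t p - \<psi>h t p)))\<^sup>2))
    \<le> ereal C * (ereal ((nrm \<Omega> (grad \<Omega> (\<lambda>p. \<psi> 0 p - \<psi>h 0 p)))\<^sup>2)
        + (INF (\<mu>, \<eta>') \<in> admissible a b T X \<psi>.
             ereal (approx_error \<Omega> T (\<lambda>t p. \<psi> t p - \<mu> t p) \<eta>')))"
proof -
  obtain p where "p \<in> box a b" using rect by blast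
  then have "fst a < fst b" "snd a < snd b" by (auto simp: mem_box_plane)
  then interpret flow a b T Rey Ros \<Gamma>\<^sub>0 \<Gamma>\<^sub>3 F
    using pos F \<Gamma>_pos(1,4) \<Gamma>\<^sub>0 \<Gamma>\<^sub>3 unfolding rect(1) by unfold_locales
  show ?thesis unfolding rect(1) by (rule error_estimate)
qed

end
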